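(* Let $A\subset\mathbb{R}^n$ have non-empty interior and let $Q\subset A$ be countable and dense in the interior of $A$. Then $E:=A\setminus Q$ is not $(n/p,p)$-null, and hence $s_E(p)=n/p$, for all $1<p<\infty$.
   Context: For $s\in\mathbb{R}$, $1<p<\infty$, $H^{s,p}=H^{s,p}(\mathbb{R}^n)$ is the Bessel potential Sobolev space of tempered distributions $u$ with $\mathcal{F}^{-1}[(1+|\xi|^2)^{s/2}\mathcal{F}u]\in L^p(\mathbb{R}^n)$ ($\mathcal{F}$ the Fourier transform). A set $E$ is $(s,p)$-null if no non-zero element of $H^{s,p}$ has (distributional) support contained in $E$. The nullity threshold is $s_E(p)=\inf\{s: E\text{ is }(s,p)\text{-null}\}$; $E$ is $(s,p)$-null for $s>s_E(p)$ and not for $s<s_E(p)$. *)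

theory Defs
  imports "HOL-Analysis.Analysis"
begin

text \<open>Functions on R^n are modelled as complex-valued functions on real^'n,
  with n = CARD('n).  Tempered distributions are modelled as complex-valued
  functionals; only their values on Schwartz functions matter.\<close>

type_synonym 'n test = "real^'n \<Rightarrow> complex"
type_synonym 'n distr = "'n test \<Rightarrow> complex"

fun pdiff :: "'n::finite list \<Rightarrow> 'n test \<Rightarrow> 'n test" where
  "pdiff [] f = f"
| "pdiff (i # is) f = (\<lambda>x. frechet_derivative (pdiff is f) (at x) (axis i 1))"

definition smooth_fun :: "'n::finite test \<Rightarrow> bool" where
  "smooth_fun f \<longleftrightarrow> (\<forall>is x. pdiff is f differentiable (at x))"

definition schwartz :: "'n::finite test set" where
  "schwartz = {f. smooth_fun f \<and>
     (\<forall>is (k::nat). bounded (range (\<lambda>x. (1 + norm x) ^ k * norm (pdiff is f x))))}"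

definition test_fun :: "'n::finite test set" where
  "test_fun = {f. smooth_fun f \<and> compact (closure {x. f x \<noteq> 0})}"

definition schwartz_seminorm :: "nat \<Rightarrow> 'n::finite test \<Rightarrow> real" where
  "schwartz_seminorm N f = Sup {(1 + norm x) ^ k * norm (pdiff is f x) | x k is.
      k \<le> N \<and> length is \<le> N}"

definition tempered :: "'n::finite distr \<Rightarrow> bool" where
  "tempered u \<longleftrightarrow>
     (\<forall>f\<in>schwartz. \<forall>g\<in>schwartz. u (\<lambda>x. f x + g x) = u f + u g) \<and>
     (\<forall>f\<in>schwartz. \<forall>c. u (\<lambda>x. c * f x) = c * u f) \<and>
     (\<exists>C N. \<forall>f\<in>schwartz. norm (u f) \<le> C * schwartz_seminorm N f)"

definition fourier :: "'n::finite test \<Rightarrow> 'n test" where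
  "fourier f = (\<lambda>\<xi>. integral\<^sup>L lborel (\<lambda>x. f x * cis (- (x \<bullet> \<xi>))))"

definition ifourier :: "'n::finite test \<Rightarrow> 'n test" where
  "ifourier f = (\<lambda>x. complex_of_real ((2 * pi) powr (- real CARD('n))) *
      integral\<^sup>L lborel (\<lambda>\<xi>. f \<xi> * cis (x \<bullet> \<xi>)))"

definition dist_fourier :: "'n::finite distr \<Rightarrow> 'n distr" where
  "dist_fourier u = (\<lambda>\<phi>. u (fourier \<phi>))"

definition dist_ifourier :: "'n::finite distr \<Rightarrow> 'n distr" where
  "dist_ifourier u = (\<lambda>\<phi>. u (ifourier \<phi>))"

definition bessel_symbol :: "real \<Rightarrow> real^'n::finite \<Rightarrow> complex" where
  "bessel_symbol s \<xi> = complex_of_real ((1 + (norm \<xi>)\<^sup>2) powr (s / 2))"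

definition dist_mult :: "(real^'n::finite \<Rightarrow> complex) \<Rightarrow> 'n distr \<Rightarrow> 'n distr" where
  "dist_mult m u = (\<lambda>\<phi>. u (\<lambda>x. m x * \<phi> x))"

definition Lp_distr :: "real \<Rightarrow> 'n::finite distr \<Rightarrow> bool" where
  "Lp_distr p u \<longleftrightarrow> (\<exists>g :: 'n test. g \<in> borel_measurable lborel \<and>
      integrable lborel (\<lambda>x. norm (g x) powr p) \<and>
      (\<forall>\<phi>\<in>schwartz. u \<phi> = integral\<^sup>L lborel (\<lambda>x. g x * \<phi> x)))"

definition bessel_space :: "real \<Rightarrow> real \<Rightarrow> 'n::finite distr set" where
  "bessel_space s p = {u. tempered u \<and>
      Lp_distr p (dist_ifourier (dist_mult (bessel_symbol s) (dist_fourier u)))}"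

definition zero_distr :: "'n::finite distr \<Rightarrow> bool" where
  "zero_distr u \<longleftrightarrow> (\<forall>\<phi>\<in>schwartz. u \<phi> = 0)"

definition dist_support :: "'n::finite distr \<Rightarrow> (real^'n) set" where
  "dist_support u = - {x. \<exists>U. open U \<and> x \<in> U \<and>
      (\<forall>\<phi>\<in>test_fun. closure {y. \<phi> y \<noteq> 0} \<subseteq> U \<longrightarrow> u \<phi> = 0)}"

definition null_set :: "real \<Rightarrow> real \<Rightarrow> (real^'n::finite) set \<Rightarrow> bool" where
  "null_set s p E \<longleftrightarrow> (\<forall>u\<in>bessel_space s p. dist_support u \<subseteq> E \<longrightarrow> zero_distr u)"

definition nullity_threshold :: "real \<Rightarrow> (real^'n::finite) set \<Rightarrow> real" where
  "nullity_threshold p E = Inf {s. null_set s p E}"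

end

theory Submission
  imports Defs "HOL-Probability.Probability"
begin

text \<open>Write n for the dimension and J s for the Fourier multiplier of symbol
  (1 + |xi|^2) powr (s/2).  Negative orders are convolutions with a probability density, the
  Bessel kernel, which is a Gamma-weighted superposition of heat kernels.  Hence the spaces
  decrease in s, and for s > n/p an element is given by a continuous function: it is nonzero on
  an open subset of its support, and such a set must meet the dense set Q.

  At s = n/p one starts from a bump h supported in the interior of A and multiplies it
  successively by factors 1 - f that vanish near the N-th point of Q.  The cutoff f is chosen
  after the smooth function h that it multiplies, so that only the following qualitative fact is
  needed: for fixed smooth h there are f equal to 1 near q for which h f is arbitrarily small in
  the space.  Rescaled bumps at q have bounded norm, because n/p is the scale-invariant order, and
  J s maps them to functions concentrated at their own scale; the average of M of them at dyadic
  scales therefore has p-th power of the norm of order M powr (1 - p).  The products converge to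
  a nonzero bounded function vanishing near every point of Q.\<close>

section \<open>Smooth, slowly growing and Schwartz functions\<close>

text \<open>Product estimates would cost a constant at each of infinitely many factors 1 - f, and
  the derivatives of h are out of control after many steps. With h fixed first, h f is an average of
  functions h times bump, whose constants may depend on h in any way, because the number M of scales
  is chosen last. The gain needs a genuine separation of scales. The potential of a bump of width e
  has size e powr (-s) up to distance e and a tail like the power -n of the distance. For 0 < s < n
  a dyadic sum of such profiles is comparable to its largest term, so the p-th power of the sum
  costs no more than the sum of the p-th powers. Here p > 1 enters three times: in s = n/p < n, in
  the integrability of the tail, and in the decay of M powr (1 - p). Since n/p is in general no even
  integer, the potential is nonlocal. Its even part is a power of 1 - Laplacian, which keeps
  supports; the remaining fractional part is an integral of increments of the heat semigroup.
  Nonvanishing of the limit is secured by a second smallness condition, in L1, on each removed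
  piece: the total loss stays below half of the initial mass.\<close>

lemma pdiff_append: "pdiff (is @ js) f = pdiff is (pdiff js f)"
  by (induction "is") auto

lemma pdiff_eqI:
  assumes "\<And>x. (f has_derivative D x) (at x)"
  shows "pdiff [i] f = (\<lambda>x. D x (axis i 1))"
  using frechet_derivative_at[OF assms] by auto

lemma smooth_fun_differentiable: "smooth_fun f \<Longrightarrow> f differentiable (at x)"
  unfolding smooth_fun_def by (metis pdiff.simps(1))

lemma smooth_fun_pdiff: "smooth_fun f \<Longrightarrow> smooth_fun (pdiff is f)"
  unfolding smooth_fun_def by (metis pdiff_append)

lemma smooth_fun_pdiff_differentiable: "smooth_fun f \<Longrightarrow> pdiff is f differentiable (at x)"
  unfolding smooth_fun_def by blast

lemma smooth_fun_has_derivative: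
  "smooth_fun f \<Longrightarrow> (pdiff is f has_derivative frechet_derivative (pdiff is f) (at x)) (at x)"
  using smooth_fun_pdiff_differentiable frechet_derivative_works by blast

lemma smooth_fun_continuous_on: "smooth_fun f \<Longrightarrow> continuous_on S (pdiff is f)"
  by (meson continuous_at_imp_continuous_on differentiable_imp_continuous_within
      smooth_fun_pdiff_differentiable)

lemma smooth_fun_continuous: "smooth_fun f \<Longrightarrow> continuous_on S f"
  using smooth_fun_continuous_on[of f S "[]"] by simp

lemma pdiff_coinduct:
  assumes "P f" and "\<And>f i. P f \<Longrightarrow> P (pdiff [i] f)"
  shows "P (pdiff is f)"
proof (induction "is")
  case (Cons i "is")
  then show ?case using assms(2)[of "pdiff is f" i] by simp
qed (use assms in simp)

text \<open>Smoothness is proved by naming a class of differentiable functions that contains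
  \<open>f\<close> and is stable under first partial derivatives. The classes used are explicit: a
  slowly growing factor times a power of the weight, multiples of a character, Fourier transforms,
  quotients by powers of a fixed function.\<close>

lemma smooth_fun_coinduct:
  assumes "P f" and "\<And>f i. P f \<Longrightarrow> P (pdiff [i] f)"
    and "\<And>f x. P f \<Longrightarrow> f differentiable (at x)"
  shows "smooth_fun f"
  unfolding smooth_fun_def using assms(3) pdiff_coinduct[of P, OF assms(1,2)] by blast

lemma pdiff_const: "pdiff [i] (\<lambda>x. c) = (\<lambda>x. 0)"
  using pdiff_eqI[OF has_derivative_const, of i c] by simp

lemma smooth_fun_const: "smooth_fun (\<lambda>x. c)"
  by (rule smooth_fun_coinduct[of "\<lambda>f. \<exists>c. f = (\<lambda>x. c)"]) (auto simp: pdiff_const simp del: pdiff.simps)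

text \<open>All ways of distributing a word of derivatives over two factors, listed with repetition.
  The Leibniz rule then needs neither binomial coefficients nor multi-indices.\<close>

fun splits :: "'a list \<Rightarrow> ('a list \<times> 'a list) list" where
  "splits [] = [([], [])]"
| "splits (i # is) = map (\<lambda>(js, ks). (i # js, ks)) (splits is) @ map (\<lambda>(js, ks). (js, i # ks)) (splits is)"

lemma length_splits: "(js, ks) \<in> set (splits is) \<Longrightarrow> length js + length ks = length is"
  by (induction "is" arbitrary: js ks) auto

lemma has_derivative_sum_list:
  assumes "\<And>a. a \<in> set xs \<Longrightarrow> (F a has_derivative F' a) (at x)"
  shows "((\<lambda>x. \<Sum>a\<leftarrow>xs. F a x) has_derivative (\<lambda>h. \<Sum>a\<leftarrow>xs. F' a h)) (at x)"
  using assms by (induction xs) (auto intro!: has_derivative_add)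

lemma has_derivative_Leibniz:
  assumes f: "smooth_fun f" and g: "smooth_fun g"
  shows "((\<lambda>x. \<Sum>a\<leftarrow>xs. pdiff (fst a) f x * pdiff (snd a) g x) has_derivative
    (\<lambda>h. \<Sum>a\<leftarrow>xs. pdiff (fst a) f x * frechet_derivative (pdiff (snd a) g) (at x) h +
       frechet_derivative (pdiff (fst a) f) (at x) h * pdiff (snd a) g x)) (at x)"
  by (intro has_derivative_sum_list has_derivative_mult smooth_fun_has_derivative assms)

lemma pdiff_mult:
  assumes f: "smooth_fun f" and g: "smooth_fun g"
  shows "pdiff is (\<lambda>x. f x * g x) = (\<lambda>x. \<Sum>a\<leftarrow>splits is. pdiff (fst a) f x * pdiff (snd a) g x)"
proof (induction "is")
  case (Cons i "is")
  have "pdiff (i # is) (\<lambda>x. f x * g x) x =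
     (\<Sum>a\<leftarrow>splits is. pdiff (fst a) f x * pdiff (i # snd a) g x + pdiff (i # fst a) f x * pdiff (snd a) g x)" for x
    using frechet_derivative_at[OF has_derivative_Leibniz[OF f g, of "splits is" x]]
    by (simp add: Cons fun_eq_iff)
  also have "\<dots> x = (\<Sum>a\<leftarrow>splits (i # is). pdiff (fst a) f x * pdiff (snd a) g x)" for x
    by (simp add: comp_def case_prod_unfold sum_list_addf add.commute)
  finally show ?case by auto
qed simp

lemma smooth_fun_mult:
  assumes "smooth_fun f" "smooth_fun g"
  shows "smooth_fun (\<lambda>x. f x * g x)"
  unfolding smooth_fun_def pdiff_mult[OF assms]
  using has_derivative_Leibniz[OF assms] differentiable_def by blast

lemma pdiff_add:
  assumes f: "smooth_fun f" and g: "smooth_fun g"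
  shows "pdiff is (\<lambda>x. f x + g x) = (\<lambda>x. pdiff is f x + pdiff is g x)"
proof (induction "is")
  case (Cons i "is")
  have "((\<lambda>x. pdiff is f x + pdiff is g x) has_derivative (\<lambda>h. frechet_derivative (pdiff is f) (at x) h
     + frechet_derivative (pdiff is g) (at x) h)) (at x)" for x
    by (intro has_derivative_add smooth_fun_has_derivative assms)
  from pdiff_eqI[OF this, of i] show ?case by (simp add: Cons)
qed simp

lemma smooth_fun_add:
  assumes "smooth_fun f" "smooth_fun g"
  shows "smooth_fun (\<lambda>x. f x + g x)"
  unfolding smooth_fun_def pdiff_add[OF assms]
  using assms smooth_fun_pdiff_differentiable by (auto intro!: differentiable_add)

lemma pdiff_cmult:
  assumes f: "smooth_fun f"
  shows "pdiff is (\<lambda>x. c * f x) = (\<lambda>x. c * pdiff is f x)"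
proof (induction "is")
  case (Cons i "is")
  have "((\<lambda>x. c * pdiff is f x) has_derivative (\<lambda>h. c * frechet_derivative (pdiff is f) (at x) h)) (at x)" for x
    by (intro has_derivative_mult_right smooth_fun_has_derivative assms)
  from pdiff_eqI[OF this, of i] show ?case by (simp add: Cons)
qed simp

lemma smooth_fun_cmult: "smooth_fun f \<Longrightarrow> smooth_fun (\<lambda>x. c * f x)"
  by (intro smooth_fun_mult smooth_fun_const)

lemma smooth_fun_sum:
  "(\<And>a. a \<in> I \<Longrightarrow> smooth_fun (F a)) \<Longrightarrow> smooth_fun (\<lambda>x. \<Sum>a\<in>I. F a x)"
  by (induction I rule: infinite_finite_induct) (auto intro!: smooth_fun_add smooth_fun_const)

lemma pdiff_sum:
  assumes "\<And>a. a \<in> I \<Longrightarrow> smooth_fun (F a)"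
  shows "pdiff is (\<lambda>x. \<Sum>a\<in>I. F a x) = (\<lambda>x. \<Sum>a\<in>I. pdiff is (F a) x)"
  using assms
proof (induction I rule: infinite_finite_induct)
  case (insert a I)
  then show ?case by (simp add: pdiff_add smooth_fun_sum)
next
  case empty
  show ?case using pdiff_cmult[OF smooth_fun_const, of "is" 0 0] by simp
next
  case (infinite I)
  then show ?case using pdiff_cmult[OF smooth_fun_const, of "is" 0 0] by simp
qed

lemma pdiff_affine:
  assumes f: "smooth_fun f"
  shows "pdiff is (\<lambda>x. f (c *\<^sub>R (x - a))) = (\<lambda>x. of_real (c ^ length is) * pdiff is f (c *\<^sub>R (x - a)))"
proof (induction "is")
  case (Cons i "is")
  have "((\<lambda>x. of_real (c ^ length is) * pdiff is f (c *\<^sub>R (x - a))) has_derivative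
     (\<lambda>h. of_real (c ^ length is) * frechet_derivative (pdiff is f) (at (c *\<^sub>R (x - a))) (c *\<^sub>R (h - 0)))) (at x)" for x
    by (intro has_derivative_mult_right
        has_derivative_compose[of "\<lambda>x. c *\<^sub>R (x - a)", OF _ smooth_fun_has_derivative[OF f]]
        has_derivative_scaleR_right has_derivative_diff has_derivative_ident has_derivative_const)
  from pdiff_eqI[OF this, of i]
  have "pdiff (i # is) (\<lambda>x. f (c *\<^sub>R (x - a))) =
     (\<lambda>x. of_real (c ^ length is) * frechet_derivative (pdiff is f) (at (c *\<^sub>R (x - a))) (c *\<^sub>R axis i 1))"
    by (simp add: Cons)
  moreover have "frechet_derivative (pdiff is f) (at y) (c *\<^sub>R axis i 1) = of_real c * pdiff (i # is) f y" for y
    using smooth_fun_has_derivative[OF f, THEN has_derivative_linear]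
    by (metis linear_cmul pdiff.simps(2) scaleR_conv_of_real)
  ultimately show ?case by (simp add: mult_ac)
qed simp

lemma smooth_fun_affine:
  assumes f: "smooth_fun f"
  shows "smooth_fun (\<lambda>x. f (c *\<^sub>R (x - a)))"
  unfolding smooth_fun_def pdiff_affine[OF f]
proof (intro allI differentiable_mult differentiable_const)
  fix "is" x
  have "(pdiff is f \<circ> (\<lambda>x. c *\<^sub>R (x - a))) differentiable at x"
    by (intro differentiable_chain_at smooth_fun_pdiff_differentiable f derivative_intros)
  then show "(\<lambda>x. pdiff is f (c *\<^sub>R (x - a))) differentiable at x" by (simp add: comp_def)
qed

lemma pdiff_coord:
  "pdiff [i] (\<lambda>x. complex_of_real (x $ j)) = (\<lambda>x. if i = j then 1 else 0)"
proof -
  have "((\<lambda>x. complex_of_real (x $ j)) has_derivative (\<lambda>h. complex_of_real (h $ j))) (at x)" for x :: "real^'a"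
    by (intro has_derivative_of_real bounded_linear_imp_has_derivative bounded_linear_vec_nth)
  from pdiff_eqI[OF this, of i] show ?thesis by (auto simp: axis_def fun_eq_iff)
qed

lemma smooth_fun_coord: "smooth_fun (\<lambda>x. complex_of_real (x $ j))"
proof (rule smooth_fun_coinduct[of "\<lambda>f. f = (\<lambda>x. complex_of_real (x $ j)) \<or> (\<exists>c. f = (\<lambda>x. c))"])
  fix f :: "(real^'a) \<Rightarrow> complex" and x
  have "((\<lambda>x. complex_of_real (x $ j)) has_derivative (\<lambda>h. complex_of_real (h $ j))) (at x)"
    by (intro has_derivative_of_real bounded_linear_imp_has_derivative bounded_linear_vec_nth)
  then show "f = (\<lambda>x. complex_of_real (x $ j)) \<or> (\<exists>c. f = (\<lambda>x. c)) \<Longrightarrow> f differentiable at x"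
    by (auto simp: differentiable_def intro: has_derivative_const)
qed (auto simp: pdiff_coord pdiff_const simp del: pdiff.simps)

section \<open>Slowly growing multipliers\<close>

text \<open>The multiplier algebra O_M of the Schwartz class: the growth exponent may depend on the
  derivative.\<close>

definition slow :: "'n::finite test \<Rightarrow> bool" where
  "slow f \<longleftrightarrow> smooth_fun f \<and> (\<forall>is. \<exists>C k. \<forall>x. norm (pdiff is f x) \<le> C * (1 + norm x) ^ k)"

lemma slow_smooth: "slow f \<Longrightarrow> smooth_fun f"
  by (simp add: slow_def)

lemma slow_pdiff: "slow f \<Longrightarrow> slow (pdiff is f)"
  unfolding slow_def by (metis pdiff_append smooth_fun_pdiff)

lemma slow_bound:
  assumes "slow f" obtains C k where "C \<ge> 0" "\<And>x. norm (pdiff is f x) \<le> C * (1 + norm x) ^ k"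
proof -
  obtain C k where *: "\<And>x. norm (pdiff is f x) \<le> C * (1 + norm x) ^ k"
    using assms unfolding slow_def by blast
  from order_trans[OF norm_ge_zero *[of 0]] have "C \<ge> 0" by simp
  with * that show ?thesis by blast
qed

lemma slow_coinduct:
  assumes "P f" and "\<And>f i. P f \<Longrightarrow> P (pdiff [i] f)"
    and "\<And>f x. P f \<Longrightarrow> f differentiable (at x)"
    and "\<And>f. P f \<Longrightarrow> \<exists>C k. \<forall>x. norm (f x) \<le> C * (1 + norm x) ^ k"
  shows "slow f"
  unfolding slow_def
  using smooth_fun_coinduct[of P, OF assms(1-3)] assms(4) pdiff_coinduct[of P, OF assms(1,2)] by blast

lemma poly_growth_add:
  assumes "\<exists>C k. \<forall>x. norm (f x) \<le> C * (1 + norm x) ^ k" "\<exists>C k. \<forall>x. norm (g x) \<le> C * (1 + norm x) ^ k"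
  shows "\<exists>C k. \<forall>x::'a::real_normed_vector. norm (f x + g x :: complex) \<le> C * (1 + norm x) ^ k"
proof -
  obtain C k where 1: "\<And>x. norm (f x) \<le> C * (1 + norm x) ^ k" using assms(1) by blast
  obtain D l where 2: "\<And>x. norm (g x) \<le> D * (1 + norm x) ^ l" using assms(2) by blast
  have C: "C \<ge> 0" "D \<ge> 0" using order_trans[OF norm_ge_zero 1[of 0]] order_trans[OF norm_ge_zero 2[of 0]] by auto
  have "norm (f x + g x) \<le> (C + D) * (1 + norm x) ^ (max k l)" for x
  proof -
    have "norm (f x + g x) \<le> C * (1 + norm x) ^ k + D * (1 + norm x) ^ l"
      using norm_triangle_ineq[of "f x" "g x"] 1[of x] 2[of x] by linarith
    also have "\<dots> \<le> C * (1 + norm x) ^ (max k l) + D * (1 + norm x) ^ (max k l)"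
      using C by (intro add_mono mult_left_mono power_increasing) auto
    finally show ?thesis by (simp add: algebra_simps)
  qed
  then show ?thesis by blast
qed

lemma poly_growth_mult:
  assumes "\<exists>C k. \<forall>x. norm (f x) \<le> C * (1 + norm x) ^ k" "\<exists>C k. \<forall>x. norm (g x) \<le> C * (1 + norm x) ^ k"
  shows "\<exists>C k. \<forall>x::'a::real_normed_vector. norm (f x * g x :: complex) \<le> C * (1 + norm x) ^ k"
proof -
  obtain C k where 1: "\<And>x. norm (f x) \<le> C * (1 + norm x) ^ k" using assms(1) by blast
  obtain D l where 2: "\<And>x. norm (g x) \<le> D * (1 + norm x) ^ l" using assms(2) by blast
  have C: "C \<ge> 0" "D \<ge> 0" using order_trans[OF norm_ge_zero 1[of 0]] order_trans[OF norm_ge_zero 2[of 0]] by auto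
  have "norm (f x * g x) \<le> (C * D) * (1 + norm x) ^ (k + l)" for x
    using mult_mono[OF 1[of x] 2[of x]] C by (simp add: norm_mult power_add algebra_simps)
  then show ?thesis by blast
qed

lemma slow_add: assumes "slow f" "slow g" shows "slow (\<lambda>x. f x + g x)"
  using assms smooth_fun_add[of f g] unfolding slow_def
  by (auto simp: pdiff_add intro!: poly_growth_add)

lemma poly_growth_sum_list:
  assumes "\<And>a. a \<in> set xs \<Longrightarrow> \<exists>C k. \<forall>x. norm (F a x) \<le> C * (1 + norm x) ^ k"
  shows "\<exists>C k. \<forall>x::'a::real_normed_vector. norm (\<Sum>a\<leftarrow>xs. F a x :: complex) \<le> C * (1 + norm x) ^ k"
  using assms
proof (induction xs)
  case Nil
  show ?case by (auto intro!: exI[of _ 0])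
qed (auto intro!: poly_growth_add)

lemma slow_mult: assumes "slow f" "slow g" shows "slow (\<lambda>x. f x * g x)"
  using assms smooth_fun_mult[of f g] unfolding slow_def
  by (auto simp: pdiff_mult intro!: poly_growth_sum_list poly_growth_mult)

lemma slow_const: "slow (\<lambda>x. c)"
proof (rule slow_coinduct[of "\<lambda>f. \<exists>c. f = (\<lambda>x. c)"])
  fix f :: "(real^'a) \<Rightarrow> complex" assume "\<exists>c. f = (\<lambda>x. c)"
  then obtain c where "f = (\<lambda>x. c)" by blast
  then show "\<exists>C k. \<forall>x. cmod (f x) \<le> C * (1 + norm x) ^ k" by (intro exI[of _ "norm c"] exI[of _ 0]) auto
qed (auto simp: pdiff_const simp del: pdiff.simps)

lemma slow_coord: "slow (\<lambda>x. complex_of_real (x $ j))"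
proof (rule slow_coinduct[of "\<lambda>f. f = (\<lambda>x. complex_of_real (x $ j)) \<or> (\<exists>c. f = (\<lambda>x. c))"])
  fix f :: "(real^'a) \<Rightarrow> complex" assume "f = (\<lambda>x. complex_of_real (x $ j)) \<or> (\<exists>c. f = (\<lambda>x. c))"
  then show "\<exists>C k. \<forall>x. cmod (f x) \<le> C * (1 + norm x) ^ k"
  proof
    assume "f = (\<lambda>x. complex_of_real (x $ j))"
    then show ?thesis by (auto intro!: exI[of _ 1] order_trans[OF component_le_norm_cart])
  next
    assume "\<exists>c. f = (\<lambda>x. c)"
    then obtain c where "f = (\<lambda>x. c)" by blast
    then show ?thesis by (intro exI[of _ "norm c"] exI[of _ 0]) auto
  qed
qed (auto simp: pdiff_coord pdiff_const smooth_fun_coord[THEN smooth_fun_differentiable] simp del: pdiff.simps)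

lemma slow_sum:
  "(\<And>a. a \<in> I \<Longrightarrow> slow (F a)) \<Longrightarrow> slow (\<lambda>x. \<Sum>a\<in>I. F a x)"
  by (induction I rule: infinite_finite_induct) (auto intro!: slow_add slow_const)

section \<open>The weight 1 + |x|^2 and its real powers\<close>

abbreviation lam :: "real^'n::finite \<Rightarrow> real" where
  "lam x \<equiv> 1 + (norm x)\<^sup>2"

lemma lam_pos: "lam x > 0" by (simp add: add_pos_nonneg)

lemma norm_sq_sum: "(norm (x::real^'n::finite))\<^sup>2 = (\<Sum>i\<in>UNIV. (x $ i)\<^sup>2)"
  unfolding power2_norm_eq_inner by (simp add: inner_vec_def power2_eq_square)

lemma lam_sum: "complex_of_real (lam x) = 1 + (\<Sum>i\<in>UNIV. of_real (x $ i) * of_real (x $ i))"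
  unfolding norm_sq_sum by (simp add: power2_eq_square)

lemma slow_lam: "slow (\<lambda>x. complex_of_real (lam x))"
  unfolding lam_sum by (intro slow_add slow_const slow_sum slow_mult slow_coord)

lemma one_plus_norm_le: "1 + norm x \<le> 2 * lam x"
proof -
  have "0 \<le> (1 - norm x)\<^sup>2" "0 \<le> (norm x)\<^sup>2" by auto
  then have "2 * norm x \<le> 1 + (norm x)\<^sup>2" by (simp add: power2_diff)
  moreover have "1 + a \<le> 2 * (1 + b)" if "2 * a \<le> 1 + b" "0 \<le> b" for a b :: real using that by argo
  ultimately show ?thesis using \<open>0 \<le> (norm x)\<^sup>2\<close> by blast
qed

lemma lam_le: "lam x \<le> (1 + norm x)\<^sup>2"
  by (simp add: power2_eq_square algebra_simps)

lemma lam_powr_growth: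
  "\<exists>C k. \<forall>x::real^'n::finite. norm (complex_of_real (lam x powr r)) \<le> C * (1 + norm x) ^ k"
proof -
  define k where "k = nat \<lceil>\<bar>r\<bar>\<rceil>"
  have "lam x powr r \<le> 1 * (1 + norm x) ^ (2 * k)" for x :: "real^'n"
  proof -
    have "lam x powr r \<le> lam x powr (real k)"
      by (intro powr_mono) (auto simp: k_def, linarith)
    also have "\<dots> = lam x ^ k" by (simp add: powr_realpow lam_pos)
    also have "\<dots> \<le> ((1 + norm x)\<^sup>2) ^ k" by (intro power_mono lam_le) simp
    finally show ?thesis by (simp add: power_mult)
  qed
  then show ?thesis by (intro exI[of _ 1] exI[of _ "2 * k"]) (simp add: norm_of_real del: of_real_add)
qed

lemma has_derivative_lam_powr:
  "((\<lambda>x::real^'n::finite. complex_of_real (lam x powr r)) has_derivative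
     (\<lambda>h. complex_of_real (2 * r * (x \<bullet> h) * lam x powr (r - 1)))) (at x)"
proof -
  have 1: "((\<lambda>x::real^'n. 1 + x \<bullet> x) has_derivative (\<lambda>h. 0 + (x \<bullet> h + h \<bullet> x))) (at x)"
    by (intro derivative_intros)
  have "0 < 1 + x \<bullet> x" by (simp add: add_pos_nonneg)
  have "((\<lambda>x::real^'n. (1 + x \<bullet> x) powr r) has_derivative
      (\<lambda>h. (0 + (x \<bullet> h + h \<bullet> x)) * (r * (1 + x \<bullet> x) powr (r - 1)))) (at x)"
    using has_derivative_powr[OF 1, of "\<lambda>x. r" "\<lambda>_. 0"] \<open>0 < 1 + x \<bullet> x\<close>
    by (simp add: algebra_simps powr_diff)
  then have "((\<lambda>x::real^'n. (1 + x \<bullet> x) powr r) has_derivative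
      (\<lambda>h. 2 * r * (x \<bullet> h) * (1 + x \<bullet> x) powr (r - 1))) (at x)"
    by (rule has_derivative_eq_rhs) (auto simp: inner_commute)
  then show ?thesis unfolding power2_norm_eq_inner by (rule has_derivative_of_real)
qed

text \<open>Products m * lam powr r with m slow form a class stable under derivatives: a derivative
  lowers r by one and replaces m by \<open>pdiff [i] m * lam + 2 * r * x_i * m\<close>, which is
  slow again.\<close>

lemma slow_lam_powr: "slow (\<lambda>x. complex_of_real (lam x powr r))"
proof (rule slow_coinduct[of "\<lambda>f. \<exists>m r. slow m \<and> f = (\<lambda>x. m x * complex_of_real (lam x powr r))"])
  show "\<exists>m ra. slow m \<and> (\<lambda>x::real^'a. complex_of_real (lam x powr r)) = (\<lambda>x. m x * complex_of_real (lam x powr ra))"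
    using slow_const[of 1] by (intro exI[of _ "\<lambda>x. 1"] exI[of _ r]) simp
next
  fix f :: "(real^'a) \<Rightarrow> complex" and x
  assume "\<exists>m r. slow m \<and> f = (\<lambda>x. m x * complex_of_real (lam x powr r))"
  then obtain m r where *: "slow m" and f: "f = (\<lambda>x. m x * complex_of_real (lam x powr r))" by blast
  show "f differentiable at x" unfolding f
    by (rule differentiable_mult[OF smooth_fun_differentiable[OF slow_smooth[OF *]] differentiableI[OF has_derivative_lam_powr]])
  show "\<exists>C k. \<forall>x. norm (f x) \<le> C * (1 + norm x) ^ k" unfolding f
    using slow_bound[OF *, of "[]"] by (intro poly_growth_mult lam_powr_growth) (metis pdiff.simps(1))
next
  fix f :: "(real^'a) \<Rightarrow> complex" and i
  assume "\<exists>m r. slow m \<and> f = (\<lambda>x. m x * complex_of_real (lam x powr r))"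
  then obtain m r where *: "slow m" and f: "f = (\<lambda>x. m x * complex_of_real (lam x powr r))" by blast
  let ?m = "\<lambda>x. pdiff [i] m x * complex_of_real (lam x) + m x * (complex_of_real (2 * r) * of_real (x $ i))"
  have "slow ?m" by (intro slow_add slow_mult slow_pdiff slow_const slow_coord slow_lam *)
  moreover have "pdiff [i] f = (\<lambda>x. ?m x * complex_of_real (lam x powr (r - 1)))"
  proof -
    have "(f has_derivative (\<lambda>h. m x * complex_of_real (2 * r * (x \<bullet> h) * lam x powr (r - 1)) +
       frechet_derivative (pdiff [] m) (at x) h * complex_of_real (lam x powr r))) (at x)" for x
      unfolding f using smooth_fun_has_derivative[OF slow_smooth[OF *], of "[]" x]
      by (intro has_derivative_mult has_derivative_lam_powr) simp
    from pdiff_eqI[OF this, of i] have A: "pdiff [i] f = (\<lambda>x. m x * complex_of_real (2 * r * (x \<bullet> axis i 1) * lam x powr (r - 1)) +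
       frechet_derivative (pdiff [] m) (at x) (axis i 1) * complex_of_real (lam x powr r))" .
    have B: "complex_of_real (lam x powr r) = complex_of_real (lam x) * complex_of_real (lam x powr (r - 1))" for x
    proof -
      have "lam x powr r = lam x * lam x powr (r - 1)" using lam_pos[of x] by (simp add: powr_diff)
      then show ?thesis by (metis of_real_mult)
    qed
    show ?thesis
    proof
      fix x
      have "pdiff [i] f x = m x * (complex_of_real (2 * r) * of_real (x $ i) * complex_of_real (lam x powr (r - 1)))
          + pdiff [i] m x * (complex_of_real (lam x) * complex_of_real (lam x powr (r - 1)))"
        unfolding A B[symmetric] by (simp add: inner_axis)
      then show "pdiff [i] f x = ?m x * complex_of_real (lam x powr (r - 1))" by (simp add: ring_distribs mult_ac)
    qed
  qed
  ultimately show "\<exists>m r. slow m \<and> pdiff [i] f = (\<lambda>x. m x * complex_of_real (lam x powr r))" by blast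
qed

lemma slow_bessel_symbol: "slow (bessel_symbol s)"
  unfolding bessel_symbol_def[abs_def] by (rule slow_lam_powr)

section \<open>The Schwartz class\<close>

lemma schwartz_iff:
  "f \<in> schwartz \<longleftrightarrow> smooth_fun f \<and> (\<forall>is k. \<exists>C. \<forall>x. (1 + norm x) ^ k * norm (pdiff is f x) \<le> C)"
  unfolding schwartz_def bounded_iff by (auto simp: norm_mult abs_mult)

lemma schwartz_smooth: "f \<in> schwartz \<Longrightarrow> smooth_fun f"
  by (simp add: schwartz_iff)

lemma schwartz_bound: "f \<in> schwartz \<Longrightarrow> \<exists>C. \<forall>x. (1 + norm x) ^ k * norm (pdiff is f x) \<le> C"
  by (simp add: schwartz_iff)

lemma schwartz_pdiff: "f \<in> schwartz \<Longrightarrow> pdiff is f \<in> schwartz"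
  unfolding schwartz_iff by (metis pdiff_append smooth_fun_pdiff)

lemma schwartz_coinduct:
  assumes "P f" and "\<And>f i. P f \<Longrightarrow> P (pdiff [i] f)"
    and "\<And>f x. P f \<Longrightarrow> f differentiable (at x)"
    and "\<And>f k. P f \<Longrightarrow> \<exists>C. \<forall>x. (1 + norm x) ^ k * norm (f x) \<le> C"
  shows "f \<in> schwartz"
  unfolding schwartz_iff
  using smooth_fun_coinduct[of P, OF assms(1-3)] assms(4) pdiff_coinduct[of P, OF assms(1,2)] by blast

lemma rapid_add:
  assumes "\<exists>C. \<forall>x. (1 + norm x) ^ k * norm (f x) \<le> C" "\<exists>C. \<forall>x. (1 + norm x) ^ k * norm (g x) \<le> C"
  shows "\<exists>C. \<forall>x::'a::real_normed_vector. (1 + norm x) ^ k * norm (f x + g x :: complex) \<le> C"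
proof -
  obtain C where 1: "\<And>x. (1 + norm x) ^ k * norm (f x) \<le> C" using assms(1) by blast
  obtain D where 2: "\<And>x. (1 + norm x) ^ k * norm (g x) \<le> D" using assms(2) by blast
  have "(1 + norm x) ^ k * norm (f x + g x) \<le> C + D" for x
    using mult_left_mono[OF norm_triangle_ineq[of "f x" "g x"], of "(1 + norm x) ^ k"] 1[of x] 2[of x]
    by (simp add: algebra_simps)
  then show ?thesis by blast
qed

lemma rapid_sum_list:
  assumes "\<And>a. a \<in> set xs \<Longrightarrow> \<exists>C. \<forall>x. (1 + norm x) ^ k * norm (F a x) \<le> C"
  shows "\<exists>C. \<forall>x::'a::real_normed_vector. (1 + norm x) ^ k * norm (\<Sum>a\<leftarrow>xs. F a x :: complex) \<le> C"
  using assms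
proof (induction xs)
  case Nil
  show ?case by (auto intro!: exI[of _ 0])
qed (auto intro!: rapid_add)

lemma schwartz_add:
  assumes "f \<in> schwartz" "g \<in> schwartz" shows "(\<lambda>x. f x + g x) \<in> schwartz"
  using assms smooth_fun_add[of f g] unfolding schwartz_iff
  by (auto simp: pdiff_add intro!: rapid_add)

lemma schwartz_slow_mult:
  assumes m: "slow m" and f: "f \<in> schwartz" shows "(\<lambda>x. m x * f x) \<in> schwartz"
  unfolding schwartz_iff pdiff_mult[OF slow_smooth[OF m] schwartz_smooth[OF f]]
proof (intro conjI allI rapid_sum_list)
  show "smooth_fun (\<lambda>x. m x * f x)" by (intro smooth_fun_mult slow_smooth[OF m] schwartz_smooth[OF f])
  fix k and a :: "'a list \<times> 'a list"
  obtain C l where 1: "C \<ge> 0" "\<And>x. norm (pdiff (fst a) m x) \<le> C * (1 + norm x) ^ l" using slow_bound[OF m] by metis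
  \<comment> \<open>The growth exponent \<open>l\<close> of the multiplier is paid for with
    \<open>l\<close> additional orders of decay of \<open>f\<close>.\<close>
  obtain D where 2: "\<And>x. (1 + norm x) ^ (k + l) * norm (pdiff (snd a) f x) \<le> D" using schwartz_bound[OF f] by metis
  have "(1 + norm x) ^ k * norm (pdiff (fst a) m x * pdiff (snd a) f x) \<le> C * D" for x
  proof -
    have "(1 + norm x) ^ k * norm (pdiff (fst a) m x * pdiff (snd a) f x)
        \<le> (1 + norm x) ^ k * ((C * (1 + norm x) ^ l) * norm (pdiff (snd a) f x))"
      unfolding norm_mult by (intro mult_left_mono mult_right_mono 1) auto
    also have "\<dots> = C * ((1 + norm x) ^ (k + l) * norm (pdiff (snd a) f x))" by (simp add: power_add algebra_simps)
    also have "\<dots> \<le> C * D" using 1 2 by (intro mult_left_mono) auto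
    finally show ?thesis .
  qed
  then show "\<exists>C. \<forall>x. (1 + norm x) ^ k * norm (pdiff (fst a) m x * pdiff (snd a) f x) \<le> C" by blast
qed

lemma schwartz_cmult: "f \<in> schwartz \<Longrightarrow> (\<lambda>x. c * f x) \<in> schwartz"
  by (intro schwartz_slow_mult slow_const)

lemma schwartz_diff:
  assumes "f \<in> schwartz" "g \<in> schwartz" shows "(\<lambda>x. f x - g x) \<in> schwartz"
  using schwartz_add[OF assms(1) schwartz_cmult[OF assms(2), of "-1"]] by simp

lemma schwartz_0: "(\<lambda>x. 0) \<in> schwartz"
  using smooth_fun_const[of 0] unfolding schwartz_iff
  by (auto simp: pdiff_sum[of "{}", simplified])

lemma schwartz_sum:
  "(\<And>a. a \<in> I \<Longrightarrow> F a \<in> schwartz) \<Longrightarrow> (\<lambda>x. \<Sum>a\<in>I. F a x) \<in> schwartz"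
  by (induction I rule: infinite_finite_induct) (auto intro!: schwartz_add schwartz_0)

lemma schwartz_affine:
  assumes f: "f \<in> schwartz" and "c \<noteq> 0" shows "(\<lambda>x. f (c *\<^sub>R (x - a))) \<in> schwartz"
  unfolding schwartz_iff pdiff_affine[OF schwartz_smooth[OF f]]
proof (intro conjI allI)
  show "smooth_fun (\<lambda>x. f (c *\<^sub>R (x - a)))" by (intro smooth_fun_affine schwartz_smooth f)
  fix k and "is" :: "'a list"
  obtain D where D: "\<And>x. (1 + norm x) ^ k * norm (pdiff is f x) \<le> D" using schwartz_bound[OF f] by metis
  define B where "B = 1 + norm a + 1 / \<bar>c\<bar>"
  have le: "1 + norm x \<le> B * (1 + norm (c *\<^sub>R (x - a)))" for x
  proof -
    have "norm x \<le> norm a + norm (x - a)" using norm_triangle_ineq[of a "x - a"] by simp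
    also have "norm (x - a) = (1 / \<bar>c\<bar>) * norm (c *\<^sub>R (x - a))" using assms(2) by simp
    finally show ?thesis
      unfolding B_def ring_distribs by (smt (verit) mult_nonneg_nonneg norm_ge_zero divide_nonneg_nonneg abs_ge_zero mult_cancel_left1)
  qed
  have B: "B \<ge> 0" unfolding B_def by auto
  have "(1 + norm x) ^ k * norm (of_real (c ^ length is) * pdiff is f (c *\<^sub>R (x - a)))
      \<le> \<bar>c\<bar> ^ length is * B ^ k * D" for x
  proof -
    let ?y = "c *\<^sub>R (x - a)"
    have "(1 + norm x) ^ k \<le> B ^ k * (1 + norm ?y) ^ k"
      unfolding power_mult_distrib[symmetric] by (intro power_mono le) auto
    then have "(1 + norm x) ^ k * norm (pdiff is f ?y) \<le> (B ^ k * (1 + norm ?y) ^ k) * norm (pdiff is f ?y)"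
      by (intro mult_right_mono) auto
    also have "\<dots> \<le> B ^ k * D" using D[of ?y] B by (simp add: mult.assoc mult_left_mono)
    finally have "\<bar>c\<bar> ^ length is * ((1 + norm x) ^ k * norm (pdiff is f ?y)) \<le> \<bar>c\<bar> ^ length is * (B ^ k * D)"
      by (intro mult_left_mono) auto
    then show ?thesis by (simp add: norm_mult norm_power power_abs mult_ac)
  qed
  then show "\<exists>C. \<forall>x. (1 + norm x) ^ k * norm (of_real (c ^ length is) * pdiff is f (c *\<^sub>R (x - a))) \<le> C" by blast
qed

section \<open>Integration on Euclidean space\<close>

declare pdiff.simps(2) [simp del]

section \<open>Affine changes of variables\<close>

lemma nn_integral_lborel_affine:
  fixes f :: "real^'n::finite \<Rightarrow> ennreal"
  assumes [measurable]: "f \<in> borel_measurable borel" and "c \<noteq> 0"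
  shows "(\<integral>\<^sup>+x. f x \<partial>lborel) = ennreal (\<bar>c\<bar> ^ CARD('n)) * (\<integral>\<^sup>+x. f (t + c *\<^sub>R x) \<partial>lborel)"
  by (subst lborel_affine[OF assms(2), of t])
     (simp add: nn_integral_density nn_integral_distr nn_integral_cmult)

lemma integrable_lborel_affine:
  fixes f :: "real^'n::finite \<Rightarrow> 'b :: {banach, second_countable_topology}"
  assumes f: "integrable lborel f" and c: "c \<noteq> 0"
  shows "integrable lborel (\<lambda>x. f (t + c *\<^sub>R x))"
  using f f[THEN borel_measurable_integrable] c unfolding integrable_iff_bounded
  by (subst (asm) nn_integral_lborel_affine[where c=c and t=t]) (auto simp: ennreal_mult_less_top)

lemma integral_lborel_affine:
  fixes f :: "real^'n::finite \<Rightarrow> 'b :: {banach, second_countable_topology}"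
  assumes f: "integrable lborel f" and c: "c \<noteq> 0"
  shows "integral\<^sup>L lborel f = \<bar>c\<bar> ^ CARD('n) *\<^sub>R (\<integral>x. f (t + c *\<^sub>R x) \<partial>lborel)"
  using f[THEN borel_measurable_integrable] integrable_lborel_affine[OF assms, of t]
  by (subst lborel_affine[OF c, of t]) (simp add: integral_density integral_distr)

lemma integrable_reflect_shift:
  fixes f :: "real^'n::finite \<Rightarrow> 'b :: {banach, second_countable_topology}"
  assumes "integrable lborel f"
  shows "integrable lborel (\<lambda>y. f (x - y))" "(\<integral>y. f (x - y) \<partial>lborel) = integral\<^sup>L lborel f"
  using integrable_lborel_affine[OF assms, of "-1" x] integral_lborel_affine[OF assms, of "-1" x] by auto

lemma integrable_shift:
  fixes f :: "real^'n::finite \<Rightarrow> 'b :: {banach, second_countable_topology}"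
  assumes "integrable lborel f"
  shows "integrable lborel (\<lambda>y. f (x + y))" "(\<integral>y. f (x + y) \<partial>lborel) = integral\<^sup>L lborel f"
  using integrable_lborel_affine[OF assms, of "1" x] integral_lborel_affine[OF assms, of "1" x] by auto

section \<open>Gamma and Gaussian integrals\<close>

text \<open>Homogeneity of the measure t powr (a - 1) dt on the half-line. With a > 0 it evaluates
  Gamma integrals; with a = - \<sigma> it produces the factor k powr \<sigma> of a fractional
  power.\<close>

lemma nn_integral_power_scale:
  fixes F :: "real \<Rightarrow> real"
  assumes [measurable]: "F \<in> borel_measurable borel" and k: "k > 0"
  shows "(\<integral>\<^sup>+t. ennreal (indicator {0<..} t * t powr (a - 1) * F (k * t)) \<partial>lborel) =
    ennreal (k powr (- a)) * (\<integral>\<^sup>+t. ennreal (indicator {0<..} t * t powr (a - 1) * F t) \<partial>lborel)"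
proof -
  let ?h = "\<lambda>t. ennreal (indicator {0<..} t * t powr (a - 1) * F t)"
  have "integral\<^sup>N lborel ?h = ennreal k * (\<integral>\<^sup>+t. ?h (0 + k * t) \<partial>lborel)"
    using k by (subst nn_integral_real_affine[of _ k 0]) auto
  also have "(\<lambda>t. ?h (0 + k * t)) = (\<lambda>t. ennreal (k powr (a - 1)) *
      ennreal (indicator {0<..} t * t powr (a - 1) * F (k * t)))"
  proof
    fix t
    show "?h (0 + k * t) = ennreal (k powr (a - 1)) * ennreal (indicator {0<..} t * t powr (a - 1) * F (k * t))"
      using k by (cases "t > 0")
        (auto simp: ennreal_mult'[symmetric] powr_mult indicator_def zero_less_mult_iff mult_ac)
  qed
  also have "(\<integral>\<^sup>+t. ennreal (k powr (a - 1)) * ennreal (indicator {0<..} t * t powr (a - 1) * F (k * t)) \<partial>lborel)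
     = ennreal (k powr (a - 1)) * (\<integral>\<^sup>+t. ennreal (indicator {0<..} t * t powr (a - 1) * F (k * t)) \<partial>lborel)"
    by (intro nn_integral_cmult) measurable
  finally have "ennreal (k powr (-a)) * integral\<^sup>N lborel ?h = ennreal (k powr (-a)) * (ennreal k * (ennreal (k powr (a - 1)) *
      (\<integral>\<^sup>+t. ennreal (indicator {0<..} t * t powr (a - 1) * F (k * t)) \<partial>lborel)))" by simp
  also have "\<dots> = ennreal (k powr (-a) * (k * k powr (a - 1))) *
      (\<integral>\<^sup>+t. ennreal (indicator {0<..} t * t powr (a - 1) * F (k * t)) \<partial>lborel)"
    using k by (simp add: ennreal_mult' mult.assoc)
  also have "k powr (-a) * (k * k powr (a - 1)) = 1"
    using k by (simp add: powr_minus powr_diff field_simps)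
  finally show ?thesis by simp
qed

lemma nn_integral_Gamma:
  assumes a: "a > 0" and k: "k > 0"
  shows "(\<integral>\<^sup>+t. ennreal (indicator {0<..} t * t powr (a - 1) * exp (- (k * t))) \<partial>lborel) = ennreal (Gamma a * k powr (-a))"
proof -
  have "(\<integral>\<^sup>+t. ennreal (indicator {0<..} t * t powr (a - 1) * exp (- t)) \<partial>lborel) =
      (\<integral>\<^sup>+t. ennreal (indicator {0..} t * t powr (a - 1) / exp t) \<partial>lborel)"
    by (intro nn_integral_cong) (auto simp: indicator_def exp_minus field_simps)
  also have "\<dots> = ennreal (Gamma a)" using Gamma_conv_nn_integral_real[OF a] by simp
  finally show ?thesis
    using nn_integral_power_scale[of "\<lambda>t. exp (- t)" k a] k a Gamma_real_pos[OF a]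
    by (simp add: ennreal_mult'[symmetric] mult.commute)
qed

lemma nn_integral_gaussian_1D:
  assumes "t > 0"
  shows "(\<integral>\<^sup>+x. ennreal (exp (- t * x\<^sup>2)) \<partial>lborel) = ennreal (sqrt (pi / t))"
proof -
  define \<sigma> where "\<sigma> = sqrt (1 / (2 * t))"
  have \<sigma>: "\<sigma> > 0" "\<sigma>\<^sup>2 = 1 / (2 * t)" using assms by (auto simp: \<sigma>_def)
  have e: "x\<^sup>2 / (2 * \<sigma>\<^sup>2) = t * x\<^sup>2" "2 * pi * \<sigma>\<^sup>2 = pi / t" for x :: real
    using assms \<sigma> by auto
  have "exp (- t * x\<^sup>2) = sqrt (pi / t) * normal_density 0 \<sigma> x" for x
    unfolding normal_density_def diff_0_right minus_divide_left[symmetric] e using assms by simp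
  then have "(\<integral>\<^sup>+x. ennreal (exp (- t * x\<^sup>2)) \<partial>lborel) = (\<integral>\<^sup>+x. ennreal (sqrt (pi / t) * normal_density 0 \<sigma> x) \<partial>lborel)"
    by simp
  also have "\<dots> = ennreal (\<integral>x. sqrt (pi / t) * normal_density 0 \<sigma> x \<partial>lborel)"
    using \<sigma> assms by (intro nn_integral_eq_integral) auto
  finally show ?thesis using \<sigma> by simp
qed

lemma nn_integral_gaussian:
  assumes "t > 0"
  shows "(\<integral>\<^sup>+x. ennreal (exp (- t * (norm (x::real^'n::finite))\<^sup>2)) \<partial>lborel) = ennreal ((pi / t) powr (CARD('n) / 2))"
proof -
  have "exp (- t * (norm x)\<^sup>2) = (\<Prod>b\<in>Basis. exp (- t * (x \<bullet> b)\<^sup>2))" for x :: "real^'n"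
    unfolding power2_norm_eq_inner
    by (subst euclidean_inner) (simp add: sum_distrib_left exp_sum[symmetric] power2_eq_square)
  then have "(\<integral>\<^sup>+x. ennreal (exp (- t * (norm (x::real^'n::finite))\<^sup>2)) \<partial>lborel) =
     (\<integral>\<^sup>+x. (\<Prod>b\<in>Basis. ennreal (exp (- t * ((x::real^'n) \<bullet> b)\<^sup>2))) \<partial>lborel)"
    by (simp add: prod_ennreal)
  also have "\<dots> = (\<Prod>b\<in>(Basis::(real^'n) set). \<integral>\<^sup>+x. ennreal (exp (- t * x\<^sup>2)) \<partial>lborel)"
    by (rule nn_integral_lborel_prod[of "\<lambda>b x. ennreal (exp (- t * x\<^sup>2))"]) auto
  also have "\<dots> = ennreal (sqrt (pi / t) ^ CARD('n))"
    using assms by (simp add: nn_integral_gaussian_1D[simplified] ennreal_power)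
  also have "sqrt (pi / t) ^ CARD('n) = (pi / t) powr (CARD('n) / 2)"
    using assms by (simp add: powr_half_sqrt[symmetric] powr_realpow[symmetric] powr_powr)
  finally show ?thesis .
qed

text \<open>Integrating the Gamma integral for a negative power of lam over all of space
  reduces it to Gaussian integrals, again a Gamma integral.\<close>

lemma nn_integral_lam_powr:
  assumes a: "a > CARD('n::finite) / 2"
  shows "(\<integral>\<^sup>+x. ennreal (lam (x::real^'n) powr (-a)) \<partial>lborel) < \<infinity>"
proof -
  let ?n = "real CARD('n)"
  have a0: "a > 0" using a by (smt (verit) divide_nonneg_nonneg of_nat_0_le_iff)
  have "ennreal (Gamma a) * (\<integral>\<^sup>+x. ennreal (lam (x::real^'n) powr (-a)) \<partial>lborel)
      = (\<integral>\<^sup>+x. ennreal (Gamma a * lam (x::real^'n) powr (-a)) \<partial>lborel)"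
    using Gamma_real_pos[OF a0] by (subst nn_integral_cmult[symmetric]) (auto simp: ennreal_mult')
  also have "\<dots> = (\<integral>\<^sup>+x. \<integral>\<^sup>+t. ennreal (indicator {0<..} t * t powr (a - 1) * exp (- (lam (x::real^'n) * t))) \<partial>lborel \<partial>lborel)"
    by (intro nn_integral_cong) (simp only: nn_integral_Gamma[OF a0 lam_pos])
  also have "\<dots> = (\<integral>\<^sup>+t. \<integral>\<^sup>+x. ennreal (indicator {0<..} t * t powr (a - 1) * exp (- (lam (x::real^'n) * t))) \<partial>lborel \<partial>lborel)"
    by (rule lborel_pair.Fubini') measurable
  \<comment> \<open>The Gaussian integral contributes (pi / t) powr (n / 2) and so lowers the Gamma
    exponent from a to a - n/2; convergence at t = 0 is the hypothesis a > n/2.\<close>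
  also have "\<dots> = (\<integral>\<^sup>+t. ennreal (pi powr (?n / 2)) * ennreal (indicator {0<..} t * t powr ((a - ?n / 2) - 1) * exp (- (1 * t))) \<partial>lborel)"
  proof (intro nn_integral_cong)
    fix t :: real
    show "(\<integral>\<^sup>+x. ennreal (indicator {0<..} t * t powr (a - 1) * exp (- (lam (x::real^'n) * t))) \<partial>lborel) =
       ennreal (pi powr (?n / 2)) * ennreal (indicator {0<..} t * t powr ((a - ?n / 2) - 1) * exp (- (1 * t)))"
    proof (cases "t > 0")
      case True
      have "(\<integral>\<^sup>+x. ennreal (indicator {0<..} t * t powr (a - 1) * exp (- (lam (x::real^'n) * t))) \<partial>lborel) =
        (\<integral>\<^sup>+x. ennreal (t powr (a - 1) * exp (- t)) * ennreal (exp (- t * (norm (x::real^'n))\<^sup>2)) \<partial>lborel)"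
        using True by (intro nn_integral_cong) (simp add: ennreal_mult'[symmetric] mult_exp_exp algebra_simps)
      also have "\<dots> = ennreal (t powr (a - 1) * exp (- t)) * ennreal ((pi / t) powr (?n / 2))"
        by (subst nn_integral_cmult) (simp_all only: nn_integral_gaussian[OF True], measurable)
      also have "\<dots> = ennreal (t powr (a - 1) * exp (- t) * (pi / t) powr (?n / 2))"
        by (simp add: ennreal_mult'[symmetric])
      also have "t powr (a - 1) * exp (- t) * (pi / t) powr (?n / 2) = pi powr (?n / 2) * (indicator {0<..} t * t powr ((a - ?n / 2) - 1) * exp (- (1 * t)))"
        using True powr_add[of t "?n / 2" "(a - ?n / 2) - 1"] by (simp add: powr_divide algebra_simps)
      finally show ?thesis by (simp add: ennreal_mult')
    qed simp
  qed
  also have "\<dots> = ennreal (pi powr (?n / 2)) * ennreal (Gamma (a - ?n / 2) * 1 powr (-(a - ?n/2)))"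
    using a by (subst nn_integral_cmult) (measurable, simp only: nn_integral_Gamma[of "a - ?n / 2" 1] zero_less_one diff_gt_0_iff_gt)
  also have "\<dots> < \<infinity>" by (simp add: ennreal_mult_less_top)
  finally show ?thesis using Gamma_real_pos[OF a0]
    by (auto simp: ennreal_mult_less_top)
qed

lemma integrable_lam_powr:
  assumes a: "a > CARD('n::finite) / 2"
  shows "integrable lborel (\<lambda>x::real^'n. lam x powr (-a))"
  using nn_integral_lam_powr[OF a] by (intro integrableI_bounded) auto

section \<open>Decay and integrability of Schwartz functions\<close>

lemma schwartz_measurable: "f \<in> schwartz \<Longrightarrow> f \<in> borel_measurable borel"
  by (intro borel_measurable_continuous_onI smooth_fun_continuous schwartz_smooth)

lemma le_lam_powrI:
  assumes "lam x ^ N * a \<le> C" shows "a \<le> C * lam x powr (- real N)"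
proof -
  have "a \<le> C / lam x ^ N" using assms lam_pos[of x] by (simp add: pos_le_divide_eq mult.commute)
  then show ?thesis using lam_pos[of x] by (simp add: powr_minus powr_realpow divide_inverse)
qed

lemma schwartz_decay:
  assumes "f \<in> schwartz" obtains C where "C \<ge> 0" "\<And>x. norm (f x) \<le> C * lam x powr (- real N)"
proof -
  obtain C where C: "\<And>x. (1 + norm x) ^ (2 * N) * norm (f x) \<le> C"
    using schwartz_bound[OF assms, of "2 * N" "[]"] by auto
  have "C \<ge> 0" using order_trans[OF _ C[of 0]] by simp
  moreover have "norm (f x) \<le> C * lam x powr (- real N)" for x
  proof -
    have "lam x ^ N * norm (f x) \<le> ((1 + norm x)\<^sup>2) ^ N * norm (f x)"
      by (intro mult_right_mono power_mono lam_le) auto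
    also have "\<dots> \<le> C" using C[of x] by (simp add: power_mult)
    finally show ?thesis by (rule le_lam_powrI)
  qed
  ultimately show ?thesis using that by blast
qed

lemma schwartz_bounded: assumes "f \<in> schwartz" obtains C where "C \<ge> 0" "\<And>x. norm (f x) \<le> C"
proof -
  obtain C where C: "C \<ge> 0" "\<And>x. norm (f x) \<le> C * lam x powr (- real 0)"
    using schwartz_decay[OF assms, of 0] by metis
  have "norm (f x) \<le> C" for x using C(2)[of x] lam_pos[of x] by (simp split: if_splits)
  with C(1) show ?thesis by (rule that)
qed

lemma half_card_less: "real CARD('n::finite) / 2 < real CARD('n)"
  by simp

lemma schwartz_integrable: assumes "(f :: 'n::finite test) \<in> schwartz" shows "integrable lborel f"
proof -
  obtain C where C: "C \<ge> 0" "\<And>x. norm (f x) \<le> C * lam x powr (- real CARD('n))"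
    using schwartz_decay[OF assms] by metis
  note [measurable] = schwartz_measurable[OF assms]
  show ?thesis
    by (rule Bochner_Integration.integrable_bound[of _ "\<lambda>x. C * lam x powr (- real CARD('n))"])
       (use assms C in \<open>auto intro!: integrable_mult_right integrable_lam_powr half_card_less\<close>)
qed

lemma schwartz_powr_integrable:
  assumes "(f :: 'n::finite test) \<in> schwartz" "p \<ge> 1"
  shows "integrable lborel (\<lambda>x. norm (f x) powr p)"
proof -
  obtain C where C: "C \<ge> 0" "\<And>x. norm (f x) \<le> C"
    using schwartz_bounded[OF assms(1)] by metis
  note [measurable] = schwartz_measurable[OF assms(1)]
  have "norm (f x) powr p \<le> C powr (p - 1) * norm (f x)" for x
  proof -
    have "norm (f x) powr p = norm (f x) powr (p - 1) * norm (f x)"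
      by (cases "f x = 0") (auto simp: powr_diff)
    also have "\<dots> \<le> C powr (p - 1) * norm (f x)"
      using assms C by (intro mult_right_mono powr_mono2) auto
    finally show ?thesis .
  qed
  moreover have "integrable lborel (\<lambda>x. C powr (p - 1) * norm (f x))"
    by (intro integrable_mult_right integrable_norm schwartz_integrable assms)
  moreover have "(\<lambda>x. norm (f x) powr p) \<in> borel_measurable lborel" by measurable
  ultimately show ?thesis
    by (intro Bochner_Integration.integrable_bound[of _ "\<lambda>x. C powr (p - 1) * norm (f x)" "\<lambda>x. norm (f x) powr p"]) auto
qed

text \<open>Both applications take the Fourier character as the kernel: Parseval's formula, and the
  inversion formula regularised by a Gaussian.\<close>

lemma Fubini_bounded_kernel:
  fixes f g :: "real^'n::finite \<Rightarrow> complex"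
  assumes f: "integrable lborel f" and g: "integrable lborel g"
    and k [measurable]: "(\<lambda>(x, y). k x y) \<in> borel_measurable (lborel \<Otimes>\<^sub>M lborel)"
    and B: "\<And>x y. norm (k x y) \<le> B"
  shows "(\<integral>x. f x * (\<integral>y. k x y * g y \<partial>lborel) \<partial>lborel) = (\<integral>y. (\<integral>x. f x * k x y \<partial>lborel) * g y \<partial>lborel)"
proof -
  note [measurable] = f[THEN borel_measurable_integrable] g[THEN borel_measurable_integrable]
  have B0: "B \<ge> 0" using B order_trans[OF norm_ge_zero] by blast
  have "integrable (lborel \<Otimes>\<^sub>M lborel) (\<lambda>(x, y). f x * (k x y * g y))"
  proof (rule lborel_pair.Fubini_integrable)
    have int: "integrable lborel (\<lambda>y. f x * (k x y * g y))" for x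
      using B0 by (intro Bochner_Integration.integrable_bound[OF integrable_mult_right[OF integrable_norm[OF g], of "norm (f x) * B"]])
         (auto simp: norm_mult abs_mult mult.assoc intro!: mult_left_mono mult_right_mono B)
    then show "AE x in lborel. integrable lborel (\<lambda>y. case (x, y) of (x, y) \<Rightarrow> f x * (k x y * g y))" by simp
    show "integrable lborel (\<lambda>x. \<integral>y. norm (case (x, y) of (x, y) \<Rightarrow> f x * (k x y * g y)) \<partial>lborel)"
    proof (rule Bochner_Integration.integrable_bound[OF integrable_mult_right[OF integrable_norm[OF f], of "B * (\<integral>y. norm (g y) \<partial>lborel)"]])
      show "AE x in lborel. norm (\<integral>y. norm (case (x, y) of (x, y) \<Rightarrow> f x * (k x y * g y)) \<partial>lborel)
          \<le> norm (B * (\<integral>y. norm (g y) \<partial>lborel) * norm (f x))"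
      proof (intro AE_I2)
        fix x
        have "(\<integral>y. norm (f x * (k x y * g y)) \<partial>lborel) \<le> (\<integral>y. norm (f x) * B * norm (g y) \<partial>lborel)"
          by (intro integral_mono integrable_norm int integrable_mult_right g)
             (auto simp: norm_mult mult.assoc intro!: mult_left_mono mult_right_mono B)
        then show "norm (\<integral>y. norm (case (x, y) of (x, y) \<Rightarrow> f x * (k x y * g y)) \<partial>lborel)
          \<le> norm (B * (\<integral>y. norm (g y) \<partial>lborel) * norm (f x))" using B0 by (simp add: mult_ac abs_mult)
      qed
    qed measurable
  qed measurable
  from lborel_pair.Fubini_integral[OF this]
  show ?thesis by (simp add: mult.assoc flip: integral_mult_right_zero integral_mult_left_zero)
qed

text \<open>The mean value inequality along a coordinate line. It bounds difference quotients by
  nearby derivatives, which yields an integrable majorant.\<close>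

lemma smooth_fun_line_bound:
  fixes f :: "'n::finite test"
  assumes f: "smooth_fun f" and B: "\<And>t. t \<in> {0..h} \<Longrightarrow> norm (pdiff [j] f (x + t *\<^sub>R axis j 1)) \<le> B" and h: "h \<ge> 0"
  shows "norm (f (x + h *\<^sub>R axis j 1) - f x) \<le> B * h"
proof -
  let ?D = "\<lambda>t. frechet_derivative f (at (x + t *\<^sub>R axis j 1))"
  have der: "(f has_derivative ?D t) (at (x + t *\<^sub>R axis j 1))" for t
    using smooth_fun_has_derivative[OF f, of "[]"] by simp
  have "norm (f (x + h *\<^sub>R axis j 1) - f (x + 0 *\<^sub>R axis j 1)) \<le> B * norm (h - 0)"
  proof (rule differentiable_bound[of "{0..h}" "\<lambda>t. f (x + t *\<^sub>R axis j 1)" "\<lambda>t d. ?D t (0 + d *\<^sub>R axis j 1)"])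
    fix t assume t: "t \<in> {0..h}"
    show "((\<lambda>t. f (x + t *\<^sub>R axis j 1)) has_derivative (\<lambda>d. ?D t (0 + d *\<^sub>R axis j 1))) (at t within {0..h})"
      by (rule has_derivative_compose[of "\<lambda>t. x + t *\<^sub>R axis j 1", OF _ der]) (intro derivative_intros)
    have "?D t (d *\<^sub>R axis j 1) = d *\<^sub>R pdiff [j] f (x + t *\<^sub>R axis j 1)" for d
      using linear_cmul[OF has_derivative_linear[OF der]] by (simp add: pdiff.simps)
    then show "onorm (\<lambda>d. ?D t (0 + d *\<^sub>R axis j 1)) \<le> B"
      using B[OF t] by (intro onorm_le) (simp add: mult.commute[of _ "\<bar>_\<bar>"] mult_left_mono)
  qed (use h in auto)
  then show ?thesis using h by simp
qed

text \<open>Difference quotients of f have vanishing integral by translation invariance.\<close>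

lemma integral_pdiff_schwartz:
  fixes f :: "'n::finite test"
  assumes f: "f \<in> schwartz"
  shows "integral\<^sup>L lborel (pdiff [j] f) = 0"
proof -
  define h where "h k = 1 / real (Suc k)" for k
  have h: "h k > 0" "h k \<le> 1" for k by (auto simp: h_def)
  have h0: "h \<longlonglongrightarrow> 0" unfolding h_def by (rule lim_1_over_n[THEN LIMSEQ_Suc])
  let ?D = "pdiff [j] f" and ?e = "axis j 1 :: real^'n"
  let ?q = "\<lambda>k x. inverse (h k) *\<^sub>R (f (h k *\<^sub>R ?e + x) - f x)"
  note [measurable] = f[THEN schwartz_measurable] schwartz_pdiff[OF f, THEN schwartz_measurable]
  obtain C where C: "\<And>x. (1 + norm x) ^ (2 * CARD('n)) * norm (?D x) \<le> C"
    using schwartz_bound[OF f] by metis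
  let ?w = "\<lambda>x::real^'n. (2 ^ (2 * CARD('n)) * C) * lam x powr (- real CARD('n))"
  \<comment> \<open>The steps are at most 1, so 1 + |x| changes by a factor of at most 2 on the
    segment. The decay of the derivative therefore gives a majorant independent of
    \<open>k\<close>.\<close>
  have bound: "norm (?q k x) \<le> ?w x" for k x
  proof -
    have X: "norm (?D (x + t *\<^sub>R ?e)) \<le> ?w x" if "t \<in> {0..h k}" for t
    proof -
      have "norm (t *\<^sub>R ?e) \<le> 1" using that h(2)[of k] by (simp add: norm_axis_1)
      then have "1 + norm x \<le> 2 * (1 + norm (x + t *\<^sub>R ?e))"
        using norm_triangle_ineq4[of "x + t *\<^sub>R ?e" "t *\<^sub>R ?e"] norm_ge_zero[of "x + t *\<^sub>R ?e"]
        unfolding add_diff_cancel_right' by argo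
      then have "(1 + norm x) ^ (2 * CARD('n)) \<le> (2 * (1 + norm (x + t *\<^sub>R ?e))) ^ (2 * CARD('n))"
        by (intro power_mono) auto
      then have "(1 + norm x) ^ (2 * CARD('n)) * norm (?D (x + t *\<^sub>R ?e)) \<le>
         (2 * (1 + norm (x + t *\<^sub>R ?e))) ^ (2 * CARD('n)) * norm (?D (x + t *\<^sub>R ?e))"
        by (intro mult_right_mono) auto
      also have "\<dots> \<le> 2 ^ (2 * CARD('n)) * C"
        using mult_left_mono[OF C[of "x + t *\<^sub>R ?e"], of "2 ^ (2 * CARD('n))"]
        unfolding power_mult_distrib mult.assoc by simp
      finally have "(1 + norm x) ^ (2 * CARD('n)) * norm (?D (x + t *\<^sub>R ?e)) \<le> 2 ^ (2 * CARD('n)) * C" .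
      moreover have "lam x ^ CARD('n) \<le> (1 + norm x) ^ (2 * CARD('n))"
        using power_mono[OF lam_le[of x], of "CARD('n)"] by (simp add: power_mult)
      ultimately have "lam x ^ CARD('n) * norm (?D (x + t *\<^sub>R ?e)) \<le> 2 ^ (2 * CARD('n)) * C"
        by (meson mult_right_mono norm_ge_zero order_trans)
      then show ?thesis by (rule le_lam_powrI)
    qed
    have "norm (f (x + h k *\<^sub>R ?e) - f x) \<le> ?w x * h k"
      using smooth_fun_line_bound[OF schwartz_smooth[OF f] X] h(1)[of k] by (simp only: less_imp_le)
    then have "norm (f (x + h k *\<^sub>R ?e) - f x) / h k \<le> ?w x"
      using h(1)[of k] by (simp only: pos_divide_le_eq)
    then show ?thesis using h(1)[of k] by (simp add: divide_inverse_commute add.commute)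
  qed
  have A: "(\<lambda>k. integral\<^sup>L lborel (?q k)) \<longlonglongrightarrow> integral\<^sup>L lborel ?D"
  proof (rule integral_dominated_convergence[where w = ?w])
    show "integrable lborel ?w" by (intro integrable_mult_right integrable_lam_powr half_card_less)
    show "AE x in lborel. (\<lambda>k. ?q k x) \<longlonglongrightarrow> ?D x"
    proof (intro AE_I2)
      fix x
      let ?F = "frechet_derivative f (at x)"
      have der: "(f has_derivative ?F) (at x)"
        using smooth_fun_has_derivative[OF schwartz_smooth[OF f], of "[]"] by simp
      have F: "?F (t *\<^sub>R ?e) = t *\<^sub>R ?D x" for t
        using linear_cmul[OF has_derivative_linear[OF der]] by (simp add: pdiff.simps)
      have lim: "((\<lambda>d. norm (f (x + d) - f x - ?F d) / norm d) \<longlongrightarrow> 0) (at 0)"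
        using der by (simp add: has_derivative_at)
      have e: "norm ?e = 1" "?e \<noteq> 0" by (auto simp: norm_axis_1 axis_eq_0_iff)
      have "filterlim (\<lambda>k. h k *\<^sub>R ?e) (at 0) sequentially"
        using e h(1) by (intro filterlim_atI tendsto_eq_intros h0) (use h0 in \<open>auto simp: less_le\<close>)
      from filterlim_compose[OF lim this]
      have "(\<lambda>k. norm (f (x + h k *\<^sub>R ?e) - f x - h k *\<^sub>R ?D x) / \<bar>h k\<bar>) \<longlonglongrightarrow> 0"
        using e by (simp add: F)
      moreover have "norm (f (x + h k *\<^sub>R ?e) - f x - h k *\<^sub>R ?D x) / \<bar>h k\<bar> = norm (?q k x - ?D x)" for k
      proof -
        have "?q k x - ?D x = inverse (h k) *\<^sub>R (f (x + h k *\<^sub>R ?e) - f x - h k *\<^sub>R ?D x)"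
          using h(1)[of k] by (simp add: scaleR_right_diff_distrib add.commute)
        then show ?thesis by (simp only: norm_scaleR) (simp add: divide_inverse)
      qed
      ultimately have "(\<lambda>k. norm (?q k x - ?D x)) \<longlonglongrightarrow> 0" by simp
      then show "(\<lambda>k. ?q k x) \<longlonglongrightarrow> ?D x"
        by (rule LIM_zero_cancel[OF tendsto_norm_zero_cancel])
    qed
    show "AE x in lborel. norm (?q k x) \<le> ?w x" for k using bound by auto
    show "?D \<in> borel_measurable lborel" "?q k \<in> borel_measurable lborel" for k by measurable
  qed
  have B: "integral\<^sup>L lborel (?q k) = 0" for k
    using integrable_shift[OF schwartz_integrable[OF f], of "h k *\<^sub>R ?e"] schwartz_integrable[OF f]
    by (simp add: Bochner_Integration.integral_diff)
  show ?thesis using LIMSEQ_unique[OF A[unfolded B] tendsto_const] .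
qed

section \<open>The Fourier transform on Schwartz functions\<close>

lemma measurable_cis [measurable]:
  assumes [measurable]: "f \<in> borel_measurable M" shows "(\<lambda>x. cis (f x)) \<in> borel_measurable M"
  by (rule borel_measurable_continuous_on[OF continuous_on_cis[OF continuous_on_id]]) measurable

lemma integrable_mult_cis:
  assumes "integrable M f" and [measurable]: "\<theta> \<in> borel_measurable M"
  shows "integrable M (\<lambda>x. f x * cis (\<theta> x))"
proof -
  note [measurable] = assms(1)[THEN borel_measurable_integrable]
  show ?thesis
    by (rule Bochner_Integration.integrable_bound[OF assms(1)]) (auto simp: norm_mult)
qed

lemma pdiff_cis:
  "pdiff [j] (\<lambda>x::real^'n::finite. c * cis (- (x \<bullet> \<xi>))) = (\<lambda>x. (- \<i> * of_real (\<xi> $ j) * c) * cis (- (x \<bullet> \<xi>)))"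
proof -
  have "((\<lambda>x::real^'n. c * cis (- (x \<bullet> \<xi>))) has_derivative
      (\<lambda>h. c * ((- (h \<bullet> \<xi>)) *\<^sub>R (\<i> * cis (- (x \<bullet> \<xi>)))))) (at x)" for x
    by (intro derivative_eq_intros) auto
  from pdiff_eqI[OF this, of j] show ?thesis by (simp add: inner_axis' scaleR_conv_of_real mult_ac)
qed

lemma slow_cis: "slow (\<lambda>x::real^'n::finite. cis (- (x \<bullet> \<xi>)))"
proof (rule slow_coinduct[of "\<lambda>f. \<exists>c. f = (\<lambda>x::real^'n::finite. c * cis (- (x \<bullet> \<xi>)))"])
  show "\<exists>c. (\<lambda>x::real^'n. cis (- (x \<bullet> \<xi>))) = (\<lambda>x. c * cis (- (x \<bullet> \<xi>)))" by (rule exI[of _ 1]) simp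
next
  fix f :: "'n test" and x
  assume "\<exists>c. f = (\<lambda>x::real^'n::finite. c * cis (- (x \<bullet> \<xi>)))"
  then obtain c where f: "f = (\<lambda>x. c * cis (- (x \<bullet> \<xi>)))" by blast
  have "((\<lambda>x::real^'n. c * cis (- (x \<bullet> \<xi>))) has_derivative
      (\<lambda>h. c * ((- (h \<bullet> \<xi>)) *\<^sub>R (\<i> * cis (- (x \<bullet> \<xi>)))))) (at x)"
    by (intro derivative_eq_intros) auto
  then show "f differentiable at x" unfolding f by (rule differentiableI)
  show "\<exists>C k. \<forall>x. norm (f x) \<le> C * (1 + norm x) ^ k"
    by (rule exI[of _ "norm c"], rule exI[of _ 0]) (simp add: f norm_mult)
next
  fix f :: "'n test" and i
  assume "\<exists>c. f = (\<lambda>x::real^'n::finite. c * cis (- (x \<bullet> \<xi>)))"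
  then obtain c where f: "f = (\<lambda>x. c * cis (- (x \<bullet> \<xi>)))" by blast
  show "\<exists>c. pdiff [i] f = (\<lambda>x::real^'n::finite. c * cis (- (x \<bullet> \<xi>)))"
    unfolding f pdiff_cis by blast
qed

lemma ifourier_eq_fourier:
  "ifourier f x = complex_of_real ((2 * pi) powr (- real CARD('n))) * fourier f (- x)" for x :: "real^'n::finite"
  by (simp add: ifourier_def fourier_def inner_commute)

lemma fourier_add:
  assumes "integrable lborel f" "integrable lborel g"
  shows "fourier (\<lambda>x. f x + g x) = (\<lambda>\<xi>. fourier f \<xi> + fourier g \<xi>)"
  unfolding fourier_def using assms
  by (simp add: ring_distribs integrable_mult_cis Bochner_Integration.integral_add)

lemma fourier_diff:
  assumes "integrable lborel f" "integrable lborel g"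
  shows "fourier (\<lambda>x. f x - g x) = (\<lambda>\<xi>. fourier f \<xi> - fourier g \<xi>)"
  unfolding fourier_def using assms
  by (simp add: left_diff_distrib integrable_mult_cis Bochner_Integration.integral_diff)

lemma fourier_cmult: "fourier (\<lambda>x. c * f x) = (\<lambda>\<xi>. c * fourier f \<xi>)"
  unfolding fourier_def by (simp add: mult.assoc)

lemma fourier_sum:
  assumes "\<And>a. a \<in> I \<Longrightarrow> integrable lborel (F a)"
  shows "fourier (\<lambda>x. \<Sum>a\<in>I. F a x) = (\<lambda>\<xi>. \<Sum>a\<in>I. fourier (F a) \<xi>)"
  unfolding fourier_def using assms
  by (simp add: sum_distrib_right integrable_mult_cis Bochner_Integration.integral_sum)

lemma norm_fourier_le:
  assumes "integrable lborel f" shows "norm (fourier f \<xi>) \<le> (\<integral>x. norm (f x) \<partial>lborel)"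
  unfolding fourier_def
  by (rule order_trans[OF integral_norm_bound]) (simp add: norm_mult)

text \<open>Integration by parts: the product of \<open>f\<close> with the character is a Schwartz
  function, so its derivative has integral zero, and the Leibniz rule splits this integral into the
  two sides.\<close>

lemma fourier_pdiff:
  assumes f: "f \<in> schwartz"
  shows "fourier (pdiff [j] f) \<xi> = \<i> * of_real (\<xi> $ j) * fourier f \<xi>"
proof -
  let ?e = "\<lambda>x. cis (- (x \<bullet> \<xi>))"
  have S: "(\<lambda>x. f x * ?e x) \<in> schwartz"
    using schwartz_slow_mult[OF slow_cis f] by (simp add: mult.commute)
  have "pdiff [j] (\<lambda>x. f x * ?e x) = (\<lambda>x. pdiff [j] f x * ?e x + f x * pdiff [j] ?e x)"
    using pdiff_mult[OF schwartz_smooth[OF f] slow_smooth[OF slow_cis], of "[j]"] by simp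
  also have "\<dots> = (\<lambda>x. pdiff [j] f x * ?e x - \<i> * of_real (\<xi> $ j) * (f x * ?e x))"
    using pdiff_cis[of j 1 \<xi>] by (simp add: algebra_simps)
  finally have "0 = (\<integral>x. pdiff [j] f x * ?e x - \<i> * of_real (\<xi> $ j) * (f x * ?e x) \<partial>lborel)"
    using integral_pdiff_schwartz[OF S, of j] by simp
  also have "\<dots> = (\<integral>x. pdiff [j] f x * ?e x \<partial>lborel) - (\<integral>x. \<i> * of_real (\<xi> $ j) * (f x * ?e x) \<partial>lborel)"
    by (intro Bochner_Integration.integral_diff integrable_mult_cis integrable_mult_right
        schwartz_integrable schwartz_pdiff f S) measurable
  also have "\<dots> = fourier (pdiff [j] f) \<xi> - \<i> * of_real (\<xi> $ j) * fourier f \<xi>"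
    unfolding fourier_def by simp
  finally show ?thesis by simp
qed

lemma norm_cis_minus_linear_le: "norm (cis a - 1 - \<i> * of_real a) \<le> a\<^sup>2"
proof -
  have "norm (iexp a - (\<Sum>k\<le>1. (\<i> * of_real a) ^ k / fact k)) \<le> \<bar>a\<bar> ^ Suc 1 / fact (Suc 1)"
    by (rule iexp_approx1)
  moreover have "(\<Sum>k\<le>1. (\<i> * of_real a) ^ k / fact k) = 1 + \<i> * of_real a" by simp
  moreover have "\<bar>a\<bar> ^ Suc 1 / fact (Suc 1) \<le> a\<^sup>2" by (simp add: power2_eq_square)
  ultimately show ?thesis by (simp add: cis_conv_exp diff_diff_eq)
qed

lemma schwartz_coord_mult: "f \<in> schwartz \<Longrightarrow> (\<lambda>x. of_real (x $ j) * f x) \<in> schwartz"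
  by (intro schwartz_slow_mult slow_coord)

text \<open>The second-order bound for the character leaves a remainder of at most |h|^2 times the
  second absolute moment of \<open>f\<close>. This gives the total derivative at once, hence also
  every partial derivative.\<close>

lemma has_derivative_fourier:
  assumes f: "f \<in> schwartz"
  shows "(fourier f has_derivative
    (\<lambda>h. \<Sum>j\<in>UNIV. of_real (h $ j) * fourier (\<lambda>x. - \<i> * (of_real (x $ j) * f x)) \<xi>)) (at \<xi>)"
proof (rule has_derivativeI_sandwich[of 1])
  let ?G = "\<lambda>j. fourier (\<lambda>x. - \<i> * (of_real (x $ j) * f x)) \<xi>"
  define K where "K = (\<integral>x. (norm x)\<^sup>2 * norm (f x) \<partial>lborel)"
  have lamf: "(\<lambda>x. of_real (lam x) * f x) \<in> schwartz" by (intro schwartz_slow_mult slow_lam f)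
  note [measurable] = f[THEN schwartz_measurable]
  have intK: "integrable lborel (\<lambda>x. (norm x)\<^sup>2 * norm (f x))"
    by (rule Bochner_Integration.integrable_bound[OF schwartz_integrable[OF lamf]])
       (auto simp: norm_mult mult_right_mono simp del: of_real_add)
  show "bounded_linear (\<lambda>h. \<Sum>j\<in>UNIV. of_real (h $ j) * ?G j)"
    by (intro bounded_linear_sum bounded_linear_mult_left[THEN bounded_linear_compose]
        bounded_linear_of_real[THEN bounded_linear_compose] bounded_linear_vec_nth)
  have intf: "integrable lborel (\<lambda>x. of_real (x $ j) * f x)" for j
    by (intro schwartz_integrable schwartz_coord_mult f)
  fix \<eta> assume "\<eta> \<noteq> \<xi>"
  define h where "h = \<eta> - \<xi>"
  have h: "h \<noteq> 0" using \<open>\<eta> \<noteq> \<xi>\<close> by (simp add: h_def)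
  have "(\<Sum>j\<in>UNIV. of_real (h $ j) * ?G j) =
      fourier (\<lambda>x. \<Sum>j\<in>UNIV. of_real (h $ j) * (- \<i> * (of_real (x $ j) * f x))) \<xi>"
    by (subst fourier_sum) (intro integrable_mult_right intf, simp only: fourier_cmult)
  also have "(\<lambda>x. \<Sum>j\<in>UNIV. of_real (h $ j) * (- \<i> * (of_real (x $ j) * f x))) =
      (\<lambda>x. (- \<i> * of_real (x \<bullet> h)) * f x)"
    by (simp add: inner_vec_def sum_distrib_left sum_distrib_right mult_ac)
  finally have sum_eq: "(\<Sum>j\<in>UNIV. of_real (h $ j) * ?G j) = fourier (\<lambda>x. (- \<i> * of_real (x \<bullet> h)) * f x) \<xi>" .
  have int2: "integrable lborel (\<lambda>x. (- \<i> * of_real (x \<bullet> h)) * f x)"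
  proof -
    have "(\<lambda>x. (- \<i> * of_real (x \<bullet> h)) * f x) = (\<lambda>x. \<Sum>j\<in>UNIV. of_real (h $ j) * (- \<i> * (of_real (x $ j) * f x)))"
      by (simp add: inner_vec_def sum_distrib_left sum_distrib_right mult_ac)
    then show ?thesis by (auto intro!: integrable_mult_right intf)
  qed
  have "fourier f \<eta> - fourier f \<xi> - fourier (\<lambda>x. (- \<i> * of_real (x \<bullet> h)) * f x) \<xi> =
     (\<integral>x. (f x * cis (- (x \<bullet> \<eta>)) - f x * cis (- (x \<bullet> \<xi>))) - ((- \<i> * of_real (x \<bullet> h)) * f x) * cis (- (x \<bullet> \<xi>)) \<partial>lborel)"
    unfolding fourier_def using schwartz_integrable[OF f] int2
    by (simp add: integrable_mult_cis Bochner_Integration.integral_diff)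
  also have "norm \<dots> \<le> (\<integral>x. (norm h)\<^sup>2 * ((norm x)\<^sup>2 * norm (f x)) \<partial>lborel)"
  proof (rule order_trans[OF integral_norm_bound integral_mono])
    show "integrable lborel (\<lambda>x. norm ((f x * cis (- (x \<bullet> \<eta>)) - f x * cis (- (x \<bullet> \<xi>))) - ((- \<i> * of_real (x \<bullet> h)) * f x) * cis (- (x \<bullet> \<xi>))))"
      using schwartz_integrable[OF f] int2 by (intro integrable_norm) (simp add: integrable_mult_cis)
    show "integrable lborel (\<lambda>x. (norm h)\<^sup>2 * ((norm x)\<^sup>2 * norm (f x)))" by (intro integrable_mult_right intK)
    fix x
    have "cis (- (x \<bullet> \<eta>)) = cis (- (x \<bullet> \<xi>)) * cis (- (x \<bullet> h))"
      by (simp add: cis_mult h_def inner_diff_right)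
    then have "(f x * cis (- (x \<bullet> \<eta>)) - f x * cis (- (x \<bullet> \<xi>))) - ((- \<i> * of_real (x \<bullet> h)) * f x) * cis (- (x \<bullet> \<xi>))
       = f x * cis (- (x \<bullet> \<xi>)) * (cis (- (x \<bullet> h)) - 1 - \<i> * of_real (- (x \<bullet> h)))"
      by (simp add: algebra_simps)
    then have "norm ((f x * cis (- (x \<bullet> \<eta>)) - f x * cis (- (x \<bullet> \<xi>))) - ((- \<i> * of_real (x \<bullet> h)) * f x) * cis (- (x \<bullet> \<xi>)))
       = norm (f x) * norm (cis (- (x \<bullet> h)) - 1 - \<i> * of_real (- (x \<bullet> h)))"
      by (simp only: norm_mult norm_cis mult_1_right)
    also have "\<dots> \<le> norm (f x) * (- (x \<bullet> h))\<^sup>2" by (intro mult_left_mono norm_cis_minus_linear_le) auto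
    also have "\<dots> \<le> norm (f x) * (norm x * norm h)\<^sup>2"
      using Cauchy_Schwarz_ineq2[of x h] by (intro mult_left_mono) (simp_all add: abs_le_square_iff[symmetric])
    finally show "norm ((f x * cis (- (x \<bullet> \<eta>)) - f x * cis (- (x \<bullet> \<xi>))) - ((- \<i> * of_real (x \<bullet> h)) * f x) * cis (- (x \<bullet> \<xi>)))
       \<le> (norm h)\<^sup>2 * ((norm x)\<^sup>2 * norm (f x))" by (simp add: power_mult_distrib mult_ac)
  qed
  also have "\<dots> = (norm h)\<^sup>2 * K" by (simp add: K_def)
  finally have "norm (fourier f \<eta> - fourier f \<xi> - (\<Sum>j\<in>UNIV. of_real (h $ j) * ?G j)) \<le> (norm h)\<^sup>2 * K"
    unfolding sum_eq .
  then show "norm ((fourier f \<eta> - fourier f \<xi>) - (\<Sum>j\<in>UNIV. of_real ((\<eta> - \<xi>) $ j) * ?G j)) / norm (\<eta> - \<xi>) \<le> norm (\<eta> - \<xi>) * K"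
    unfolding h_def[symmetric] using h by (simp add: pos_divide_le_eq power2_eq_square mult_ac)
next
  let ?K = "\<integral>x. (norm x)\<^sup>2 * norm (f x) \<partial>lborel"
  have "((\<lambda>\<eta>. norm (\<eta> - \<xi>) * ?K) \<longlongrightarrow> norm (\<xi> - \<xi>) * ?K) (at \<xi>)"
    by (intro tendsto_intros)
  then show "((\<lambda>\<eta>. norm (\<eta> - \<xi>) * ?K) \<longlongrightarrow> 0) (at \<xi>)" by simp
qed simp

lemma pdiff_fourier:
  assumes f: "f \<in> schwartz"
  shows "pdiff [j] (fourier f) = fourier (\<lambda>x. - \<i> * (of_real (x $ j) * f x))"
  unfolding pdiff_eqI[OF has_derivative_fourier[OF f], of j]
  by (simp add: axis_def if_distrib[of complex_of_real] if_distrib[of "\<lambda>a. a * _"] cong: if_cong)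

section \<open>The operator 1 - Laplacian and the decay of Fourier transforms\<close>

text \<open>This is 1 - Laplacian, with Fourier symbol \<open>lam\<close>. It is the Bessel
  potential of order 2 and, unlike those of fractional order, it is local.\<close>

definition Lop :: "'n::finite test \<Rightarrow> 'n test" where
  "Lop f = (\<lambda>x. f x - (\<Sum>j\<in>UNIV. pdiff [j, j] f x))"

lemma schwartz_Lop: "f \<in> schwartz \<Longrightarrow> Lop f \<in> schwartz"
  unfolding Lop_def by (intro schwartz_diff schwartz_sum schwartz_pdiff)

lemma fourier_Lop:
  assumes f: "f \<in> schwartz"
  shows "fourier (Lop f) \<xi> = of_real (lam \<xi>) * fourier f \<xi>"
proof -
  have "fourier (pdiff [j, j] f) \<xi> = - (of_real (\<xi> $ j) * of_real (\<xi> $ j) * fourier f \<xi>)" for j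
    using fourier_pdiff[OF schwartz_pdiff[OF f], of j "[j]"] fourier_pdiff[OF f, of j]
    by (simp add: pdiff.simps algebra_simps)
  then show ?thesis
    unfolding Lop_def lam_sum
    by (subst fourier_diff, auto simp: fourier_sum schwartz_integrable schwartz_pdiff schwartz_sum f
        sum_negf sum_distrib_right ring_distribs)
qed

lemma schwartz_Lop_pow: "f \<in> schwartz \<Longrightarrow> (Lop ^^ k) f \<in> schwartz"
  by (induction k) (auto intro: schwartz_Lop)

lemma fourier_Lop_pow:
  assumes f: "f \<in> schwartz"
  shows "fourier ((Lop ^^ k) f) \<xi> = of_real (lam \<xi>) ^ k * fourier f \<xi>"
  by (induction k) (auto simp: fourier_Lop schwartz_Lop_pow[OF f])

text \<open>Decay comes from \<open>Lop\<close>: its powers multiply the transform by powers of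
  \<open>lam\<close>, while transforms of integrable functions are bounded. Derivatives stay in the
  class because they are transforms of coordinate multiples.\<close>

lemma fourier_schwartz:
  assumes "f \<in> schwartz" shows "fourier f \<in> schwartz"
proof (rule schwartz_coinduct[of "\<lambda>g. \<exists>f\<in>schwartz. g = fourier f"])
  fix g :: "'a test" and k
  assume "\<exists>f\<in>schwartz. g = fourier f"
  then obtain f where f: "f \<in> schwartz" and g: "g = fourier f" by blast
  have "(1 + norm \<xi>) ^ k * norm (g \<xi>) \<le> 2 ^ k * (\<integral>x. norm ((Lop ^^ k) f x) \<partial>lborel)" for \<xi>
  proof -
    have "(1 + norm \<xi>) ^ k * norm (g \<xi>) \<le> (2 * lam \<xi>) ^ k * norm (g \<xi>)"
      by (intro mult_right_mono power_mono one_plus_norm_le) auto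
    also have "\<dots> = 2 ^ k * norm (fourier ((Lop ^^ k) f) \<xi>)"
      unfolding fourier_Lop_pow[OF f] g power_mult_distrib norm_mult norm_power norm_of_real
      using lam_pos[of \<xi>] by simp
    also have "\<dots> \<le> 2 ^ k * (\<integral>x. norm ((Lop ^^ k) f x) \<partial>lborel)"
      by (intro mult_left_mono norm_fourier_le schwartz_integrable schwartz_Lop_pow f) auto
    finally show ?thesis .
  qed
  then show "\<exists>C. \<forall>x. (1 + norm x) ^ k * norm (g x) \<le> C" by blast
next
  fix g :: "'a test" and j assume "\<exists>f\<in>schwartz. g = fourier f"
  then show "\<exists>f\<in>schwartz. pdiff [j] g = fourier f"
    using pdiff_fourier schwartz_cmult[OF schwartz_coord_mult] by blast
next
  fix g :: "'a test" and \<xi> assume "\<exists>f\<in>schwartz. g = fourier f"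
  then show "g differentiable at \<xi>" using has_derivative_fourier differentiableI by blast
qed (use assms in blast)

lemma ifourier_schwartz:
  assumes "f \<in> schwartz" shows "ifourier f \<in> schwartz"
proof -
  have "(\<lambda>x. complex_of_real ((2 * pi) powr (- real CARD('a))) * fourier f ((-1) *\<^sub>R (x - 0))) \<in> schwartz"
    by (intro schwartz_cmult schwartz_affine fourier_schwartz assms) simp
  then show ?thesis by (simp add: ifourier_eq_fourier[abs_def])
qed

lemma fourier_parseval:
  fixes f g :: "'n::finite test"
  assumes "integrable lborel f" "integrable lborel g"
  shows "(\<integral>x. f x * fourier g x \<partial>lborel) = (\<integral>x. fourier f x * g x \<partial>lborel)"
proof -
  have "(\<integral>x. f x * (\<integral>y. cis (- (y \<bullet> x)) * g y \<partial>lborel) \<partial>lborel) = (\<integral>y. (\<integral>x. f x * cis (- (y \<bullet> x)) \<partial>lborel) * g y \<partial>lborel)"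
    by (rule Fubini_bounded_kernel[where B = 1, OF assms]) auto
  then show ?thesis unfolding fourier_def by (simp add: mult.commute inner_commute)
qed

lemma fourier_reflect:
  fixes f :: "'n::finite test"
  assumes "integrable lborel f"
  shows "fourier (\<lambda>x. f (- x)) \<xi> = fourier f (- \<xi>)"
  using integrable_reflect_shift(2)[OF integrable_mult_cis[OF assms], of "\<lambda>x. - (x \<bullet> (- \<xi>))" 0]
  by (simp add: fourier_def)

section \<open>Heat kernel, Fourier inversion and Bessel potentials\<close>

text \<open>A rescaling of the characteristic function of the standard normal law.\<close>

lemma integral_gaussian_cis_1D:
  assumes t: "t > 0"
  shows "(\<integral>\<xi>. of_real (exp (- t * \<xi>\<^sup>2)) * cis (z * \<xi>) \<partial>lborel) = complex_of_real (sqrt (pi / t) * exp (- (z\<^sup>2 / (4 * t))))"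
    and "integrable lborel (\<lambda>\<xi>. complex_of_real (exp (- t * \<xi>\<^sup>2)) * cis (z * \<xi>))"
proof -
  \<comment> \<open>The substitution x = c * \<xi> turns exp (- x^2 / 2) into exp (- t *
    \<xi>^2).\<close>
  define c where "c = sqrt (2 * t)"
  have c: "c > 0" "c\<^sup>2 = 2 * t" using t by (auto simp: c_def)
  define F where "F x = std_normal_density x *\<^sub>R iexp (z / c * x)" for x
  have [measurable]: "F \<in> borel_measurable borel" unfolding F_def by measurable
  have F: "integrable lborel F"
    by (rule Bochner_Integration.integrable_bound[OF integrable_normal_density[where \<mu> = 0 and \<sigma> = 1, OF zero_less_one]]) (auto simp: F_def)
  have "char std_normal_distribution (z / c) = integral\<^sup>L lborel F"
    unfolding char_def F_def by (subst integral_density) auto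
  then have "complex_of_real (exp (- (z / c)\<^sup>2 / 2)) = integral\<^sup>L lborel F"
    by (simp add: char_std_normal_distribution)
  also have "\<dots> = \<bar>c\<bar> *\<^sub>R (\<integral>\<xi>. F (0 + c * \<xi>) \<partial>lborel)"
    using c by (intro lborel_integral_real_affine) auto
  finally have eq: "complex_of_real (exp (- (z / c)\<^sup>2 / 2)) = \<bar>c\<bar> *\<^sub>R (\<integral>\<xi>. F (0 + c * \<xi>) \<partial>lborel)" .
  have Fc: "F (0 + c * \<xi>) = of_real (1 / sqrt (2 * pi)) * (of_real (exp (- t * \<xi>\<^sup>2)) * cis (z * \<xi>))" for \<xi>
    using c by (simp add: F_def std_normal_density_def power_mult_distrib cis_conv_exp scaleR_conv_of_real)
  have "integrable lborel (\<lambda>\<xi>. of_real (sqrt (2 * pi)) * F (0 + c * \<xi>))"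
    using c lborel_integrable_real_affine[OF F, of c 0] by (intro integrable_mult_right) auto
  then show "integrable lborel (\<lambda>\<xi>. complex_of_real (exp (- t * \<xi>\<^sup>2)) * cis (z * \<xi>))"
    unfolding Fc by (subst (asm) mult.assoc[symmetric]) (simp flip: of_real_mult)
  have k1: "c * (1 / sqrt (2 * pi)) = 1 / sqrt (pi / t)" using t by (simp add: c_def real_sqrt_divide real_sqrt_mult)
  have k2: "- (z / c)\<^sup>2 / 2 = - (z\<^sup>2 / (4 * t))" using c by (simp add: power_divide)
  have "complex_of_real (exp (- (z\<^sup>2 / (4 * t)))) = of_real (1 / sqrt (pi / t)) * (\<integral>\<xi>. of_real (exp (- t * \<xi>\<^sup>2)) * cis (z * \<xi>) \<partial>lborel)"
    using eq unfolding Fc integral_mult_right_zero k2 abs_of_pos[OF c(1)] scaleR_conv_of_real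
    by (simp only: k1[symmetric] of_real_mult mult.assoc)
  then have "of_real (sqrt (pi / t)) * complex_of_real (exp (- (z\<^sup>2 / (4 * t)))) =
     of_real (sqrt (pi / t) * (1 / sqrt (pi / t))) * (\<integral>\<xi>. of_real (exp (- t * \<xi>\<^sup>2)) * cis (z * \<xi>) \<partial>lborel)"
    by simp
  also have "sqrt (pi / t) * (1 / sqrt (pi / t)) = 1" using t by simp
  finally show "(\<integral>\<xi>. of_real (exp (- t * \<xi>\<^sup>2)) * cis (z * \<xi>) \<partial>lborel) = complex_of_real (sqrt (pi / t) * exp (- (z\<^sup>2 / (4 * t))))"
    by simp
qed

lemma integral_lborel_prod:
  fixes f :: "'a::euclidean_space \<Rightarrow> real \<Rightarrow> complex"
  assumes f: "\<And>b. b \<in> Basis \<Longrightarrow> integrable lborel (f b)"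
  shows "(\<integral>x. (\<Prod>b\<in>Basis. f b (x \<bullet> b)) \<partial>lborel) = (\<Prod>b\<in>Basis. integral\<^sup>L lborel (f b))"
proof -
  interpret product_sigma_finite "\<lambda>b::'a. lborel :: real measure"
    by (simp add: product_sigma_finite_def sigma_finite_lborel)
  have [measurable]: "\<And>b. b \<in> Basis \<Longrightarrow> f b \<in> borel_measurable borel"
    using f[THEN borel_measurable_integrable] by simp
  have "(\<integral>x. (\<Prod>b\<in>Basis. f b (x \<bullet> b)) \<partial>lborel) =
     (\<integral>x. (\<Prod>b\<in>Basis. f b ((\<Sum>c\<in>Basis. x c *\<^sub>R c) \<bullet> b)) \<partial>(\<Pi>\<^sub>M b\<in>(Basis::'a set). lborel))"
    by (subst lborel_eq) (subst integral_distr, auto)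
  also have "\<dots> = (\<integral>x. (\<Prod>b\<in>Basis. f b (x b)) \<partial>(\<Pi>\<^sub>M b\<in>(Basis::'a set). lborel))"
    by simp
  also have "\<dots> = (\<Prod>b\<in>Basis. integral\<^sup>L lborel (f b))"
    using f by (intro product_integral_prod) auto
  finally show ?thesis .
qed

lemma cis_sum: "finite I \<Longrightarrow> cis (\<Sum>i\<in>I. f i) = (\<Prod>i\<in>I. cis (f i))"
  by (induction I rule: finite_induct) (simp_all flip: cis_mult)

lemma integral_gaussian_cis:
  assumes t: "t > 0"
  shows "(\<integral>\<xi>. of_real (exp (- t * (norm (\<xi>::real^'n::finite))\<^sup>2)) * cis (z \<bullet> \<xi>) \<partial>lborel)
    = complex_of_real ((pi / t) powr (CARD('n) / 2) * exp (- ((norm z)\<^sup>2 / (4 * t))))"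
proof -
  have e: "exp (- t * (norm \<xi>)\<^sup>2) = (\<Prod>b\<in>Basis. exp (- t * (\<xi> \<bullet> b)\<^sup>2))" for \<xi> :: "real^'n"
    unfolding power2_norm_eq_inner
    by (subst euclidean_inner) (simp add: sum_distrib_left exp_sum[symmetric] power2_eq_square)
  have c: "cis (z \<bullet> \<xi>) = (\<Prod>b\<in>Basis. cis ((z \<bullet> b) * (\<xi> \<bullet> b)))" for \<xi> :: "real^'n"
    by (subst euclidean_inner) (simp add: cis_sum)
  have e2: "exp (- ((norm z)\<^sup>2 / (4 * t))) = (\<Prod>b\<in>Basis. exp (- ((z \<bullet> b)\<^sup>2 / (4 * t))))"
    unfolding power2_norm_eq_inner
    by (subst euclidean_inner) (simp add: sum_divide_distrib sum_negf[symmetric] exp_sum[symmetric] power2_eq_square)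
  have "(\<integral>\<xi>. of_real (exp (- t * (norm (\<xi>::real^'n))\<^sup>2)) * cis (z \<bullet> \<xi>) \<partial>lborel) =
    (\<integral>\<xi>. (\<Prod>b\<in>Basis. of_real (exp (- t * ((\<xi>::real^'n) \<bullet> b)\<^sup>2)) * cis ((z \<bullet> b) * (\<xi> \<bullet> b))) \<partial>lborel)"
    unfolding e c by (simp add: prod.distrib)
  also have "\<dots> = (\<Prod>b\<in>(Basis::(real^'n) set). complex_of_real (sqrt (pi / t) * exp (- ((z \<bullet> b)\<^sup>2 / (4 * t)))))"
    by (subst integral_lborel_prod[of "\<lambda>b \<xi>. of_real (exp (- t * \<xi>\<^sup>2)) * cis ((z \<bullet> b) * \<xi>)"])
       (simp_all only: integral_gaussian_cis_1D[OF t])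
  also have "\<dots> = complex_of_real (sqrt (pi / t) ^ CARD('n) * exp (- ((norm z)\<^sup>2 / (4 * t))))"
    unfolding e2 by (simp add: prod.distrib)
  also have "sqrt (pi / t) ^ CARD('n) = (pi / t) powr (CARD('n) / 2)"
    using t by (simp add: powr_half_sqrt[symmetric] powr_realpow[symmetric] powr_powr)
  finally show ?thesis .
qed

definition heat :: "real \<Rightarrow> real^'n::finite \<Rightarrow> real" where
  "heat t z = (4 * pi * t) powr (- real CARD('n) / 2) * exp (- ((norm z)\<^sup>2 / (4 * t)))"

lemma heat_measurable [measurable]:
  assumes [measurable]: "f \<in> borel_measurable M" "g \<in> borel_measurable M"
  shows "(\<lambda>x. heat (f x) (g x)) \<in> borel_measurable M"
  unfolding heat_def by measurable

lemma heat_nonneg: "heat t z \<ge> 0"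
  by (simp add: heat_def)

lemma heat_minus: "heat t (- z) = heat t z"
  by (simp add: heat_def)

lemma heat_minus_commute: "heat t (x - y) = heat t (y - x)"
  using heat_minus[of t "x - y"] by simp

lemma heat_le: "t > 0 \<Longrightarrow> heat t (z::real^'n::finite) \<le> (4 * pi * t) powr (- real CARD('n) / 2)"
  by (simp add: heat_def mult_left_le)

lemma nn_integral_heat:
  assumes "t > 0" shows "(\<integral>\<^sup>+z. ennreal (heat t (z::real^'n::finite)) \<partial>lborel) = 1"
proof -
  have "(\<integral>\<^sup>+z. ennreal (heat t (z::real^'n)) \<partial>lborel) =
     ennreal ((4 * pi * t) powr (- real CARD('n) / 2)) * (\<integral>\<^sup>+z. ennreal (exp (- (1 / (4 * t)) * (norm (z::real^'n))\<^sup>2)) \<partial>lborel)"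
    by (subst nn_integral_cmult[symmetric]) (auto simp: heat_def ennreal_mult' field_simps)
  also have "\<dots> = ennreal ((4 * pi * t) powr (- real CARD('n) / 2)) * ennreal ((4 * pi * t) powr (CARD('n) / 2))"
    using assms nn_integral_gaussian[of "1 / (4 * t)", where 'n = 'n] by (simp add: mult_ac)
  also have "\<dots> = 1" using assms by (simp add: ennreal_mult'[symmetric] powr_add[symmetric])
  finally show ?thesis .
qed

lemma heat_integrable: assumes "t > 0" shows "integrable lborel (heat t :: real^'n::finite \<Rightarrow> real)"
  using nn_integral_heat[OF assms, where 'n = 'n] by (intro integrableI_bounded) (auto simp: heat_nonneg)

lemma heat_integral: assumes "t > 0" shows "integral\<^sup>L lborel (heat t :: real^'n::finite \<Rightarrow> real) = 1"
  using nn_integral_heat[OF assms, where 'n = 'n]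
  by (subst integral_eq_nn_integral) (auto simp: heat_nonneg)

lemma integral_gaussian_cis_heat:
  assumes t: "t > 0"
  shows "(\<integral>\<xi>. of_real (exp (- t * (norm (\<xi>::real^'n::finite))\<^sup>2)) * cis (z \<bullet> \<xi>) \<partial>lborel)
    = complex_of_real ((2 * pi) powr (real CARD('n)) * heat t z)"
proof -
  have "pi / t = (2 * pi)\<^sup>2 / (4 * pi * t)"
    using t by (simp add: power2_eq_square field_simps)
  then have "(pi / t) powr (CARD('n) / 2) = ((2 * pi)\<^sup>2) powr (CARD('n) / 2) / (4 * pi * t) powr (CARD('n) / 2)"
    using t by (simp only: powr_divide zero_le_power2)
  also have "((2 * pi)\<^sup>2) powr (CARD('n) / 2) = (2 * pi) powr (real CARD('n))"
    by (subst powr_numeral[symmetric]) (simp_all only: powr_powr, simp_all)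
  also have "(2 * pi) powr (real CARD('n)) / (4 * pi * t) powr (CARD('n) / 2) =
      (2 * pi) powr (real CARD('n)) * (4 * pi * t) powr (- real CARD('n) / 2)"
    by (simp only: powr_minus divide_inverse minus_mult_left[symmetric])
  finally show ?thesis using integral_gaussian_cis[OF t, of z] by (simp add: heat_def mult.assoc)
qed

lemma gaussian_integrable:
  assumes t: "t > 0" shows "integrable lborel (\<lambda>\<xi>::real^'n::finite. complex_of_real (exp (- t * (norm \<xi>)\<^sup>2)))"
proof (rule integrableI_bounded)
  show "(\<integral>\<^sup>+\<xi>. ennreal (norm (complex_of_real (exp (- t * (norm (\<xi>::real^'n))\<^sup>2)))) \<partial>lborel) < \<infinity>"
    unfolding norm_of_real abs_exp_cancel nn_integral_gaussian[OF t] by simp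
qed measurable

text \<open>The transform of an integrable function need not be integrable; the Gaussian factor
  makes Fubini applicable. As t tends to 0 the formula gives Fourier inversion, and integrated
  against a Gamma density it gives the Bessel kernel.\<close>

lemma ifourier_gaussian_mult:
  fixes f :: "'n::finite test"
  assumes f: "integrable lborel f" and t: "t > 0"
  shows "ifourier (\<lambda>\<xi>. of_real (exp (- t * (norm \<xi>)\<^sup>2)) * fourier f \<xi>) x = (\<integral>y. of_real (heat t (x - y)) * f y \<partial>lborel)"
proof -
  let ?c = "complex_of_real ((2 * pi) powr (- real CARD('n)))"
  let ?g = "\<lambda>\<xi>. complex_of_real (exp (- t * (norm \<xi>)\<^sup>2)) * cis (x \<bullet> \<xi>)"
  have "(\<integral>\<xi>. ?g \<xi> * (\<integral>y. cis (- (y \<bullet> \<xi>)) * f y \<partial>lborel) \<partial>lborel)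
      = (\<integral>y. (\<integral>\<xi>. ?g \<xi> * cis (- (y \<bullet> \<xi>)) \<partial>lborel) * f y \<partial>lborel)"
    by (rule Fubini_bounded_kernel[where B = 1, OF integrable_mult_cis[OF gaussian_integrable[OF t]] f]) auto
  also have "\<dots> = (\<integral>y. of_real ((2 * pi) powr (real CARD('n))) * (of_real (heat t (x - y)) * f y) \<partial>lborel)"
  proof (intro Bochner_Integration.integral_cong refl)
    fix y
    have "?g \<xi> * cis (- (y \<bullet> \<xi>)) = of_real (exp (- t * (norm \<xi>)\<^sup>2)) * cis ((x - y) \<bullet> \<xi>)" for \<xi>
      by (simp add: cis_mult inner_diff_left mult.assoc)
    then show "(\<integral>\<xi>. ?g \<xi> * cis (- (y \<bullet> \<xi>)) \<partial>lborel) * f y = of_real ((2 * pi) powr (real CARD('n))) * (of_real (heat t (x - y)) * f y)"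
      by (simp only: integral_gaussian_cis_heat[OF t] of_real_mult mult.assoc)
  qed
  finally have "?c * (\<integral>\<xi>. ?g \<xi> * (\<integral>y. cis (- (y \<bullet> \<xi>)) * f y \<partial>lborel) \<partial>lborel) =
      (?c * of_real ((2 * pi) powr (real CARD('n)))) * (\<integral>y. of_real (heat t (x - y)) * f y \<partial>lborel)"
    by simp
  also have "?c * of_real ((2 * pi) powr (real CARD('n))) = 1"
    by (simp add: powr_minus flip: of_real_mult)
  finally show ?thesis
    by (simp add: ifourier_def fourier_def mult_ac)
qed

lemma integral_heat_rescale:
  fixes f :: "'n::finite test"
  assumes f: "f \<in> schwartz" and t: "t > 0"
  shows "(\<integral>y. of_real (heat t (x - y)) * f y \<partial>lborel) = (\<integral>z. of_real (heat 1 z) * f (x + sqrt t *\<^sub>R z) \<partial>lborel)"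
proof -
  obtain C where C: "C \<ge> 0" "\<And>x. norm (f x) \<le> C" using schwartz_bounded[OF f] by metis
  note [measurable] = f[THEN schwartz_measurable]
  have "integrable lborel (\<lambda>y. of_real (heat t (x - y)) * f y)"
    using C by (intro Bochner_Integration.integrable_bound[OF integrable_mult_right[OF integrable_reflect_shift(1)[OF heat_integrable[OF t]], of C x]])
      (auto simp: norm_mult heat_nonneg mult.commute mult_right_mono)
  from integral_lborel_affine[OF this, of "sqrt t" x] t
  have "(\<integral>y. of_real (heat t (x - y)) * f y \<partial>lborel) = sqrt t ^ CARD('n) *\<^sub>R (\<integral>z. of_real (heat t (sqrt t *\<^sub>R z)) * f (x + sqrt t *\<^sub>R z) \<partial>lborel)"
    by (simp add: heat_minus)
  also have "\<dots> = (\<integral>z. of_real (sqrt t ^ CARD('n) * heat t (sqrt t *\<^sub>R z)) * f (x + sqrt t *\<^sub>R z) \<partial>lborel)"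
    by (simp add: scaleR_conv_of_real mult.assoc)
  also have "(\<lambda>z. sqrt t ^ CARD('n) * heat t (sqrt t *\<^sub>R z)) = (heat 1 :: real^'n \<Rightarrow> real)"
  proof
    fix z :: "real^'n"
    have "sqrt t ^ CARD('n) = t powr (CARD('n) / 2)"
      using t by (simp add: powr_half_sqrt[symmetric] powr_realpow[symmetric] powr_powr)
    moreover have "(4 * pi * t) powr (- real CARD('n) / 2) = (4 * pi) powr (- real CARD('n) / 2) * t powr (- real CARD('n) / 2)"
      using t by (simp add: powr_mult)
    moreover have "t powr (CARD('n) / 2) * t powr (- real CARD('n) / 2) = 1" using t by (simp add: powr_add[symmetric])
    ultimately show "sqrt t ^ CARD('n) * heat t (sqrt t *\<^sub>R z) = heat 1 z"
      using t by (simp add: heat_def power_mult_distrib)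
  qed
  finally show ?thesis .
qed

section \<open>Fourier inversion\<close>

text \<open>Both sides of the regularised formula converge as t tends to 0. On the frequency side
  \<open>fourier f\<close> is an integrable majorant. On the space side a rescaling freezes the
  kernel at time 1 and moves t into the argument of \<open>f\<close>, where continuity and
  boundedness of \<open>f\<close> apply.\<close>

theorem ifourier_fourier:
  fixes f :: "'n::finite test"
  assumes f: "f \<in> schwartz"
  shows "ifourier (fourier f) = f"
proof
  fix x
  define t where "t k = 1 / real (Suc k)" for k
  have t: "t k > 0" for k by (auto simp: t_def)
  have t0: "t \<longlonglongrightarrow> 0" unfolding t_def by (rule lim_1_over_n[THEN LIMSEQ_Suc])
  note [measurable] = f[THEN schwartz_measurable] fourier_schwartz[OF f, THEN schwartz_measurable]
  obtain C where C: "C \<ge> 0" "\<And>x. norm (f x) \<le> C" using schwartz_bounded[OF f] by metis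
  have "(\<lambda>k. \<integral>\<xi>. (of_real (exp (- t k * (norm \<xi>)\<^sup>2)) * fourier f \<xi>) * cis (x \<bullet> \<xi>) \<partial>lborel)
     \<longlonglongrightarrow> (\<integral>\<xi>. fourier f \<xi> * cis (x \<bullet> \<xi>) \<partial>lborel)"
  proof (rule integral_dominated_convergence[where w = "\<lambda>\<xi>. norm (fourier f \<xi>)"])
    show "integrable lborel (\<lambda>\<xi>. norm (fourier f \<xi>))" by (intro integrable_norm schwartz_integrable fourier_schwartz f)
    show "AE \<xi> in lborel. (\<lambda>k. of_real (exp (- t k * (norm \<xi>)\<^sup>2)) * fourier f \<xi> * cis (x \<bullet> \<xi>)) \<longlonglongrightarrow> fourier f \<xi> * cis (x \<bullet> \<xi>)"
    proof (intro AE_I2)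
      fix \<xi>
      have "(\<lambda>k. complex_of_real (exp (- t k * (norm \<xi>)\<^sup>2)) * fourier f \<xi> * cis (x \<bullet> \<xi>)) \<longlonglongrightarrow> complex_of_real (exp (- 0 * (norm \<xi>)\<^sup>2)) * fourier f \<xi> * cis (x \<bullet> \<xi>)"
        by (intro tendsto_intros t0)
      then show "(\<lambda>k. complex_of_real (exp (- t k * (norm \<xi>)\<^sup>2)) * fourier f \<xi> * cis (x \<bullet> \<xi>)) \<longlonglongrightarrow> fourier f \<xi> * cis (x \<bullet> \<xi>)" by simp
    qed
    show "AE \<xi> in lborel. norm (of_real (exp (- t k * (norm \<xi>)\<^sup>2)) * fourier f \<xi> * cis (x \<bullet> \<xi>)) \<le> norm (fourier f \<xi>)" for k
      using t[of k] by (intro AE_I2) (simp add: norm_mult mult_left_le_one_le)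
  qed measurable
  then have "(\<lambda>k. ifourier (\<lambda>\<xi>. of_real (exp (- t k * (norm \<xi>)\<^sup>2)) * fourier f \<xi>) x) \<longlonglongrightarrow> ifourier (fourier f) x"
    unfolding ifourier_def by (intro tendsto_mult tendsto_const)
  moreover have "(\<lambda>k. \<integral>z. of_real (heat 1 z) * f (x + sqrt (t k) *\<^sub>R z) \<partial>lborel) \<longlonglongrightarrow> (\<integral>z. of_real (heat 1 (z::real^'n)) * f x \<partial>lborel)"
  proof (rule integral_dominated_convergence[where w = "\<lambda>z::real^'n. heat 1 z * C"])
    show "integrable lborel (\<lambda>z::real^'n. heat 1 z * C)" by (intro integrable_mult_left heat_integrable) auto
    show "AE z in lborel. (\<lambda>k. of_real (heat 1 z) * f (x + sqrt (t k) *\<^sub>R z)) \<longlonglongrightarrow> of_real (heat 1 z) * f x"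
    proof (intro AE_I2 tendsto_mult tendsto_const)
      fix z
      have "(\<lambda>k. x + sqrt (t k) *\<^sub>R z) \<longlonglongrightarrow> x + sqrt 0 *\<^sub>R z"
        by (intro tendsto_intros t0)
      then have "(\<lambda>k. x + sqrt (t k) *\<^sub>R z) \<longlonglongrightarrow> x" by simp
      moreover have "isCont f x"
        using smooth_fun_continuous[OF schwartz_smooth[OF f], of UNIV] by (simp add: continuous_on_eq_continuous_at)
      ultimately show "(\<lambda>k. f (x + sqrt (t k) *\<^sub>R z)) \<longlonglongrightarrow> f x" by (rule isCont_tendsto_compose[rotated])
    qed
    show "AE z in lborel. norm (of_real (heat 1 z) * f (x + sqrt (t k) *\<^sub>R z)) \<le> heat 1 z * C" for k
      using C by (intro AE_I2) (simp add: norm_mult heat_nonneg mult_left_mono)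
  qed measurable
  moreover have "(\<integral>z. of_real (heat 1 (z::real^'n)) * f x \<partial>lborel) = f x"
    using heat_integral[of 1, where 'n = 'n] by simp
  ultimately show "ifourier (fourier f) x = f x"
    unfolding ifourier_gaussian_mult[OF schwartz_integrable[OF f] t] integral_heat_rescale[OF f t]
    using LIMSEQ_unique by auto
qed

text \<open>\<open>ifourier\<close> is a reflected multiple of \<open>fourier\<close>, and an even
  factor does not notice the reflection. The case m = 1 is the second inversion formula. For the
  Bessel symbol it identifies the order of transforms in \<open>bessel\<close> with the opposite
  order that duality produces in the definition of the space.\<close>

lemma fourier_ifourier_commute:
  fixes \<phi> :: "'n::finite test"
  assumes \<phi>: "\<phi> \<in> schwartz" and m: "slow m" and even: "\<And>\<xi>. m (- \<xi>) = m \<xi>"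
  shows "fourier (\<lambda>\<xi>. m \<xi> * ifourier \<phi> \<xi>) = ifourier (\<lambda>\<xi>. m \<xi> * fourier \<phi> \<xi>)"
proof
  fix x
  let ?c = "complex_of_real ((2 * pi) powr (- real CARD('n)))"
  let ?g = "\<lambda>\<xi>. m \<xi> * fourier \<phi> \<xi>"
  have "(\<lambda>\<xi>. m \<xi> * ifourier \<phi> \<xi>) = (\<lambda>\<xi>. ?c * ?g (- \<xi>))"
    by (simp add: ifourier_eq_fourier even mult_ac)
  then show "fourier (\<lambda>\<xi>. m \<xi> * ifourier \<phi> \<xi>) x = ifourier ?g x"
    using fourier_reflect[of ?g x, OF schwartz_integrable[OF schwartz_slow_mult[OF m fourier_schwartz[OF \<phi>]]]]
    by (simp only: fourier_cmult ifourier_eq_fourier)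
qed

lemma fourier_ifourier:
  assumes "f \<in> schwartz" shows "fourier (ifourier f) = f"
  using fourier_ifourier_commute[OF assms slow_const[of 1]] ifourier_fourier[OF assms] by simp

section \<open>Bessel potentials of Schwartz functions\<close>

definition bessel :: "real \<Rightarrow> 'n::finite test \<Rightarrow> 'n test" where
  "bessel s f = ifourier (\<lambda>\<xi>. bessel_symbol s \<xi> * fourier f \<xi>)"

lemma bessel_symbol_add: "bessel_symbol s \<xi> * bessel_symbol t \<xi> = bessel_symbol (s + t) \<xi>"
  by (simp add: bessel_symbol_def add_divide_distrib powr_add)

lemma bessel_symbol_0: "bessel_symbol 0 \<xi> = 1"
  using lam_pos[of \<xi>] by (simp add: bessel_symbol_def)

lemma bessel_symbol_minus: "bessel_symbol s (- \<xi>) = bessel_symbol s \<xi>"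
  by (simp add: bessel_symbol_def)

lemma bessel_symbol_even_nat: "bessel_symbol (2 * real k) \<xi> = of_real (lam \<xi>) ^ k"
proof -
  have "lam \<xi> powr (2 * real k / 2) = lam \<xi> ^ k" using lam_pos[of \<xi>] by (simp add: powr_realpow)
  then show ?thesis unfolding bessel_symbol_def by (simp only: of_real_power)
qed

lemma bessel_alt: "\<phi> \<in> schwartz \<Longrightarrow> bessel s \<phi> = fourier (\<lambda>\<xi>. bessel_symbol s \<xi> * ifourier \<phi> \<xi>)"
  unfolding bessel_def by (rule fourier_ifourier_commute[symmetric]) (auto simp: slow_bessel_symbol bessel_symbol_minus)

lemma schwartz_bessel_mult: "f \<in> schwartz \<Longrightarrow> (\<lambda>\<xi>. bessel_symbol s \<xi> * fourier f \<xi>) \<in> schwartz"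
  by (intro schwartz_slow_mult slow_bessel_symbol fourier_schwartz)

lemma schwartz_bessel: "f \<in> schwartz \<Longrightarrow> bessel s f \<in> schwartz"
  unfolding bessel_def by (intro ifourier_schwartz schwartz_bessel_mult)

lemma fourier_bessel: "f \<in> schwartz \<Longrightarrow> fourier (bessel s f) = (\<lambda>\<xi>. bessel_symbol s \<xi> * fourier f \<xi>)"
  unfolding bessel_def by (intro fourier_ifourier schwartz_bessel_mult)

lemma bessel_bessel: "f \<in> schwartz \<Longrightarrow> bessel s (bessel t f) = bessel (s + t) f"
  by (subst bessel_def) (simp add: fourier_bessel bessel_symbol_add mult.assoc[symmetric], simp add: bessel_def)

lemma bessel_0: "f \<in> schwartz \<Longrightarrow> bessel 0 f = f"
  by (simp add: bessel_def bessel_symbol_0 ifourier_fourier)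

lemma bessel_minus_cancel: "f \<in> schwartz \<Longrightarrow> bessel s (bessel (- s) f) = f"
  by (simp add: bessel_bessel bessel_0)

lemma bessel_even_nat: "f \<in> schwartz \<Longrightarrow> bessel (2 * real k) f = (Lop ^^ k) f"
  unfolding bessel_def bessel_symbol_even_nat
  by (subst fourier_Lop_pow[symmetric]) (simp_all add: ifourier_fourier schwartz_Lop_pow)

lemma bessel_add:
  assumes "f \<in> schwartz" "g \<in> schwartz"
  shows "bessel s (\<lambda>x. f x + g x) = (\<lambda>x. bessel s f x + bessel s g x)"
  unfolding bessel_alt[OF assms(1)] bessel_alt[OF assms(2)] bessel_alt[OF schwartz_add[OF assms]]
  using assms
  by (subst fourier_add[symmetric])
     (auto simp: ifourier_eq_fourier fourier_add schwartz_integrable ring_distribs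
       intro!: schwartz_integrable schwartz_slow_mult slow_bessel_symbol ifourier_schwartz[unfolded ifourier_eq_fourier[abs_def]])

lemma bessel_cmult: "bessel s (\<lambda>x. c * f x) = (\<lambda>x. c * bessel s f x)"
  by (simp add: bessel_def fourier_cmult ifourier_def mult_ac)

text \<open>The pairing is bilinear, without conjugation, as in the action of a distribution. Two
  applications of Parseval's formula move the symbol from one factor to the other.\<close>

lemma bessel_symmetric:
  fixes f g :: "'n::finite test"
  assumes f: "f \<in> schwartz" and g: "g \<in> schwartz"
  shows "(\<integral>x. bessel s f x * g x \<partial>lborel) = (\<integral>x. f x * bessel s g x \<partial>lborel)"
proof -
  have "(\<integral>x. f x * bessel s g x \<partial>lborel) = (\<integral>x. fourier f x * (bessel_symbol s x * ifourier g x) \<partial>lborel)"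
    unfolding bessel_alt[OF g] by (intro fourier_parseval schwartz_integrable f schwartz_slow_mult slow_bessel_symbol ifourier_schwartz g)
  also have "\<dots> = (\<integral>x. fourier (bessel s f) x * ifourier g x \<partial>lborel)"
    by (simp add: fourier_bessel[OF f] mult_ac)
  also have "\<dots> = (\<integral>x. bessel s f x * fourier (ifourier g) x \<partial>lborel)"
    by (intro fourier_parseval[symmetric] schwartz_integrable schwartz_bessel f ifourier_schwartz g)
  finally show ?thesis by (simp add: fourier_ifourier[OF g])
qed

text \<open>If a symbol is a superposition of nonnegative symbols, so is the operator; nonnegativity
  makes the total \<open>M\<close> itself the majorant for Fubini. It is applied to a negative power
  of \<open>lam\<close>, to 1 - exp (- lam * t) as an integral over [0, t], and to a positive
  fractional power.\<close>

lemma ifourier_superposition: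
  fixes g :: "'n::finite test"
  assumes k [measurable]: "(\<lambda>(\<xi>, t). k t \<xi>) \<in> borel_measurable (lborel \<Otimes>\<^sub>M lborel)"
    and k0: "\<And>t \<xi>. k t \<xi> \<ge> (0::real)"
    and M: "\<And>\<xi>. (\<integral>\<^sup>+t. ennreal (k t \<xi>) \<partial>lborel) = ennreal (M \<xi>)" and M0: "\<And>\<xi>. M \<xi> \<ge> 0"
    and g [measurable]: "g \<in> borel_measurable borel"
    and int: "integrable lborel (\<lambda>\<xi>. of_real (M \<xi>) * g \<xi>)"
  shows "ifourier (\<lambda>\<xi>. of_real (M \<xi>) * g \<xi>) x = (\<integral>t. ifourier (\<lambda>\<xi>. of_real (k t \<xi>) * g \<xi>) x \<partial>lborel)"
    and "integrable lborel (\<lambda>t. ifourier (\<lambda>\<xi>. of_real (k t \<xi>) * g \<xi>) x)"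
proof -
  let ?h = "\<lambda>\<xi> t. (of_real (k t \<xi>) * g \<xi>) * cis (x \<bullet> \<xi>)"
  have kt: "integrable lborel (\<lambda>t. k t \<xi>)" for \<xi>
    using M[of \<xi>] k0 by (intro integrableI_nonneg) auto
  have kM: "(\<integral>t. k t \<xi> \<partial>lborel) = M \<xi>" for \<xi>
    using M[of \<xi>] k0 M0 by (subst integral_eq_nn_integral) auto
  have kt': "integrable lborel (\<lambda>t. complex_of_real (k t \<xi>))" for \<xi>
    using kt by (rule integrable_of_real)
  have inth: "integrable lborel (\<lambda>t. ?h \<xi> t)" for \<xi>
    by (intro integrable_mult_left kt')
  have intp: "integrable (lborel \<Otimes>\<^sub>M lborel) (\<lambda>(\<xi>, t). ?h \<xi> t)"
  proof (rule lborel_pair.Fubini_integrable)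
    have "(\<integral>t. norm (?h \<xi> t) \<partial>lborel) = norm (of_real (M \<xi>) * g \<xi>)" for \<xi>
      using k0 M0 by (simp add: norm_mult kM)
    then show "integrable lborel (\<lambda>\<xi>. \<integral>t. norm (case (\<xi>, t) of (\<xi>, t) \<Rightarrow> ?h \<xi> t) \<partial>lborel)"
      using integrable_norm[OF int] by simp
  qed (use inth in auto)
  have "(\<integral>t. (\<integral>\<xi>. ?h \<xi> t \<partial>lborel) \<partial>lborel) = (\<integral>\<xi>. (\<integral>t. ?h \<xi> t \<partial>lborel) \<partial>lborel)"
    by (rule lborel_pair.Fubini_integral[OF intp])
  also have "(\<lambda>\<xi>. \<integral>t. ?h \<xi> t \<partial>lborel) = (\<lambda>\<xi>. (of_real (M \<xi>) * g \<xi>) * cis (x \<bullet> \<xi>))"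
    by (simp add: kM)
  finally have eq: "(\<integral>t. (\<integral>\<xi>. ?h \<xi> t \<partial>lborel) \<partial>lborel) = (\<integral>\<xi>. (of_real (M \<xi>) * g \<xi>) * cis (x \<bullet> \<xi>) \<partial>lborel)" .
  show "ifourier (\<lambda>\<xi>. of_real (M \<xi>) * g \<xi>) x = (\<integral>t. ifourier (\<lambda>\<xi>. of_real (k t \<xi>) * g \<xi>) x \<partial>lborel)"
    unfolding ifourier_def integral_mult_right_zero eq ..
  show "integrable lborel (\<lambda>t. ifourier (\<lambda>\<xi>. of_real (k t \<xi>) * g \<xi>) x)"
    unfolding ifourier_def using lborel_pair.integrable_snd[OF intp] by (intro integrable_mult_right) simp
qed

lemma heat_integral_shift: "t > 0 \<Longrightarrow> (\<integral>y. heat t (x - y) \<partial>lborel) = 1" for x :: "real^'n::finite"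
  by (simp only: integrable_reflect_shift(2)[OF heat_integrable] heat_integral)

definition heat_op :: "real \<Rightarrow> 'n::finite test \<Rightarrow> 'n test" where
  "heat_op t f x = (\<integral>y. of_real (heat t (x - y)) * f y \<partial>lborel)"

lemma ifourier_exp_lam:
  assumes "f \<in> schwartz" "t > 0"
  shows "ifourier (\<lambda>\<xi>. of_real (exp (- (lam \<xi> * t))) * fourier f \<xi>) x = of_real (exp (- t)) * heat_op t f x"
proof -
  have "complex_of_real (exp (- (lam \<xi> * t))) = of_real (exp (- t)) * of_real (exp (- t * (norm \<xi>)\<^sup>2))" for \<xi> :: "real^'a"
    by (simp add: mult_exp_exp algebra_simps flip: of_real_mult)
  then have "ifourier (\<lambda>\<xi>. of_real (exp (- (lam \<xi> * t))) * fourier f \<xi>) x =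
     ifourier (\<lambda>\<xi>. of_real (exp (- t)) * (of_real (exp (- t * (norm \<xi>)\<^sup>2)) * fourier f \<xi>)) x"
    by (simp only: mult.assoc)
  also have "\<dots> = of_real (exp (- t)) * ifourier (\<lambda>\<xi>. of_real (exp (- t * (norm \<xi>)\<^sup>2)) * fourier f \<xi>) x"
    unfolding ifourier_def mult.assoc[of "of_real (exp (- t))"] integral_mult_right_zero by (simp only: mult_ac)
  finally show ?thesis
    unfolding heat_op_def ifourier_gaussian_mult[OF schwartz_integrable[OF assms(1)] assms(2)] .
qed

lemma norm_heat_op_le:
  assumes f: "f \<in> borel_measurable borel" and C: "\<And>x. norm (f x) \<le> C" and t: "t > 0"
  shows "norm (heat_op t f x) \<le> C"
proof -
  note [measurable] = f
  have i: "integrable lborel (\<lambda>y. heat t (x - y))" by (rule integrable_reflect_shift(1)[OF heat_integrable[OF t]])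
  have ih: "integrable lborel (\<lambda>y. norm (of_real (heat t (x - y)) * f y))"
  proof (rule Bochner_Integration.integrable_bound[OF integrable_mult_left[OF i, of C]], measurable, intro AE_I2)
    fix y show "norm (norm (of_real (heat t (x - y)) * f y)) \<le> norm (heat t (x - y) * C)"
      using order_trans[OF norm_ge_zero C] C[of y] by (simp add: norm_mult heat_nonneg mult_left_mono)
  qed
  have "norm (heat_op t f x) \<le> (\<integral>y. norm (of_real (heat t (x - y)) * f y) \<partial>lborel)"
    unfolding heat_op_def by (rule integral_norm_bound)
  also have "\<dots> \<le> (\<integral>y. heat t (x - y) * C \<partial>lborel)"
    by (intro integral_mono ih integrable_mult_left i) (simp add: norm_mult heat_nonneg mult_left_mono C)
  also have "\<dots> = C" by (simp add: heat_integral_shift t)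
  finally show ?thesis .
qed

section \<open>Negative orders and the Bessel kernel\<close>

text \<open>The Gamma law of shape a/2; the half appears because order -a has the symbol lam powr (-
  a / 2).\<close>

definition gamma_density :: "real \<Rightarrow> real \<Rightarrow> real" where
  "gamma_density a t = indicator {0<..} t * t powr (a / 2 - 1) * exp (- t) / Gamma (a / 2)"

lemma gamma_density_measurable [measurable]: "gamma_density a \<in> borel_measurable borel"
  unfolding gamma_density_def[abs_def] by measurable

lemma gamma_density_nonneg: "a > 0 \<Longrightarrow> gamma_density a t \<ge> 0"
  using Gamma_real_pos[of "a / 2"] by (simp add: gamma_density_def)

lemma gamma_density_eq_0: "t \<le> 0 \<Longrightarrow> gamma_density a t = 0"
  by (simp add: gamma_density_def)

text \<open>A negative moment of the Gamma law. Later b = n / (2 p), so that the condition reads a >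
  n / p: it decides where potentials of Lp functions become continuous.\<close>

lemma nn_integral_gamma_density_powr:
  assumes a: "a > 0" and b: "a / 2 - b > 0"
  shows "(\<integral>\<^sup>+t. ennreal (gamma_density a t * t powr (- b)) \<partial>lborel) < \<infinity>"
proof -
  have "(\<integral>\<^sup>+t. ennreal (gamma_density a t * t powr (- b)) \<partial>lborel) =
     (\<integral>\<^sup>+t. ennreal (1 / Gamma (a / 2)) * ennreal (indicator {0<..} t * t powr ((a / 2 - b) - 1) * exp (- (1 * t))) \<partial>lborel)"
  proof (intro nn_integral_cong)
    fix t :: real
    have "t powr (a / 2 - 1) * t powr (- b) = t powr ((a / 2 - b) - 1)" if "t > 0"
      using that by (simp add: powr_add[symmetric] algebra_simps)
    then show "ennreal (gamma_density a t * t powr (- b)) =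
        ennreal (1 / Gamma (a / 2)) * ennreal (indicator {0<..} t * t powr ((a / 2 - b) - 1) * exp (- (1 * t)))"
      using Gamma_real_pos[of "a / 2"] a
      by (cases "t > 0") (simp_all add: gamma_density_def ennreal_mult'[symmetric] field_simps)
  qed
  also have "\<dots> = ennreal (1 / Gamma (a / 2)) * ennreal (Gamma (a / 2 - b) * 1 powr (-(a / 2 - b)))"
    by (subst nn_integral_cmult) (measurable, simp only: nn_integral_Gamma[OF b zero_less_one])
  also have "\<dots> < \<infinity>" by (simp add: ennreal_mult_less_top)
  finally show ?thesis .
qed

lemma gamma_density_integral:
  assumes a: "a > 0"
  shows "integrable lborel (gamma_density a)" "integral\<^sup>L lborel (gamma_density a) = 1"
proof -
  have "(\<integral>\<^sup>+t. ennreal (gamma_density a t) \<partial>lborel) =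
     (\<integral>\<^sup>+t. ennreal (1 / Gamma (a / 2)) * ennreal (indicator {0<..} t * t powr (a / 2 - 1) * exp (- (1 * t))) \<partial>lborel)"
    using Gamma_real_pos[of "a / 2"] a
    by (intro nn_integral_cong) (simp add: gamma_density_def ennreal_mult'[symmetric])
  also have "\<dots> = ennreal (1 / Gamma (a / 2)) * ennreal (Gamma (a / 2) * 1 powr (-(a / 2)))"
    using a by (subst nn_integral_cmult) (measurable, simp only: nn_integral_Gamma[of "a / 2" 1] zero_less_one half_gt_zero)
  also have "\<dots> = 1"
    using Gamma_real_pos[of "a / 2"] a by (simp add: ennreal_mult'[symmetric] del: Gamma_real_pos)
  finally have *: "(\<integral>\<^sup>+t. ennreal (gamma_density a t) \<partial>lborel) = 1" .
  show "integrable lborel (gamma_density a)"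
    using * gamma_density_nonneg[OF a] by (intro integrableI_nonneg) auto
  show "integral\<^sup>L lborel (gamma_density a) = 1"
    using * gamma_density_nonneg[OF a] by (subst integral_eq_nn_integral) auto
qed

text \<open>By the Gamma integral, lam powr (- a / 2) is a weighted mean of exp (- lam * t), the
  symbol of exp (- t) times the heat semigroup. The factor exp (- t) is what makes the weight a
  probability density.\<close>

lemma bessel_neg_heat:
  fixes f :: "'n::finite test"
  assumes f: "f \<in> schwartz" and a: "a > 0"
  shows "bessel (- a) f x = (\<integral>t. of_real (gamma_density a t) * heat_op t f x \<partial>lborel)"
proof -
  let ?k = "\<lambda>t \<xi>. (indicator {0<..} t * t powr (a / 2 - 1) * exp (- (lam \<xi> * t))) / Gamma (a / 2) :: real"
  note [measurable] = fourier_schwartz[OF f, THEN schwartz_measurable]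
  have G: "Gamma (a / 2) > 0" using a by (intro Gamma_real_pos) auto
  have bs: "bessel_symbol (- a) \<xi> = of_real (lam \<xi> powr (- (a / 2)))" for \<xi> :: "real^'n"
    by (simp add: bessel_symbol_def)
  have "bessel (- a) f x = (\<integral>t. ifourier (\<lambda>\<xi>. of_real (?k t \<xi>) * fourier f \<xi>) x \<partial>lborel)"
    unfolding bessel_def bs
  proof (rule ifourier_superposition)
    fix \<xi> :: "real^'n"
    have "(\<integral>\<^sup>+t. ennreal (?k t \<xi>) \<partial>lborel) =
       (\<integral>\<^sup>+t. ennreal (1 / Gamma (a / 2)) * ennreal (indicator {0<..} t * t powr (a / 2 - 1) * exp (- (lam \<xi> * t))) \<partial>lborel)"
      using G by (intro nn_integral_cong) (simp add: ennreal_mult'[symmetric])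
    also have "\<dots> = ennreal (1 / Gamma (a / 2)) * ennreal (Gamma (a / 2) * lam \<xi> powr (- (a / 2)))"
      using a by (subst nn_integral_cmult) (measurable, simp only: nn_integral_Gamma[OF _ lam_pos] half_gt_zero)
    also have "\<dots> = ennreal (lam \<xi> powr (- (a / 2)))" using G by (simp add: ennreal_mult'[symmetric])
    finally show "(\<integral>\<^sup>+t. ennreal (?k t \<xi>) \<partial>lborel) = ennreal (lam \<xi> powr (- (a / 2)))" .
    show "?k t \<xi> \<ge> 0" for t using G by simp
    show "integrable lborel (\<lambda>\<xi>. complex_of_real (lam \<xi> powr (- (a / 2))) * fourier f \<xi>)"
      using schwartz_integrable[OF schwartz_bessel_mult[OF f, of "- a"]] unfolding bs .
  qed auto
  also have "\<dots> = (\<integral>t. of_real (gamma_density a t) * heat_op t f x \<partial>lborel)"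
  proof (intro Bochner_Integration.integral_cong refl)
    fix t :: real
    show "ifourier (\<lambda>\<xi>. of_real (?k t \<xi>) * fourier f \<xi>) x = of_real (gamma_density a t) * heat_op t f x"
    proof (cases "t > 0")
      case True
      have "ifourier (\<lambda>\<xi>. of_real (?k t \<xi>) * fourier f \<xi>) x =
         ifourier (\<lambda>\<xi>. of_real (t powr (a / 2 - 1) / Gamma (a / 2)) * (of_real (exp (- (lam \<xi> * t))) * fourier f \<xi>)) x"
        using True by (simp add: mult_ac)
      also have "\<dots> = of_real (t powr (a / 2 - 1) / Gamma (a / 2)) * ifourier (\<lambda>\<xi>. of_real (exp (- (lam \<xi> * t))) * fourier f \<xi>) x"
        unfolding ifourier_def mult.assoc[of "of_real (t powr (a / 2 - 1) / Gamma (a / 2))"] integral_mult_right_zero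
        by (simp only: mult_ac)
      also have "\<dots> = of_real (gamma_density a t) * heat_op t f x"
        unfolding ifourier_exp_lam[OF f True] using True by (simp add: gamma_density_def)
      finally show ?thesis .
    qed (simp add: gamma_density_eq_0 ifourier_def)
  qed
  finally show ?thesis .
qed

definition bessel_kernel :: "real \<Rightarrow> real^'n::finite \<Rightarrow> real" where
  "bessel_kernel a z = (\<integral>t. gamma_density a t * heat t z \<partial>lborel)"

lemma bessel_kernel_measurable [measurable]: "bessel_kernel a \<in> borel_measurable borel"
  unfolding bessel_kernel_def[abs_def] by measurable

lemma bessel_kernel_nonneg: "a > 0 \<Longrightarrow> bessel_kernel a z \<ge> 0"
  unfolding bessel_kernel_def by (intro Bochner_Integration.integral_nonneg mult_nonneg_nonneg gamma_density_nonneg heat_nonneg)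

lemma gamma_heat_integrable:
  assumes a: "a > 0"
  shows "integrable (lborel \<Otimes>\<^sub>M lborel) (\<lambda>(t, z::real^'n::finite). gamma_density a t * heat t z)"
proof (rule lborel_pair.Fubini_integrable)
  have "(\<integral>z. norm (gamma_density a t * heat t (z::real^'n)) \<partial>lborel) = gamma_density a t" for t
    using gamma_density_nonneg[OF a] heat_integral[of t, where 'n = 'n]
    by (cases "t > 0") (auto simp: heat_nonneg gamma_density_eq_0)
  then show "integrable lborel (\<lambda>t. \<integral>z. norm (case (t, z) of (t, z::real^'n) \<Rightarrow> gamma_density a t * heat t z) \<partial>lborel)"
    using gamma_density_integral(1)[OF a] by simp
  have "integrable lborel (\<lambda>z::real^'n. gamma_density a t * heat t z)" for t
    by (cases "t > 0") (auto simp: heat_integrable gamma_density_eq_0)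
  then show "AE t in lborel. integrable lborel (\<lambda>z. case (t, z) of (t, z::real^'n) \<Rightarrow> gamma_density a t * heat t z)" by simp
qed measurable

lemma bessel_kernel_integral:
  assumes a: "a > 0"
  shows "integrable lborel (bessel_kernel a :: real^'n::finite \<Rightarrow> real)" "integral\<^sup>L lborel (bessel_kernel a :: real^'n \<Rightarrow> real) = 1"
proof -
  show "integrable lborel (bessel_kernel a :: real^'n \<Rightarrow> real)"
    using lborel_pair.integrable_snd[OF gamma_heat_integrable[OF a]] unfolding bessel_kernel_def[abs_def] by simp
  have "integral\<^sup>L lborel (bessel_kernel a :: real^'n \<Rightarrow> real) = (\<integral>t. (\<integral>z. gamma_density a t * heat t (z::real^'n) \<partial>lborel) \<partial>lborel)"
    using lborel_pair.Fubini_integral[OF gamma_heat_integrable[OF a, where 'n = 'n]] unfolding bessel_kernel_def[abs_def] by simp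
  also have "(\<lambda>t. \<integral>z. gamma_density a t * heat t (z::real^'n) \<partial>lborel) = gamma_density a"
  proof
    show "(\<integral>z. gamma_density a t * heat t (z::real^'n) \<partial>lborel) = gamma_density a t" for t
      using heat_integral[of t, where 'n = 'n] by (cases "t > 0") (auto simp: gamma_density_eq_0)
  qed
  finally show "integral\<^sup>L lborel (bessel_kernel a :: real^'n \<Rightarrow> real) = 1" using gamma_density_integral[OF a] by simp
qed

text \<open>The majorant \<open>B\<close> is left open for two uses: a constant for bounded
  \<open>g\<close>, and a negative power of t for \<open>g\<close> in Lp, where heat averages may
  blow up as t tends to 0.\<close>

lemma Fubini_gamma_heat:
  fixes g :: "'n::finite test"
  assumes a: "a > 0" and [measurable]: "g \<in> borel_measurable borel"
    and int: "\<And>t. t > 0 \<Longrightarrow> integrable lborel (\<lambda>y. heat t (x - y) * norm (g y))"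
    and bd: "\<And>t. t > 0 \<Longrightarrow> (\<integral>y. heat t (x - y) * norm (g y) \<partial>lborel) \<le> B t" and B0: "\<And>t. t > 0 \<Longrightarrow> B t \<ge> 0"
    and B: "integrable lborel (\<lambda>t. gamma_density a t * B t)"
  shows "(\<integral>t. of_real (gamma_density a t) * heat_op t g x \<partial>lborel) = (\<integral>y. of_real (bessel_kernel a (x - y)) * g y \<partial>lborel)"
    and "integrable lborel (\<lambda>y. bessel_kernel a (x - y) * norm (g y))"
proof -
  let ?h = "\<lambda>t y. of_real (gamma_density a t * heat t (x - y)) * g y"
  have n: "norm (?h t y) = gamma_density a t * (heat t (x - y) * norm (g y))" for t y
    using gamma_density_nonneg[OF a, of t] heat_nonneg[of t "x - y"] by (simp add: norm_mult)
  have intp: "integrable (lborel \<Otimes>\<^sub>M lborel) (\<lambda>(t, y). ?h t y)"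
  proof (rule lborel_pair.Fubini_integrable)
    show "integrable lborel (\<lambda>t. \<integral>y. norm (case (t, y) of (t, y) \<Rightarrow> ?h t y) \<partial>lborel)"
    proof (rule Bochner_Integration.integrable_bound[OF B])
      show "AE t in lborel. norm (\<integral>y. norm (case (t, y) of (t, y) \<Rightarrow> ?h t y) \<partial>lborel) \<le> norm (gamma_density a t * B t)"
      proof (intro AE_I2)
        fix t
        show "norm (\<integral>y. norm (case (t, y) of (t, y) \<Rightarrow> ?h t y) \<partial>lborel) \<le> norm (gamma_density a t * B t)"
        proof (cases "t > 0")
          case True
          have "0 \<le> (\<integral>y. heat t (x - y) * norm (g y) \<partial>lborel)"
            by (intro Bochner_Integration.integral_nonneg) (simp add: heat_nonneg)
          then show ?thesis using bd[OF True] gamma_density_nonneg[OF a, of t] B0[OF True]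
            unfolding split n integral_mult_right_zero by (simp add: mult_left_mono)
        qed (simp add: gamma_density_eq_0)
      qed
    qed measurable
    have "integrable lborel (\<lambda>y. ?h t y)" for t
    proof (cases "t > 0")
      case True
      have "integrable lborel (\<lambda>y. norm (?h t y))" unfolding n using int[OF True] by (rule integrable_mult_right)
      then show ?thesis by (subst (asm) integrable_norm_iff) measurable
    qed (simp add: gamma_density_eq_0)
    then show "AE t in lborel. integrable lborel (\<lambda>y. case (t, y) of (t, y) \<Rightarrow> ?h t y)" by simp
  qed measurable
  have "(\<integral>y. (\<integral>t. ?h t y \<partial>lborel) \<partial>lborel) = (\<integral>t. (\<integral>y. ?h t y \<partial>lborel) \<partial>lborel)"
    by (rule lborel_pair.Fubini_integral[OF intp])
  also have "(\<lambda>y. \<integral>t. ?h t y \<partial>lborel) = (\<lambda>y. of_real (bessel_kernel a (x - y)) * g y)"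
    unfolding bessel_kernel_def by (simp only: integral_mult_left_zero integral_complex_of_real)
  also have "(\<lambda>t. \<integral>y. ?h t y \<partial>lborel) = (\<lambda>t. of_real (gamma_density a t) * heat_op t g x)"
    unfolding heat_op_def of_real_mult mult.assoc by simp
  finally show "(\<integral>t. of_real (gamma_density a t) * heat_op t g x \<partial>lborel) = (\<integral>y. of_real (bessel_kernel a (x - y)) * g y \<partial>lborel)" ..
  have "integrable (lborel \<Otimes>\<^sub>M lborel) (\<lambda>(t, y). norm (?h t y))"
    using integrable_norm[OF intp] by (simp add: case_prod_unfold)
  from lborel_pair.integrable_snd[OF this]
  have "integrable lborel (\<lambda>y. \<integral>t. norm (?h t y) \<partial>lborel)" .
  then show "integrable lborel (\<lambda>y. bessel_kernel a (x - y) * norm (g y))"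
    unfolding n bessel_kernel_def mult.assoc[symmetric] by simp
qed

lemma bessel_neg_kernel:
  fixes f :: "'n::finite test"
  assumes f: "f \<in> schwartz" and a: "a > 0"
  shows "bessel (- a) f x = (\<integral>y. of_real (bessel_kernel a (x - y)) * f y \<partial>lborel)"
proof -
  obtain C where C: "C \<ge> 0" "\<And>x. norm (f x) \<le> C" using schwartz_bounded[OF f] by metis
  note [measurable] = schwartz_measurable[OF f]
  have i: "integrable lborel (\<lambda>y. heat t (x - y))" if "t > 0" for t by (rule integrable_reflect_shift(1)[OF heat_integrable[OF that]])
  have ih: "integrable lborel (\<lambda>y. heat t (x - y) * norm (f y))" if "t > 0" for t
    using C by (intro Bochner_Integration.integrable_bound[OF integrable_mult_left[OF i[OF that], of C]]) 
      (auto simp: heat_nonneg mult_left_mono abs_mult)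
  have "(\<integral>y. heat t (x - y) * norm (f y) \<partial>lborel) \<le> C" if t: "t > 0" for t
  proof -
    have "(\<integral>y. heat t (x - y) * norm (f y) \<partial>lborel) \<le> (\<integral>y. heat t (x - y) * C \<partial>lborel)"
      by (intro integral_mono ih t integrable_mult_left i) (simp add: heat_nonneg mult_left_mono C)
    also have "\<dots> = C" by (simp add: heat_integral_shift t)
    finally show ?thesis .
  qed
  with C show ?thesis unfolding bessel_neg_heat[OF assms]
    by (intro Fubini_gamma_heat(1)[where B = "\<lambda>t. C"] a ih integrable_mult_left gamma_density_integral) auto
qed

section \<open>Bessel potentials of Lp functions\<close>

text \<open>The tangent line of x powr p at m lies below the graph; here this is Young's inequality
  with exponents p and p / (p - 1). Averaged with m equal to the mean it gives Jensen's inequality,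
  both for integrals and for finite sums.\<close>

lemma powr_tangent:
  fixes x m p :: real
  assumes "x \<ge> 0" "m > 0" "p > 1"
  shows "p * (x * m powr (p - 1)) \<le> x powr p + (p - 1) * m powr p"
proof -
  have "x * m powr (p - 1) \<le> x powr p / p + (m powr (p - 1)) powr (p / (p - 1)) / (p / (p - 1))"
    using assms by (intro Youngs_inequality) (auto simp: divide_simps)
  also have "(m powr (p - 1)) powr (p / (p - 1)) = m powr p"
    using assms by (simp add: powr_powr)
  finally have "p * (x * m powr (p - 1)) \<le> p * (x powr p / p + m powr p / (p / (p - 1)))"
    using assms by (intro mult_left_mono) auto
  also have "\<dots> = x powr p + (p - 1) * m powr p" using assms by (simp add: field_simps)
  finally show ?thesis .
qed

text \<open>Stands in for Hoelder's inequality where only finiteness matters.\<close>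

lemma le_one_plus_powr: "x \<ge> 0 \<Longrightarrow> p \<ge> 1 \<Longrightarrow> x \<le> 1 + x powr p" for x p :: real
  by (smt (verit) powr_mono powr_one powr_ge_zero)

lemma Jensen_powr:
  fixes k G :: "'a \<Rightarrow> real"
  assumes k: "integrable M k" "integral\<^sup>L M k = 1" "\<And>x. k x \<ge> 0"
    and [measurable]: "G \<in> borel_measurable M" and G: "\<And>x. G x \<ge> 0"
    and int: "integrable M (\<lambda>x. k x * G x powr p)" and p: "p > 1"
  shows "integrable M (\<lambda>x. k x * G x)"
    and "(\<integral>x. k x * G x \<partial>M) powr p \<le> (\<integral>x. k x * G x powr p \<partial>M)"
proof -
  note [measurable] = k(1)[THEN borel_measurable_integrable]
  show i: "integrable M (\<lambda>x. k x * G x)"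
  proof (rule Bochner_Integration.integrable_bound[OF Bochner_Integration.integrable_add[OF k(1) int]])
    show "AE x in M. norm (k x * G x) \<le> norm (k x + k x * G x powr p)"
    proof (intro AE_I2)
      fix x
      have "k x * G x \<le> k x * (1 + G x powr p)" using k(3) G p by (intro mult_left_mono le_one_plus_powr) auto
      then show "norm (k x * G x) \<le> norm (k x + k x * G x powr p)" using k(3) G by (simp add: algebra_simps)
    qed
  qed measurable
  define m where "m = (\<integral>x. k x * G x \<partial>M)"
  have m0: "m \<ge> 0" unfolding m_def using k(3) G by (intro Bochner_Integration.integral_nonneg) auto
  show "(\<integral>x. k x * G x \<partial>M) powr p \<le> (\<integral>x. k x * G x powr p \<partial>M)"
  proof (cases "m = 0")
    case True
    then show ?thesis unfolding m_def[symmetric] using k(3) by (auto intro!: Bochner_Integration.integral_nonneg)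
  next
    case False
    with m0 have m: "m > 0" by simp
    have "p * m powr (p - 1) * m = (\<integral>x. p * m powr (p - 1) * (k x * G x) \<partial>M)" by (simp add: m_def)
    also have "\<dots> \<le> (\<integral>x. k x * G x powr p + (p - 1) * m powr p * k x \<partial>M)"
    proof (intro integral_mono Bochner_Integration.integrable_add integrable_mult_right i int k)
      fix x
      have "k x * (p * (G x * m powr (p - 1))) \<le> k x * (G x powr p + (p - 1) * m powr p)"
        using k(3) G m p by (intro mult_left_mono powr_tangent) auto
      then show "p * m powr (p - 1) * (k x * G x) \<le> k x * G x powr p + (p - 1) * m powr p * k x"
        by (simp add: algebra_simps)
    qed
    also have "\<dots> = (\<integral>x. k x * G x powr p \<partial>M) + (p - 1) * m powr p"
      using int k by (simp add: Bochner_Integration.integral_add)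
    also have "p * m powr (p - 1) * m = p * m powr p" using m by (simp add: powr_diff)
    finally show ?thesis unfolding m_def[symmetric] by (simp add: algebra_simps)
  qed
qed

lemma pair_integrable_prob:
  fixes w :: "'a::euclidean_space \<Rightarrow> real" and k :: "'a \<Rightarrow> 'b::euclidean_space \<Rightarrow> real"
  assumes w: "integrable lborel w" and [measurable]: "(\<lambda>(a, b). k a b) \<in> borel_measurable (lborel \<Otimes>\<^sub>M lborel)"
    and k: "\<And>a. integrable lborel (k a)" "\<And>a. integral\<^sup>L lborel (k a) = 1" "\<And>a b. k a b \<ge> 0"
  shows "integrable (lborel \<Otimes>\<^sub>M lborel) (\<lambda>(a, b). w a * k a b)"
proof -
  note [measurable] = w[THEN borel_measurable_integrable]
  show ?thesis
  proof (rule lborel_pair.Fubini_integrable)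
    show "integrable lborel (\<lambda>a. \<integral>b. norm (case (a, b) of (a, b) \<Rightarrow> w a * k a b) \<partial>lborel)"
      using integrable_norm[OF w] k by (simp add: abs_mult)
  qed (use k in auto)
qed

section \<open>Convolution with a probability density\<close>

locale prob_kernel =
  fixes K :: "real^'n::finite \<Rightarrow> real"
  assumes K_int: "integrable lborel K" "integral\<^sup>L lborel K = 1" and K0: "\<And>z. K z \<ge> 0"
begin

lemma K_meas [measurable]: "K \<in> borel_measurable borel"
  using borel_measurable_integrable[OF K_int(1)] by simp

lemma K_shift:
  "integrable lborel (\<lambda>x. K (x - y))" "(\<integral>x. K (x - y) \<partial>lborel) = 1"
  "integrable lborel (\<lambda>x. K (y - x))" "(\<integral>x. K (y - x) \<partial>lborel) = 1"
  using integrable_shift[OF K_int(1), of "- y"] integrable_reflect_shift[OF K_int(1), of y] K_int(2) by auto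

text \<open>Jensen's inequality pointwise and Tonelli in the double integral: convolution with a
  probability density preserves Lp. The kernel appears with its variables transposed, as it arises
  when convolution is moved from the test function to \<open>g\<close>.\<close>

lemma conv_Lp:
  fixes g :: "'n test"
  assumes [measurable]: "g \<in> borel_measurable borel" and g: "integrable lborel (\<lambda>x. norm (g x) powr p)" and p: "p > 1"
  shows "integrable lborel (\<lambda>y. norm (\<integral>x. of_real (K (x - y)) * g x \<partial>lborel) powr p)"
proof -
  have pi: "integrable (lborel \<Otimes>\<^sub>M lborel) (\<lambda>(x, y). norm (g x) powr p * K (x - y))"
    by (rule pair_integrable_prob[OF g]) (auto simp: K_shift K0)
  have "AE y in lborel. norm (norm (\<integral>x. of_real (K (x - y)) * g x \<partial>lborel) powr p) \<le> norm (\<integral>x. norm (g x) powr p * K (x - y) \<partial>lborel)"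
    using lborel_pair.AE_integrable_snd[OF pi]
  proof eventually_elim
    case (elim y)
    then have i: "integrable lborel (\<lambda>x. K (x - y) * norm (g x) powr p)" by (simp add: mult.commute)
    have "norm (\<integral>x. of_real (K (x - y)) * g x \<partial>lborel) \<le> (\<integral>x. K (x - y) * norm (g x) \<partial>lborel)"
      by (rule order_trans[OF integral_norm_bound]) (simp add: norm_mult K0)
    then have "norm (\<integral>x. of_real (K (x - y)) * g x \<partial>lborel) powr p \<le> (\<integral>x. K (x - y) * norm (g x) \<partial>lborel) powr p"
      using p by (intro powr_mono2) auto
    also have "\<dots> \<le> (\<integral>x. K (x - y) * norm (g x) powr p \<partial>lborel)"
      by (rule Jensen_powr(2)[OF K_shift(1,2) K0 _ _ i p]) auto
    finally show ?case by (simp add: mult.commute)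
  qed
  then show ?thesis
    by (intro Bochner_Integration.integrable_bound[OF lborel_pair.integrable_snd[OF pi]]) auto
qed

text \<open>The convolution of the kernel with |\<phi>| is both integrable and bounded. After |g|
  \<le> 1 + |g| powr p, integrability handles the first term and boundedness the second, so the
  double integral converges absolutely.\<close>

lemma conv_swap:
  fixes g \<phi> :: "'n test"
  assumes [measurable]: "g \<in> borel_measurable borel" and g: "integrable lborel (\<lambda>x. norm (g x) powr p)" and p: "p > 1"
    and \<phi>: "\<phi> \<in> schwartz"
  shows "(\<integral>x. g x * (\<integral>y. of_real (K (x - y)) * \<phi> y \<partial>lborel) \<partial>lborel) = (\<integral>y. (\<integral>x. of_real (K (x - y)) * g x \<partial>lborel) * \<phi> y \<partial>lborel)"
proof -
  obtain C where C: "C \<ge> 0" "\<And>x. norm (\<phi> x) \<le> C" using schwartz_bounded[OF \<phi>] by metis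
  note [measurable] = schwartz_measurable[OF \<phi>]
  let ?h = "\<lambda>x y. g x * (of_real (K (x - y)) * \<phi> y)"
  have n: "norm (?h x y) = norm (g x) * (K (x - y) * norm (\<phi> y))" for x y
    using K0 by (simp add: norm_mult)
  have "integrable (lborel \<Otimes>\<^sub>M lborel) (\<lambda>(y, x). norm (\<phi> y) * K (x - y))"
    by (rule pair_integrable_prob[OF integrable_norm[OF schwartz_integrable[OF \<phi>]]]) (auto simp: K_shift K0)
  from lborel_pair.integrable_snd[OF this] have i1: "integrable lborel (\<lambda>x. \<integral>y. K (x - y) * norm (\<phi> y) \<partial>lborel)"
    by (simp add: mult.commute)
  have i2: "integrable lborel (\<lambda>y. K (x - y) * norm (\<phi> y))" for x
    by (rule Bochner_Integration.integrable_bound[OF integrable_mult_left[OF K_shift(3)[of x], of C]])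
       (use C K0 in \<open>auto simp: abs_mult mult_left_mono\<close>)
  have le: "(\<integral>y. K (x - y) * norm (\<phi> y) \<partial>lborel) \<le> C" for x
  proof -
    have "(\<integral>y. K (x - y) * norm (\<phi> y) \<partial>lborel) \<le> (\<integral>y. K (x - y) * C \<partial>lborel)"
      by (intro integral_mono i2 integrable_mult_left K_shift mult_left_mono C K0)
    then show ?thesis by (simp add: K_shift)
  qed
  have ge: "(\<integral>y. K (x - y) * norm (\<phi> y) \<partial>lborel) \<ge> 0" for x
    using K0 by (intro Bochner_Integration.integral_nonneg) auto
  have intp: "integrable (lborel \<Otimes>\<^sub>M lborel) (\<lambda>(x, y). ?h x y)"
  proof (rule lborel_pair.Fubini_integrable)
    have "norm (g x) * (\<integral>y. K (x - y) * norm (\<phi> y) \<partial>lborel) \<le>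
       (\<integral>y. K (x - y) * norm (\<phi> y) \<partial>lborel) + norm (g x) powr p * C" for x
    proof -
      have "norm (g x) * (\<integral>y. K (x - y) * norm (\<phi> y) \<partial>lborel) \<le> (1 + norm (g x) powr p) * (\<integral>y. K (x - y) * norm (\<phi> y) \<partial>lborel)"
        using p by (intro mult_right_mono le_one_plus_powr ge) auto
      also have "\<dots> \<le> (\<integral>y. K (x - y) * norm (\<phi> y) \<partial>lborel) + norm (g x) powr p * C"
        using mult_left_mono[OF le[of x], of "norm (g x) powr p"] by (simp add: algebra_simps)
      finally show ?thesis .
    qed
    then have "integrable lborel (\<lambda>x. norm (g x) * (\<integral>y. K (x - y) * norm (\<phi> y) \<partial>lborel))"
      using ge by (intro Bochner_Integration.integrable_bound[OF Bochner_Integration.integrable_add[OF i1 integrable_mult_left[OF g, of C]]])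
        (auto simp: abs_mult intro: order_trans[OF _ abs_ge_self])
    then show "integrable lborel (\<lambda>x. \<integral>y. norm (case (x, y) of (x, y) \<Rightarrow> ?h x y) \<partial>lborel)"
      unfolding split n integral_mult_right_zero .
    have "integrable lborel (\<lambda>y. norm (?h x y))" for x unfolding n by (intro integrable_mult_right i2)
    then have "integrable lborel (\<lambda>y. ?h x y)" for x by (subst (asm) integrable_norm_iff) measurable
    then show "AE x in lborel. integrable lborel (\<lambda>y. case (x, y) of (x, y) \<Rightarrow> ?h x y)" by simp
  qed measurable
  have "(\<integral>y. (\<integral>x. ?h x y \<partial>lborel) \<partial>lborel) = (\<integral>x. (\<integral>y. ?h x y \<partial>lborel) \<partial>lborel)"
    by (rule lborel_pair.Fubini_integral[OF intp])
  moreover have "(\<integral>x. ?h x y \<partial>lborel) = (\<integral>x. of_real (K (x - y)) * g x \<partial>lborel) * \<phi> y" for y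
    by (simp add: mult_ac flip: integral_mult_left_zero)
  ultimately show ?thesis by simp
qed

end

lemma prob_kernel_bessel: "a > 0 \<Longrightarrow> prob_kernel (bessel_kernel a :: real^'n::finite \<Rightarrow> real)"
  by (simp add: prob_kernel_def bessel_kernel_integral bessel_kernel_nonneg)

lemma prob_kernel_heat: "t > 0 \<Longrightarrow> prob_kernel (heat t :: real^'n::finite \<Rightarrow> real)"
  by (simp add: prob_kernel_def heat_integral heat_integrable heat_nonneg)

section \<open>Embeddings of the Bessel potential spaces\<close>

text \<open>Each operation on a distribution acts on the test function in reverse order, so the
  composite is \<open>bessel s\<close> in the form of \<open>bessel_alt\<close>. Membership means
  that u composed with \<open>bessel s\<close> has a density in Lp.\<close>

lemma bessel_space_iff:
  "u \<in> bessel_space s p \<longleftrightarrow> tempered u \<and> (\<exists>g. g \<in> borel_measurable lborel \<and>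
     integrable lborel (\<lambda>x. norm (g x) powr p) \<and> (\<forall>\<phi>\<in>schwartz. u (bessel s \<phi>) = (\<integral>x. g x * \<phi> x \<partial>lborel)))"
  by (simp add: bessel_space_def Lp_distr_def dist_ifourier_def dist_mult_def dist_fourier_def bessel_alt)

text \<open>Order s' is order s after the smoothing order s' - s < 0. The latter is a convolution,
  and transposing it onto the density \<open>g\<close> keeps Lp.\<close>

lemma bessel_space_mono:
  fixes u :: "'n::finite distr"
  assumes u: "u \<in> bessel_space s p" and s: "s' < s" and p: "p > 1"
  shows "u \<in> bessel_space s' p"
proof -
  obtain g where t: "tempered u" and [measurable]: "g \<in> borel_measurable borel"
     and g: "integrable lborel (\<lambda>x. norm (g x) powr p)" "\<And>\<phi>. \<phi> \<in> schwartz \<Longrightarrow> u (bessel s \<phi>) = (\<integral>x. g x * \<phi> x \<partial>lborel)"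
    using u unfolding bessel_space_iff by auto
  define a where "a = s - s'"
  have a: "a > 0" using s by (simp add: a_def)
  interpret prob_kernel "bessel_kernel a :: real^'n \<Rightarrow> real" by (rule prob_kernel_bessel[OF a])
  let ?f = "\<lambda>y. \<integral>x. of_real (bessel_kernel a (x - y)) * g x \<partial>lborel"
  have "u (bessel s' \<phi>) = (\<integral>x. ?f x * \<phi> x \<partial>lborel)" if "\<phi> \<in> schwartz" for \<phi>
  proof -
    have "bessel s' \<phi> = bessel s (bessel (- a) \<phi>)" using that by (simp add: bessel_bessel a_def)
    then have "u (bessel s' \<phi>) = (\<integral>x. g x * bessel (- a) \<phi> x \<partial>lborel)"
      using g(2)[OF schwartz_bessel[OF that]] by simp
    also have "\<dots> = (\<integral>x. ?f x * \<phi> x \<partial>lborel)"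
      unfolding bessel_neg_kernel[OF that a] using g p that by (intro conv_swap) auto
    finally show ?thesis .
  qed
  moreover have "integrable lborel (\<lambda>x. norm (?f x) powr p)" using g p by (intro conv_Lp) auto
  moreover have "?f \<in> borel_measurable lborel" by measurable
  ultimately show ?thesis unfolding bessel_space_iff using t by blast
qed

text \<open>Jensen for the heat kernel, then the supremum of the kernel, of order t powr (- n / 2).
  The resulting rate t powr (- n / (2 p)) is the origin of the threshold n / p.\<close>

lemma heat_Lp_bound:
  fixes g :: "'n::finite test"
  assumes [measurable]: "g \<in> borel_measurable borel" and g: "integrable lborel (\<lambda>x. norm (g x) powr p)" and p: "p > 1" and t: "t > 0"
  shows "integrable lborel (\<lambda>x. heat t (y - x) * norm (g x))"
    and "(\<integral>x. heat t (y - x) * norm (g x) \<partial>lborel) \<le>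
      ((4 * pi * t) powr (- real CARD('n) / 2) * (\<integral>x. norm (g x) powr p \<partial>lborel)) powr (1 / p)"
proof -
  interpret prob_kernel "heat t :: real^'n \<Rightarrow> real" by (rule prob_kernel_heat[OF t])
  have i: "integrable lborel (\<lambda>x. heat t (y - x) * norm (g x) powr p)"
    by (rule Bochner_Integration.integrable_bound[OF integrable_mult_right[OF g, of "(4 * pi * t) powr (- real CARD('n) / 2)"]])
       (use mult_right_mono[OF heat_le[OF t, where 'n = 'n]] in \<open>auto simp: abs_mult heat_nonneg\<close>)
  note J = Jensen_powr[OF K_shift(3,4) K0 _ _ i p]
  show "integrable lborel (\<lambda>x. heat t (y - x) * norm (g x))" by (rule J(1)) auto
  let ?m = "\<integral>x. heat t (y - x) * norm (g x) \<partial>lborel"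
  have m0: "?m \<ge> 0" by (intro Bochner_Integration.integral_nonneg) (simp add: heat_nonneg)
  have "?m powr p \<le> (\<integral>x. heat t (y - x) * norm (g x) powr p \<partial>lborel)" by (rule J(2)) auto
  also have "\<dots> \<le> (\<integral>x. (4 * pi * t) powr (- real CARD('n) / 2) * norm (g x) powr p \<partial>lborel)"
    by (intro integral_mono i integrable_mult_right g mult_right_mono heat_le t) auto
  also have "\<dots> = (4 * pi * t) powr (- real CARD('n) / 2) * (\<integral>x. norm (g x) powr p \<partial>lborel)" by simp
  finally have "(?m powr p) powr (1 / p) \<le> ((4 * pi * t) powr (- real CARD('n) / 2) * (\<integral>x. norm (g x) powr p \<partial>lborel)) powr (1 / p)"
    using p by (intro powr_mono2) auto
  then show "?m \<le> ((4 * pi * t) powr (- real CARD('n) / 2) * (\<integral>x. norm (g x) powr p \<partial>lborel)) powr (1 / p)"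
    using m0 p by (simp add: powr_powr)
qed

text \<open>A displacement of the centre by at most 1 is absorbed by doubling the time. This
  provides one majorant for all nearby centres.\<close>

lemma heat_nearby_le:
  fixes y y' x :: "real^'n::finite"
  assumes t: "t > 0" and d: "norm (y' - y) \<le> 1"
  shows "heat t (y' - x) \<le> exp (1 / (4 * t)) * 2 powr (real CARD('n) / 2) * heat (2 * t) (y - x)"
proof -
  have "(norm (y - x))\<^sup>2 \<le> 2 * (norm (y' - x))\<^sup>2 + 2"
  proof -
    have "norm (y - x) \<le> norm (y' - x) + 1"
      using norm_triangle_ineq4[of "y' - x" "y' - y"] d by simp
    then have "(norm (y - x))\<^sup>2 \<le> (norm (y' - x) + 1)\<^sup>2" by (intro power_mono) auto
    also have "\<dots> \<le> 2 * (norm (y' - x))\<^sup>2 + 2"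
      using zero_le_power2[of "norm (y' - x) - 1"] by (simp add: power2_eq_square algebra_simps)
    finally show ?thesis .
  qed
  then have "- ((norm (y' - x))\<^sup>2 / (4 * t)) \<le> 1 / (4 * t) + - ((norm (y - x))\<^sup>2 / (4 * (2 * t)))"
    using t by (simp add: field_simps)
  then have "exp (- ((norm (y' - x))\<^sup>2 / (4 * t))) \<le> exp (1 / (4 * t)) * exp (- ((norm (y - x))\<^sup>2 / (4 * (2 * t))))"
    unfolding mult_exp_exp by simp
  then have "heat t (y' - x) \<le> (4 * pi * t) powr (- real CARD('n) / 2) * (exp (1 / (4 * t)) * exp (- ((norm (y - x))\<^sup>2 / (4 * (2 * t)))))"
    unfolding heat_def by (intro mult_left_mono) auto
  also have "(4 * pi * t) powr (- real CARD('n) / 2) = 2 powr (real CARD('n) / 2) * (4 * pi * (2 * t)) powr (- real CARD('n) / 2)"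
  proof -
    have "4 * pi * (2 * t) = 2 * (4 * pi * t)" by simp
    then have "(4 * pi * (2 * t)) powr (- real CARD('n) / 2) = 2 powr (- real CARD('n) / 2) * (4 * pi * t) powr (- real CARD('n) / 2)"
      using t by (simp only: powr_mult)
    moreover have "2 powr (real CARD('n) / 2) * 2 powr (- real CARD('n) / 2) = (1::real)" by (simp add: powr_add[symmetric])
    ultimately show ?thesis by simp
  qed
  finally show ?thesis unfolding heat_def by (simp only: mult_ac)
qed

lemma heat_op_tendsto:
  fixes g :: "'n::finite test"
  assumes [measurable]: "g \<in> borel_measurable borel" and g: "integrable lborel (\<lambda>x. norm (g x) powr p)" and p: "p > 1" and t: "t > 0"
    and Y: "Y \<longlonglongrightarrow> y" and Y1: "\<And>k. norm (Y k - y) \<le> 1"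
  shows "(\<lambda>k. heat_op t g (Y k)) \<longlonglongrightarrow> heat_op t g y"
  unfolding heat_op_def
proof (rule integral_dominated_convergence)
  let ?c = "exp (1 / (4 * t)) * 2 powr (real CARD('n) / 2)"
  show "integrable lborel (\<lambda>x. ?c * (heat (2 * t) (y - x) * norm (g x)))"
    using t by (intro integrable_mult_right heat_Lp_bound(1)[OF _ g p]) auto
  show "AE x in lborel. norm (of_real (heat t (Y k - x)) * g x) \<le> ?c * (heat (2 * t) (y - x) * norm (g x))" for k
    using mult_right_mono[OF heat_nearby_le[OF t Y1[of k]] norm_ge_zero]
    by (intro AE_I2) (simp add: norm_mult heat_nonneg mult.assoc)
  show "AE x in lborel. (\<lambda>k. of_real (heat t (Y k - x)) * g x) \<longlonglongrightarrow> of_real (heat t (y - x)) * g x"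
    unfolding heat_def by (intro AE_I2 tendsto_intros Y) (use t in auto)
qed measurable

text \<open>The potential is a mean over t of functions \<open>heat_op t g\<close>, each continuous
  and bounded by \<open>B t\<close> uniformly in space. The Gamma density integrates
  \<open>B\<close> exactly because a / 2 > n / (2 p), so dominated convergence in t applies.\<close>

lemma bessel_potential_continuous:
  fixes g :: "'n::finite test"
  assumes [measurable]: "g \<in> borel_measurable borel" and g: "integrable lborel (\<lambda>x. norm (g x) powr p)" and p: "p > 1"
    and a: "a > real CARD('n) / p"
  shows "continuous_on UNIV (\<lambda>y. \<integral>x. of_real (bessel_kernel a (y - x)) * g x \<partial>lborel)"
proof -
  have a0: "a > 0" using a p by (smt (verit) divide_nonneg_nonneg of_nat_0_le_iff)
  define I where "I = (\<integral>x. norm (g x) powr p \<partial>lborel)"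
  have I0: "I \<ge> 0" unfolding I_def by (intro Bochner_Integration.integral_nonneg) auto
  define B where "B t = ((4 * pi * t) powr (- real CARD('n) / 2) * I) powr (1 / p)" for t
  define b where "b = real CARD('n) / (2 * p)"
  have b: "a / 2 - b > 0" using a p by (simp add: b_def field_simps)
  have B_eq: "gamma_density a t * B t = ((4 * pi) powr (- b) * I powr (1 / p)) * (gamma_density a t * t powr (- b))" for t
  proof (cases "t > 0")
    case True
    have "B t = ((4 * pi * t) powr (- real CARD('n) / 2)) powr (1 / p) * I powr (1 / p)"
      unfolding B_def using I0 by (simp add: powr_mult)
    also have "((4 * pi * t) powr (- real CARD('n) / 2)) powr (1 / p) = (4 * pi * t) powr (- b)"
      unfolding powr_powr b_def by simp
    also have "\<dots> = (4 * pi) powr (- b) * t powr (- b)" using True by (simp add: powr_mult)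
    finally show ?thesis by (simp add: mult_ac)
  qed (simp add: gamma_density_eq_0)
  have Bint: "integrable lborel (\<lambda>t. gamma_density a t * B t)"
    unfolding B_eq
  proof (intro integrable_mult_right integrableI_nonneg)
    show "AE t in lborel. 0 \<le> gamma_density a t * t powr (- b)" using gamma_density_nonneg[OF a0] by auto
    show "(\<integral>\<^sup>+t. ennreal (gamma_density a t * t powr (- b)) \<partial>lborel) < \<infinity>" by (rule nn_integral_gamma_density_powr[OF a0 b])
  qed measurable
  have B0: "B t \<ge> 0" for t by (simp add: B_def)
  note hb = heat_Lp_bound[OF assms(1) g p, folded I_def, folded B_def]
  have eq: "(\<integral>x. of_real (bessel_kernel a (y - x)) * g x \<partial>lborel) = (\<integral>t. of_real (gamma_density a t) * heat_op t g y \<partial>lborel)" for y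
    by (rule Fubini_gamma_heat(1)[OF a0 _ hb B0 Bint, symmetric]) auto
  have hop: "norm (heat_op t g y) \<le> B t" if t: "t > 0" for t y
    using hb(2)[OF t, of y] unfolding heat_op_def
    by (intro order_trans[OF integral_norm_bound]) (simp add: norm_mult heat_nonneg)
  have [measurable]: "(\<lambda>t. heat_op t g y) \<in> borel_measurable borel" for y
    unfolding heat_op_def by measurable
  show ?thesis unfolding eq continuous_on_sequentially
  proof (intro ballI allI impI, elim conjE)
    fix y and Z :: "nat \<Rightarrow> real^'n" assume "Z \<longlonglongrightarrow> y"
    \<comment> \<open>Initial terms are dropped because the majorant for the heat averages requires
      centres within distance 1 of y.\<close>
    then obtain N where N: "\<And>k. k \<ge> N \<Longrightarrow> norm (Z k - y) < 1" using LIMSEQ_iff[THEN iffD1] zero_less_one by blast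
    define Y where "Y k = Z (k + N)" for k
    have Y: "Y \<longlonglongrightarrow> y" unfolding Y_def using \<open>Z \<longlonglongrightarrow> y\<close> by (rule LIMSEQ_ignore_initial_segment)
    have Y1: "norm (Y k - y) \<le> 1" for k using N[of "k + N"] by (simp add: Y_def)
    have "(\<lambda>k. \<integral>t. of_real (gamma_density a t) * heat_op t g (Y k) \<partial>lborel) \<longlonglongrightarrow> (\<integral>t. of_real (gamma_density a t) * heat_op t g y \<partial>lborel)"
    proof (rule integral_dominated_convergence[OF _ _ Bint])
      show "AE t in lborel. (\<lambda>k. of_real (gamma_density a t) * heat_op t g (Y k)) \<longlonglongrightarrow> of_real (gamma_density a t) * heat_op t g y"
      proof (intro AE_I2)
        fix t show "(\<lambda>k. of_real (gamma_density a t) * heat_op t g (Y k)) \<longlonglongrightarrow> of_real (gamma_density a t) * heat_op t g y"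
        proof (cases "t > 0")
          case True
          show ?thesis by (intro tendsto_mult tendsto_const heat_op_tendsto[OF assms(1) g p True Y Y1])
        qed (simp add: gamma_density_eq_0)
      qed
      show "AE t in lborel. norm (of_real (gamma_density a t) * heat_op t g (Y k)) \<le> gamma_density a t * B t" for k
      proof (intro AE_I2)
        fix t show "norm (of_real (gamma_density a t) * heat_op t g (Y k)) \<le> gamma_density a t * B t"
          using hop[of t "Y k"] gamma_density_nonneg[OF a0, of t]
          by (cases "t > 0") (auto simp: norm_mult gamma_density_eq_0 mult_left_mono)
      qed
    qed measurable
    then show "((\<lambda>y. \<integral>t. of_real (gamma_density a t) * heat_op t g y \<partial>lborel) \<circ> Z) \<longlonglongrightarrow> (\<integral>t. of_real (gamma_density a t) * heat_op t g y \<partial>lborel)"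
      unfolding Y_def comp_def by (rule LIMSEQ_offset)
  qed
qed

lemma bessel_kernel_minus_commute: "bessel_kernel a (x - y) = bessel_kernel a (y - x)"
  unfolding bessel_kernel_def by (simp only: heat_minus_commute)

text \<open>The Sobolev embedding: writing the test function as \<open>bessel s\<close> of
  \<open>bessel (- s) \<phi>\<close> shows that u is the Bessel potential of its Lp density. The
  kernel is even, so the transposed convolution is the potential itself.\<close>

lemma bessel_space_continuous_rep:
  fixes u :: "'n::finite distr"
  assumes u: "u \<in> bessel_space s p" and p: "p > 1" and s: "s > real CARD('n) / p"
  obtains f where "continuous_on UNIV f" "\<And>\<phi>. \<phi> \<in> schwartz \<Longrightarrow> u \<phi> = (\<integral>x. f x * \<phi> x \<partial>lborel)"
proof -
  obtain g where [measurable]: "g \<in> borel_measurable borel"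
     and g: "integrable lborel (\<lambda>x. norm (g x) powr p)" "\<And>\<phi>. \<phi> \<in> schwartz \<Longrightarrow> u (bessel s \<phi>) = (\<integral>x. g x * \<phi> x \<partial>lborel)"
    using u unfolding bessel_space_iff by auto
  have s0: "s > 0" using s p by (smt (verit) divide_nonneg_nonneg of_nat_0_le_iff)
  interpret prob_kernel "bessel_kernel s :: real^'n \<Rightarrow> real" by (rule prob_kernel_bessel[OF s0])
  let ?f = "\<lambda>y. \<integral>x. of_real (bessel_kernel s (y - x)) * g x \<partial>lborel"
  have "u \<phi> = (\<integral>x. ?f x * \<phi> x \<partial>lborel)" if "\<phi> \<in> schwartz" for \<phi>
  proof -
    have "u \<phi> = (\<integral>x. g x * bessel (- s) \<phi> x \<partial>lborel)"
      using g(2)[OF schwartz_bessel[OF that, of "- s"]] bessel_minus_cancel[OF that] by simp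
    also have "\<dots> = (\<integral>y. (\<integral>x. of_real (bessel_kernel s (x - y)) * g x \<partial>lborel) * \<phi> y \<partial>lborel)"
      unfolding bessel_neg_kernel[OF that s0] using g p that by (intro conv_swap) auto
    finally show ?thesis by (simp only: bessel_kernel_minus_commute)
  qed
  moreover have "continuous_on UNIV ?f" using g p s by (intro bessel_potential_continuous) auto
  ultimately show ?thesis using that by blast
qed

section \<open>Bump functions\<close>

text \<open>The classical function exp (- 1/t), extended by 0. The polynomial in 1/t closes the
  family under differentiation: with y = 1/t, the factor q becomes y^2 * (q - q').\<close>

definition flat_exp :: "real poly \<Rightarrow> real \<Rightarrow> real" where
  "flat_exp q t = (if t > 0 then poly q (inverse t) * exp (- inverse t) else 0)"

lemma poly_exp_tendsto_0: "((\<lambda>y::real. y ^ k * poly q y * exp (- y)) \<longlongrightarrow> 0) at_top"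
proof (induction q arbitrary: k)
  case (pCons a q)
  have "((\<lambda>y::real. a * (y ^ k / exp y) + y ^ Suc k * poly q y * exp (- y)) \<longlongrightarrow> a * 0 + 0) at_top"
    by (intro tendsto_intros tendsto_power_div_exp_0 pCons)
  then show ?case by (simp add: exp_minus field_simps)
qed simp

lemma flat_quotient_tendsto: "((\<lambda>t. flat_exp q t / t) \<longlongrightarrow> 0) (at 0)"
proof (rule filterlim_split_at)
  have "((\<lambda>t::real. inverse t ^ 1 * poly q (inverse t) * exp (- inverse t)) \<longlongrightarrow> 0) (at_right 0)"
    by (rule filterlim_compose[OF poly_exp_tendsto_0 filterlim_inverse_at_top_right])
  then show "((\<lambda>t. flat_exp q t / t) \<longlongrightarrow> 0) (at_right 0)"
    by (rule Lim_transform_eventually)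
       (auto simp: eventually_at_right_less flat_exp_def field_simps intro: eventually_mono[OF eventually_at_right_less])
  show "((\<lambda>t. flat_exp q t / t) \<longlongrightarrow> 0) (at_left 0)"
    by (rule Lim_transform_eventually[OF tendsto_const])
       (auto simp: eventually_at_filter flat_exp_def)
qed

lemma flat_has_derivative:
  "(flat_exp q has_real_derivative flat_exp ([:0, 0, 1:] * (q - pderiv q)) t) (at t)"
proof -
  consider "t > 0" | "t = 0" | "t < 0" by linarith
  then show ?thesis
  proof cases
    case 1
    have "((\<lambda>t. poly q (inverse t) * exp (- inverse t)) has_real_derivative flat_exp ([:0, 0, 1:] * (q - pderiv q)) t) (at t)"
      using 1 by (auto intro!: derivative_eq_intros simp: flat_exp_def power2_eq_square algebra_simps)
    then show ?thesis
      by (rule DERIV_cong_ev[THEN iffD1, rotated -1, of _ _ _ t])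
         (use 1 in \<open>auto simp: flat_exp_def intro!: eventually_mono[OF eventually_nhds_in_open[of "{0<..}"]]\<close>)
  next
    case 2
    have "flat_exp q 0 = 0" "flat_exp ([:0, 0, 1:] * (q - pderiv q)) 0 = 0" by (auto simp: flat_exp_def)
    then show ?thesis using 2 flat_quotient_tendsto[of q] by (simp add: DERIV_def)
  next
    case 3
    have "((\<lambda>t. 0) has_real_derivative flat_exp ([:0, 0, 1:] * (q - pderiv q)) t) (at t)"
      using 3 by (simp add: flat_exp_def)
    then show ?thesis
      by (rule DERIV_cong_ev[THEN iffD1, rotated -1, of _ _ _ t])
         (use 3 in \<open>auto simp: flat_exp_def intro!: eventually_mono[OF eventually_nhds_in_open[of "{..<0}"]]\<close>)
  qed
qed

text \<open>The class for the coinductive smoothness proof. Sums and products are built in because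
  the chain rule multiplies a flat function by coordinates and the product rule adds terms.\<close>

inductive flat_gen :: "real \<Rightarrow> real \<Rightarrow> 'n::finite test \<Rightarrow> bool" for c s where
  flat_gen_smooth: "smooth_fun f \<Longrightarrow> flat_gen c s f"
| flat_gen_flat: "flat_gen c s (\<lambda>x. of_real (flat_exp q (c + s * (x \<bullet> x))))"
| flat_gen_add: "flat_gen c s f \<Longrightarrow> flat_gen c s g \<Longrightarrow> flat_gen c s (\<lambda>x. f x + g x)"
| flat_gen_mult: "flat_gen c s f \<Longrightarrow> flat_gen c s g \<Longrightarrow> flat_gen c s (\<lambda>x. f x * g x)"

lemma flat_gen_step:
  "flat_gen c s f \<Longrightarrow> (\<forall>x. f differentiable (at x)) \<and> (\<forall>i. flat_gen c s (pdiff [i] f))"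
proof (induction rule: flat_gen.induct)
  case (flat_gen_smooth f)
  then show ?case by (auto intro: smooth_fun_differentiable flat_gen.flat_gen_smooth smooth_fun_pdiff)
next
  case (flat_gen_flat q)
  let ?q = "[:0, 0, 1:] * (q - pderiv q)"
  have 1: "((\<lambda>x. c + s * (x \<bullet> x)) has_derivative (\<lambda>h. 2 * s * (x \<bullet> h))) (at x)" for x :: "real^'a"
    by (intro derivative_eq_intros) (auto simp: inner_commute)
  have 2: "((\<lambda>x. complex_of_real (flat_exp q (c + s * (x \<bullet> x)))) has_derivative
      (\<lambda>h. of_real (flat_exp ?q (c + s * (x \<bullet> x)) * (2 * s * (x \<bullet> h))))) (at x)" for x :: "real^'a"
    by (intro has_derivative_of_real has_derivative_compose[OF 1 flat_has_derivative[THEN has_field_derivative_imp_has_derivative]])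
  have "pdiff [i] (\<lambda>x::real^'a. complex_of_real (flat_exp q (c + s * (x \<bullet> x)))) =
     (\<lambda>x. of_real (flat_exp ?q (c + s * (x \<bullet> x))) * (of_real (2 * s) * of_real (x $ i)))" for i
    unfolding pdiff_eqI[OF 2, of i] by (simp add: inner_axis)
  moreover have "flat_gen c s (\<lambda>x::real^'a. of_real (flat_exp ?q (c + s * (x \<bullet> x))) * (of_real (2 * s) * of_real (x $ i)))" for i
    by (intro flat_gen.intros(4) flat_gen.intros(2) flat_gen.intros(1) smooth_fun_const smooth_fun_coord)
  ultimately show ?case using differentiableI[OF 2] by simp
next
  case (flat_gen_add f g)
  then have d: "(f has_derivative frechet_derivative f (at x)) (at x)" "(g has_derivative frechet_derivative g (at x)) (at x)" for x
    using frechet_derivative_works by blast+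
  have "pdiff [i] (\<lambda>x. f x + g x) = (\<lambda>x. pdiff [i] f x + pdiff [i] g x)" for i
    unfolding pdiff_eqI[OF has_derivative_add[OF d], of i] by (simp add: pdiff.simps)
  then show ?case using flat_gen_add differentiableI[OF has_derivative_add[OF d]]
    by (auto intro: flat_gen.flat_gen_add)
next
  case (flat_gen_mult f g)
  then have d: "(f has_derivative frechet_derivative f (at x)) (at x)" "(g has_derivative frechet_derivative g (at x)) (at x)" for x
    using frechet_derivative_works by blast+
  have "pdiff [i] (\<lambda>x. f x * g x) = (\<lambda>x. f x * pdiff [i] g x + pdiff [i] f x * g x)" for i
    unfolding pdiff_eqI[OF has_derivative_mult[OF d], of i] by (simp add: pdiff.simps)
  moreover have "flat_gen c s (\<lambda>x. f x * pdiff [i] g x + pdiff [i] f x * g x)" for i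
    using flat_gen_mult by (intro flat_gen.intros(3) flat_gen.intros(4)) auto
  ultimately show ?case using differentiableI[OF has_derivative_mult[OF d]] by auto
qed

lemma smooth_fun_flat: "smooth_fun (\<lambda>x::real^'n::finite. complex_of_real (flat_exp q (c + s * (x \<bullet> x))))"
  by (rule smooth_fun_coinduct[of "flat_gen c s"]) (use flat_gen_step flat_gen_flat in blast)+

text \<open>The quotients m / d ^ k with m smooth are stable under derivatives, each derivative
  raising k by one.\<close>

lemma smooth_fun_inverse:
  assumes d: "smooth_fun d" and nz: "\<And>x. d x \<noteq> 0"
  shows "smooth_fun (\<lambda>x. inverse (d x))"
proof (rule smooth_fun_coinduct[of "\<lambda>f. \<exists>m k. smooth_fun m \<and> f = (\<lambda>x. m x * inverse (d x) ^ k)"])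
  show "\<exists>m k. smooth_fun m \<and> (\<lambda>x. inverse (d x)) = (\<lambda>x. m x * inverse (d x) ^ k)"
    using smooth_fun_const[of 1] by (intro exI[of _ "\<lambda>x. 1"] exI[of _ 1]) auto
next
  fix f i assume "\<exists>m k. smooth_fun m \<and> f = (\<lambda>x. m x * inverse (d x) ^ k)"
  then obtain m k where m: "smooth_fun m" and f: "f = (\<lambda>x. m x * inverse (d x) ^ k)" by blast
  let ?d = "\<lambda>x. frechet_derivative d (at x)" and ?m = "\<lambda>x. frechet_derivative m (at x)"
  have dd: "(d has_derivative ?d x) (at x)" for x using smooth_fun_has_derivative[OF d, of "[]"] by simp
  have dm: "(m has_derivative ?m x) (at x)" for x using smooth_fun_has_derivative[OF m, of "[]"] by simp
  have df: "(f has_derivative (\<lambda>h. m x * (of_nat k * (- (inverse (d x) * ?d x h * inverse (d x))) * inverse (d x) ^ (k - 1))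
      + ?m x h * inverse (d x) ^ k)) (at x)" for x
    unfolding f by (intro has_derivative_mult dm has_derivative_power Deriv.has_derivative_inverse dd nz)
  let ?M = "\<lambda>x. pdiff [i] m x * d x + of_nat k * ((-1) * (m x * pdiff [i] d x))"
  have "pdiff [i] f = (\<lambda>x. ?M x * inverse (d x) ^ Suc k)"
  proof
    fix x
    have "pdiff [i] f x = m x * (of_nat k * (- (inverse (d x) * pdiff [i] d x * inverse (d x))) * inverse (d x) ^ (k - 1))
      + pdiff [i] m x * inverse (d x) ^ k"
      unfolding pdiff_eqI[OF df, of i] by (simp add: pdiff.simps)
    also have "\<dots> = ?M x * inverse (d x) ^ Suc k" using nz[of x]
      by (cases k) (auto simp: field_simps)
    finally show "pdiff [i] f x = ?M x * inverse (d x) ^ Suc k" .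
  qed
  moreover have "smooth_fun ?M" by (intro smooth_fun_add smooth_fun_mult smooth_fun_cmult smooth_fun_pdiff m d)
  ultimately show "\<exists>m k. smooth_fun m \<and> pdiff [i] f = (\<lambda>x. m x * inverse (d x) ^ k)" by blast
next
  fix f x assume "\<exists>m k. smooth_fun m \<and> f = (\<lambda>x. m x * inverse (d x) ^ k)"
  then obtain m k where m: "smooth_fun m" and f: "f = (\<lambda>x. m x * inverse (d x) ^ k)" by blast
  show "f differentiable at x" unfolding f
    by (intro differentiable_mult differentiable_power differentiable_inverse smooth_fun_differentiable m d nz)
qed

lemma flat_1_pos_iff: "flat_exp 1 t > 0 \<longleftrightarrow> t > 0"
  by (simp add: flat_exp_def)

lemma flat_1_nonneg: "flat_exp 1 t \<ge> 0"
  by (simp add: flat_exp_def)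

lemma flat_1_eq_0: "t \<le> 0 \<Longrightarrow> flat_exp 1 t = 0"
  by (simp add: flat_exp_def)

section \<open>Cutoffs between radius r/2 and radius r\<close>

text \<open>The two flat functions switch off at |x| = 1 and switch on at |x| = 1/2. Their supports
  overlap, so the denominator never vanishes, and the quotient is 1 on the inner ball and 0 outside
  the outer one.\<close>

definition bump_real :: "real^'n::finite \<Rightarrow> real" where
  "bump_real x = flat_exp 1 (1 - x \<bullet> x) / (flat_exp 1 (1 - x \<bullet> x) + flat_exp 1 (x \<bullet> x - 1/4))"

definition bump :: "real^'n::finite \<Rightarrow> real \<Rightarrow> 'n test" where
  "bump c r x = of_real (bump_real ((1 / r) *\<^sub>R (x - c)))"

lemma bump_denominator_pos: "flat_exp 1 (1 - x \<bullet> x) + flat_exp 1 (x \<bullet> x - 1/4) > 0"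
proof (cases "x \<bullet> x < 1")
  case True
  then have "flat_exp 1 (1 - x \<bullet> x) > 0" by (simp add: flat_1_pos_iff)
  then show ?thesis using flat_1_nonneg[of "x \<bullet> x - 1/4"] by linarith
next
  case False
  then have "flat_exp 1 (x \<bullet> x - 1/4) > 0" by (simp add: flat_1_pos_iff)
  then show ?thesis using flat_1_nonneg[of "1 - x \<bullet> x"] by linarith
qed

lemma bump_real_range: "0 \<le> bump_real x" "bump_real x \<le> 1"
  using bump_denominator_pos[of x] flat_1_nonneg[of "1 - x \<bullet> x"] flat_1_nonneg[of "x \<bullet> x - 1/4"]
  by (auto simp: bump_real_def)

lemma bump_real_eq_1: assumes "norm x \<le> 1/2" shows "bump_real x = 1"
proof -
  have "(norm x)\<^sup>2 \<le> (1/2)\<^sup>2" using assms by (intro power_mono) auto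
  then have "x \<bullet> x \<le> 1/4" unfolding power2_norm_eq_inner by (simp add: power2_eq_square)
  then show ?thesis using bump_denominator_pos[of x] by (simp add: bump_real_def flat_1_eq_0)
qed

lemma bump_real_eq_0: assumes "norm x \<ge> 1" shows "bump_real x = 0"
proof -
  have "1\<^sup>2 \<le> (norm x)\<^sup>2" using assms by (intro power_mono) auto
  then show ?thesis by (simp add: bump_real_def flat_1_eq_0 power2_norm_eq_inner)
qed

lemma smooth_fun_bump_real: "smooth_fun (\<lambda>x. complex_of_real (bump_real x))"
proof -
  have eq: "1 + (-1) * (x \<bullet> x) = 1 - x \<bullet> x" "-1/4 + 1 * (x \<bullet> x) = x \<bullet> x - 1/4" for x :: "real^'a" by auto
  have "smooth_fun (\<lambda>x::real^'a. of_real (flat_exp 1 (1 + (-1) * (x \<bullet> x))) *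
      inverse (complex_of_real (flat_exp 1 (1 + (-1) * (x \<bullet> x))) + of_real (flat_exp 1 (-1/4 + 1 * (x \<bullet> x)))))"
  proof (intro smooth_fun_mult smooth_fun_inverse smooth_fun_add smooth_fun_flat)
    fix x :: "real^'a"
    show "complex_of_real (flat_exp 1 (1 + (-1) * (x \<bullet> x))) + of_real (flat_exp 1 (-1/4 + 1 * (x \<bullet> x))) \<noteq> 0"
      unfolding eq of_real_add[symmetric] of_real_eq_0_iff using bump_denominator_pos[of x] by (metis less_irrefl)
  qed
  moreover have "complex_of_real (bump_real x) = of_real (flat_exp 1 (1 - x \<bullet> x)) *
      inverse (complex_of_real (flat_exp 1 (1 - x \<bullet> x)) + of_real (flat_exp 1 (x \<bullet> x - 1/4)))" for x :: "real^'a"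
    unfolding bump_real_def of_real_divide of_real_add by (rule divide_inverse)
  ultimately show ?thesis by (simp only: eq)
qed

lemma smooth_fun_bump: "smooth_fun (bump c r)"
  unfolding bump_def[abs_def] by (rule smooth_fun_affine[OF smooth_fun_bump_real])

lemma bump_eq_1: "r > 0 \<Longrightarrow> norm (x - c) \<le> r / 2 \<Longrightarrow> bump c r x = 1"
  unfolding bump_def by (subst bump_real_eq_1) (simp_all only: norm_scaleR, simp_all add: field_simps)

lemma bump_eq_0: "r > 0 \<Longrightarrow> norm (x - c) \<ge> r \<Longrightarrow> bump c r x = 0"
  unfolding bump_def by (subst bump_real_eq_0) (simp_all only: norm_scaleR, simp_all add: field_simps)

lemma pdiff_eq_0_open:
  assumes U: "open U" and f: "\<And>x. x \<in> U \<Longrightarrow> f x = 0" and x: "x \<in> U"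
  shows "pdiff is f x = 0"
  using x
proof (induction "is" arbitrary: x)
  case (Cons i "is")
  have "(pdiff is f has_derivative (\<lambda>h. 0)) (at x)"
    by (rule has_derivative_transform_within_open[OF has_derivative_const U Cons.prems]) (simp add: Cons.IH)
  from fun_cong[OF frechet_derivative_at[OF this], of "axis i 1"] show ?case by (simp add: pdiff.simps)
qed (use f in simp)

lemma schwartz_compact_support:
  assumes f: "smooth_fun f" and R: "\<And>x. norm x > R \<Longrightarrow> f x = 0"
  shows "f \<in> schwartz"
  unfolding schwartz_iff
proof (intro conjI f allI)
  fix "is" k
  let ?g = "\<lambda>x. (1 + norm x) ^ k * norm (pdiff is f x)"
  have z: "pdiff is f x = 0" if "norm x > R" for x
    by (rule pdiff_eq_0_open[of "{x. norm x > R}"]) (use R that in \<open>auto intro!: open_Collect_less continuous_intros\<close>)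
  have "compact (?g ` cball 0 \<bar>R\<bar>)"
    by (intro compact_continuous_image continuous_intros smooth_fun_continuous_on f) auto
  from compact_imp_bounded[OF this] have "\<exists>B. \<forall>y\<in>?g ` cball 0 \<bar>R\<bar>. norm y \<le> B"
    by (simp only: bounded_iff)
  then obtain B where B': "\<forall>y\<in>?g ` cball 0 \<bar>R\<bar>. norm y \<le> B" ..
  have B: "norm (?g x) \<le> B" if "x \<in> cball 0 \<bar>R\<bar>" for x by (rule bspec[OF B' imageI[OF that]])
  have "?g x \<le> max B 0" for x
  proof (cases "norm x > R")
    case True
    then show ?thesis by (simp add: z)
  next
    case False
    then have "norm x \<le> \<bar>R\<bar>" by linarith
    then show ?thesis using B[of x] by auto
  qed
  then show "\<exists>C. \<forall>x. ?g x \<le> C" by blast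
qed

lemma test_fun_schwartz: "f \<in> test_fun \<Longrightarrow> f \<in> schwartz"
proof -
  assume "f \<in> test_fun"
  then have s: "smooth_fun f" and c: "compact (closure {x. f x \<noteq> 0})" by (auto simp: test_fun_def)
  obtain R where R: "\<And>x. x \<in> closure {x. f x \<noteq> 0} \<Longrightarrow> norm x \<le> R"
    using compact_imp_bounded[OF c] unfolding bounded_iff by blast
  show ?thesis
    by (rule schwartz_compact_support[OF s, of R]) (use R closure_subset[of "{x. f x \<noteq> 0}"] in force)
qed

lemma bump_support: assumes "r > 0" shows "closure {x. bump c r x \<noteq> 0} \<subseteq> cball c r"
proof (rule closure_minimal)
  show "{x. bump c r x \<noteq> 0} \<subseteq> cball c r"
    using bump_eq_0[OF assms, of _ c] by (force simp: dist_norm norm_minus_commute)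
qed simp

lemma bump_test_fun: assumes "r > 0" shows "bump c r \<in> test_fun"
  using bump_support[OF assms, of c] smooth_fun_bump
  by (auto simp: test_fun_def compact_eq_bounded_closed intro: bounded_subset[OF bounded_cball])

lemma bump_schwartz: "r > 0 \<Longrightarrow> bump c r \<in> schwartz"
  by (intro test_fun_schwartz bump_test_fun)

section \<open>Nullity above the critical order\<close>

text \<open>The fundamental lemma of the calculus of variations, tested with a bump in a ball where
  one real component of f stays positive.\<close>

lemma continuous_eq_0_if_test_integrals_0:
  fixes f :: "'n::finite test"
  assumes f: "continuous_on UNIV f" and U: "open U" "x \<in> U"
    and z: "\<And>\<phi>. \<phi> \<in> test_fun \<Longrightarrow> closure {y. \<phi> y \<noteq> 0} \<subseteq> U \<Longrightarrow> (\<integral>y. f y * \<phi> y \<partial>lborel) = 0"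
  shows "f x = 0"
proof (rule ccontr)
  assume nz: "f x \<noteq> 0"
  define G where "G y = Re (cnj (f x) * f y)" for y
  have Gc: "continuous_on UNIV G" unfolding G_def by (intro continuous_intros f)
  have "G x = (cmod (f x))\<^sup>2" unfolding cmod_power2 by (simp add: G_def power2_eq_square)
  then have Gx: "G x > 0" using nz by simp
  define V where "V = U \<inter> {y. G y > G x / 2}"
  have "open V" unfolding V_def using U(1) Gc by (intro open_Int open_Collect_less continuous_intros) auto
  moreover have "x \<in> V" using U(2) Gx by (simp add: V_def)
  ultimately obtain r where r: "r > 0" "cball x r \<subseteq> V" using open_contains_cball by blast
  let ?\<phi> = "bump x r"
  have "(\<integral>y. f y * ?\<phi> y \<partial>lborel) = 0"
    by (rule z[OF bump_test_fun[OF r(1)]]) (use bump_support[OF r(1), of x] r(2) in \<open>auto simp: V_def\<close>)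
  moreover have [measurable]: "f \<in> borel_measurable borel" using f by (rule borel_measurable_continuous_onI)
  moreover have [measurable]: "bump x r \<in> borel_measurable borel" by (intro schwartz_measurable bump_schwartz r)
  have br: "bump x r y = of_real (bump_real ((1 / r) *\<^sub>R (y - x)))" for y by (simp add: bump_def)
  obtain B where B: "\<And>y. y \<in> cball x r \<Longrightarrow> norm (f y) \<le> B"
    using compact_imp_bounded[OF compact_continuous_image[OF continuous_on_subset[OF f] compact_cball[of x r]]]
    unfolding bounded_iff by blast
  have int: "integrable lborel (\<lambda>y. f y * ?\<phi> y)"
  proof (rule Bochner_Integration.integrable_bound[OF integrable_mult_right[OF integrable_norm[OF schwartz_integrable[OF bump_schwartz[OF r(1)]]], of B x]])
    show "AE y in lborel. norm (f y * bump x r y) \<le> norm (B * norm (bump x r y))"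
    proof (intro AE_I2)
      fix y show "norm (f y * bump x r y) \<le> norm (B * norm (bump x r y))"
      proof (cases "y \<in> cball x r")
        case True
        then show ?thesis using B[OF True] by (auto simp: norm_mult abs_mult intro!: mult_right_mono)
      next
        case False
        then show ?thesis using bump_eq_0[OF r(1), of y x] by (auto simp: dist_norm norm_minus_commute)
      qed
    qed
  qed measurable
  ultimately have "0 = Re (cnj (f x) * (\<integral>y. f y * ?\<phi> y \<partial>lborel))" by simp
  also have "\<dots> = (\<integral>y. Re (cnj (f x) * (f y * ?\<phi> y)) \<partial>lborel)"
    using integral_Re[OF integrable_mult_right[OF int, of "cnj (f x)"]] by simp
  finally have "(\<integral>y. Re (cnj (f x) * (f y * ?\<phi> y)) \<partial>lborel) = 0" by simp
  moreover have "(\<integral>y. Re (cnj (f x) * (f y * ?\<phi> y)) \<partial>lborel) \<ge> (\<integral>y. (G x / 2) * indicator (ball x (r / 2)) y \<partial>lborel)"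
  proof (rule integral_mono)
    show "integrable lborel (\<lambda>y. (G x / 2) * indicator (ball x (r / 2)) y :: real)"
      by (intro integrable_mult_right integrable_real_indicator emeasure_bounded_finite bounded_ball) auto
    show "integrable lborel (\<lambda>y. Re (cnj (f x) * (f y * ?\<phi> y)))" using int by (intro integrable_Re integrable_mult_right)
    fix y
    have e: "Re (cnj (f x) * (f y * ?\<phi> y)) = G y * bump_real ((1 / r) *\<^sub>R (y - x))"
      unfolding br G_def by (simp add: algebra_simps)
    show "(G x / 2) * indicator (ball x (r / 2)) y \<le> Re (cnj (f x) * (f y * ?\<phi> y))"
    proof (cases "y \<in> ball x (r / 2)")
      case True
      then have "bump x r y = 1" using r by (intro bump_eq_1) (auto simp: dist_norm norm_minus_commute)
      then have "bump_real ((1 / r) *\<^sub>R (y - x)) = 1" unfolding br by simp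
      moreover have "G y > G x / 2" using True r by (auto simp: V_def dist_norm subset_eq)
      ultimately show ?thesis unfolding e using True by simp
    next
      case False
      have "0 \<le> G y * bump_real ((1 / r) *\<^sub>R (y - x))"
      proof (cases "y \<in> cball x r")
        case True
        then have "G y > G x / 2" using r by (auto simp: V_def)
        then show ?thesis using Gx bump_real_range(1) by (intro mult_nonneg_nonneg) auto
      next
        case False
        then have "bump x r y = 0" using r by (intro bump_eq_0) (auto simp: dist_norm norm_minus_commute)
        then show ?thesis unfolding br by simp
      qed
      then show ?thesis unfolding e using False by simp
    qed
  qed
  ultimately have "(G x / 2) * measure lborel (ball x (r / 2)) \<le> 0" by simp
  moreover have "measure lborel (ball x (r / 2)) > 0" using r by (simp add: content_ball_pos)
  ultimately show False using Gx by (simp add: mult_le_0_iff)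
qed

theorem null_set_supercritical:
  fixes A Q :: "(real^'n::finite) set"
  assumes Q: "interior A \<subseteq> closure Q" and p: "p > 1" and s: "s > real CARD('n) / p"
  shows "null_set s p (A - Q)"
  unfolding null_set_def
proof (intro ballI impI)
  fix u :: "'n distr" assume u: "u \<in> bessel_space s p" and supp: "dist_support u \<subseteq> A - Q"
  obtain f where f: "continuous_on UNIV f" and rep: "\<And>\<phi>. \<phi> \<in> schwartz \<Longrightarrow> u \<phi> = (\<integral>x. f x * \<phi> x \<partial>lborel)"
    using bessel_space_continuous_rep[OF u p s] by metis
  have "x \<in> dist_support u" if "f x \<noteq> 0" for x
  proof (rule ccontr)
    assume "x \<notin> dist_support u"
    then obtain U where U: "open U" "x \<in> U" and 0: "\<And>\<phi>. \<phi> \<in> test_fun \<Longrightarrow> closure {y. \<phi> y \<noteq> 0} \<subseteq> U \<Longrightarrow> u \<phi> = 0"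
      unfolding dist_support_def by blast
    have "f x = 0" by (rule continuous_eq_0_if_test_integrals_0[OF f U]) (use 0 rep test_fun_schwartz in metis)
    with that show False by simp
  qed
  then have sub: "{x. f x \<noteq> 0} \<subseteq> A - Q" using supp by blast
  have op: "open {x. f x \<noteq> 0}" using f by (intro open_Collect_neq continuous_intros)
  have "{x. f x \<noteq> 0} \<subseteq> interior A" using sub op by (intro interior_maximal) auto
  then have "{x. f x \<noteq> 0} \<subseteq> closure Q" using Q by blast
  then have "{x. f x \<noteq> 0} = {}" using op sub open_Int_closure_eq_empty[OF op, of Q] by blast
  then show "zero_distr u" unfolding zero_distr_def using rep by simp
qed

section \<open>Fractional powers at small scales\<close>

lemma power_weight_finite:
  assumes \<sigma>: "0 < \<sigma>" "\<sigma> < 1"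
  shows "(\<integral>\<^sup>+t. ennreal (indicator {0<..} t * t powr (- \<sigma> - 1) * min 1 t) \<partial>lborel) < \<infinity>"
proof -
  have 1: "(\<integral>\<^sup>+t. ennreal (indicator {0..1} t * t powr (- \<sigma>)) \<partial>lborel) = ennreal (1 powr (- \<sigma> + 1) / (- \<sigma> + 1))"
    using \<sigma> by (intro nn_integral_has_integral_lebesgue has_integral_powr_from_0) auto
  have 2: "(\<integral>\<^sup>+t. ennreal (indicator {1..} t * t powr (- \<sigma> - 1)) \<partial>lborel) = ennreal (- (1 powr (- \<sigma> - 1 + 1)) / (- \<sigma> - 1 + 1))"
    using \<sigma> by (intro nn_integral_has_integral_lebesgue has_integral_powr_to_inf) auto
  have "(\<integral>\<^sup>+t. ennreal (indicator {0<..} t * t powr (- \<sigma> - 1) * min 1 t) \<partial>lborel) \<le>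
     (\<integral>\<^sup>+t. ennreal (indicator {0..1} t * t powr (- \<sigma>)) + ennreal (indicator {1..} t * t powr (- \<sigma> - 1)) \<partial>lborel)"
  proof (intro nn_integral_mono)
    fix t :: real
    have "t powr (- \<sigma> - 1) * t = t powr (- \<sigma>)" if "t > 0"
      using that by (simp add: powr_diff)
    then have "indicator {0<..} t * t powr (- \<sigma> - 1) * min 1 t \<le> indicator {0..1} t * t powr (- \<sigma>) + indicator {1..} t * t powr (- \<sigma> - 1)"
      by (auto simp: indicator_def min_def)
    from ennreal_leI[OF this]
    show "ennreal (indicator {0<..} t * t powr (- \<sigma> - 1) * min 1 t) \<le>
        ennreal (indicator {0..1} t * t powr (- \<sigma>)) + ennreal (indicator {1..} t * t powr (- \<sigma> - 1))"
      by simp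
  qed
  also have "\<dots> = ennreal (1 powr (- \<sigma> + 1) / (- \<sigma> + 1)) + ennreal (- (1 powr (- \<sigma> - 1 + 1)) / (- \<sigma> - 1 + 1))"
    by (subst nn_integral_add) (simp_all only: 1 2, measurable)
  finally show ?thesis by (rule order.strict_trans1) simp
qed

text \<open>The constant for upper bounds, with 1 - exp (- t) replaced by the two-sided estimate min
  1 t.\<close>

definition weight_min :: "real \<Rightarrow> real" where
  "weight_min \<sigma> = enn2real (\<integral>\<^sup>+t. ennreal (indicator {0<..} t * t powr (- \<sigma> - 1) * min 1 t) \<partial>lborel)"

text \<open>The normalising constant in Balakrishnan's formula for a fractional power; for 0 <
  \<sigma> < 1 its value is Gamma (1 - \<sigma>) / \<sigma>.\<close>

definition weight_exp :: "real \<Rightarrow> real" where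
  "weight_exp \<sigma> = enn2real (\<integral>\<^sup>+t. ennreal (indicator {0<..} t * t powr (- \<sigma> - 1) * (1 - exp (- t))) \<partial>lborel)"

lemma weight_min_nonneg: "weight_min \<sigma> \<ge> 0"
  by (simp add: weight_min_def)

lemma nn_integral_weight_min:
  assumes \<sigma>: "0 < \<sigma>" "\<sigma> < 1" and k: "k > 0"
  shows "(\<integral>\<^sup>+t. ennreal (indicator {0<..} t * t powr (- \<sigma> - 1) * min 1 (k * t)) \<partial>lborel) = ennreal (k powr \<sigma> * weight_min \<sigma>)"
  using nn_integral_power_scale[of "\<lambda>t. min 1 t" k "- \<sigma>"] k power_weight_finite[OF \<sigma>]
  by (simp add: weight_min_def ennreal_mult' ennreal_enn2real_if less_top)

lemma one_minus_exp_le: "t \<ge> 0 \<Longrightarrow> 1 - exp (- t) \<le> min 1 (t::real)"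
proof -
  have "1 - exp (- t) \<le> t" using exp_ge_add_one_self[of "- t"] by linarith
  moreover have "1 - exp (- t) \<le> 1" by simp
  ultimately show ?thesis by simp
qed

lemma power_weight_exp_finite:
  assumes \<sigma>: "0 < \<sigma>" "\<sigma> < 1"
  shows "(\<integral>\<^sup>+t. ennreal (indicator {0<..} t * t powr (- \<sigma> - 1) * (1 - exp (- t))) \<partial>lborel) < \<infinity>"
proof (rule order.strict_trans1[OF nn_integral_mono power_weight_finite[OF \<sigma>]])
  fix t :: real
  show "ennreal (indicator {0<..} t * t powr (- \<sigma> - 1) * (1 - exp (- t))) \<le> ennreal (indicator {0<..} t * t powr (- \<sigma> - 1) * min 1 t)"
    using mult_left_mono[OF one_minus_exp_le[of t], of "t powr (- \<sigma> - 1)"]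
    by (cases "t > 0") (auto intro!: ennreal_leI simp del: min_mult_distrib_left)
qed

lemma nn_integral_weight_exp:
  assumes \<sigma>: "0 < \<sigma>" "\<sigma> < 1" and k: "k > 0"
  shows "(\<integral>\<^sup>+t. ennreal (indicator {0<..} t * t powr (- \<sigma> - 1) * (1 - exp (- (k * t)))) \<partial>lborel) = ennreal (k powr \<sigma> * weight_exp \<sigma>)"
  using nn_integral_power_scale[of "\<lambda>t. 1 - exp (- t)" k "- \<sigma>"] k power_weight_exp_finite[OF \<sigma>]
  by (simp add: weight_exp_def ennreal_mult' ennreal_enn2real_if less_top)

text \<open>On [1, \<infinity>) the factor 1 - exp (- t) is at least 1/2, and the remaining weight
  has integral 1 / \<sigma> there. Positivity permits dividing by the normalising constant.\<close>

lemma weight_exp_pos: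
  assumes \<sigma>: "0 < \<sigma>" "\<sigma> < 1"
  shows "weight_exp \<sigma> > 0"
proof -
  have e: "exp (- 1) \<le> (1/2 :: real)"
  proof -
    have "2 \<le> exp (1::real)" using exp_ge_add_one_self[of 1] by simp
    then have "inverse (exp 1) \<le> inverse (2::real)" by (intro le_imp_inverse_le) auto
    then show ?thesis by (simp add: exp_minus)
  qed
  have "(\<integral>\<^sup>+t. ennreal (indicator {1..} t * t powr (- \<sigma> - 1)) \<partial>lborel) = ennreal (- (1 powr (- \<sigma> - 1 + 1)) / (- \<sigma> - 1 + 1))"
    using \<sigma> by (intro nn_integral_has_integral_lebesgue has_integral_powr_to_inf) auto
  then have "ennreal (1/2) * ennreal (1 / \<sigma>) = ennreal (1/2) * (\<integral>\<^sup>+t. ennreal (indicator {1..} t * t powr (- \<sigma> - 1)) \<partial>lborel)"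
    using \<sigma> by simp
  also have "\<dots> = (\<integral>\<^sup>+t. ennreal (1/2) * ennreal (indicator {1..} t * t powr (- \<sigma> - 1)) \<partial>lborel)"
    by (rule nn_integral_cmult[symmetric]) measurable
  also have "\<dots> \<le> (\<integral>\<^sup>+t. ennreal (indicator {0<..} t * t powr (- \<sigma> - 1) * (1 - exp (- t))) \<partial>lborel)"
  proof (intro nn_integral_mono)
    fix t :: real
    have "1/2 * (indicator {1..} t * t powr (- \<sigma> - 1)) \<le> indicator {0<..} t * t powr (- \<sigma> - 1) * (1 - exp (- t))"
    proof (cases "t \<ge> 1")
      case True
      then have "exp (- t) \<le> exp (- 1)" by simp
      with e have "1/2 \<le> 1 - exp (- t)" by linarith
      from mult_left_mono[OF this, of "t powr (- \<sigma> - 1)"] True show ?thesis by (simp add: mult.commute)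
    next
      case False
      then show ?thesis by (cases "t > 0") auto
    qed
    moreover have "ennreal (1/2) * ennreal (indicator {1..} t * t powr (- \<sigma> - 1)) = ennreal (1/2 * (indicator {1..} t * t powr (- \<sigma> - 1)))"
      by (rule ennreal_mult'[symmetric]) simp
    ultimately show "ennreal (1/2) * ennreal (indicator {1..} t * t powr (- \<sigma> - 1)) \<le> ennreal (indicator {0<..} t * t powr (- \<sigma> - 1) * (1 - exp (- t)))"
      by (simp only: ennreal_leI)
  qed
  also have "\<dots> = ennreal (weight_exp \<sigma>)"
    unfolding weight_exp_def using power_weight_exp_finite[OF \<sigma>] by (simp add: less_top)
  also have "ennreal (1/2) * ennreal (1 / \<sigma>) = ennreal (1/2 * (1 / \<sigma>))"
    by (rule ennreal_mult'[symmetric]) simp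
  finally have "ennreal (1/2 * (1 / \<sigma>)) \<le> ennreal (weight_exp \<sigma>)" .
  then have "1/2 * (1 / \<sigma>) \<le> weight_exp \<sigma>" by (subst (asm) ennreal_le_iff) (auto simp: weight_exp_def)
  moreover have "1/2 * (1 / \<sigma>) > 0" using \<sigma> by simp
  ultimately show ?thesis by linarith
qed

lemma ifourier_diff:
  assumes "integrable lborel f" "integrable lborel g"
  shows "ifourier (\<lambda>x. f x - g x) y = ifourier f y - ifourier g y"
  unfolding ifourier_eq_fourier using assms by (simp add: fourier_diff right_diff_distrib)

lemma ifourier_cmult: "ifourier (\<lambda>x. c * f x) y = c * ifourier f y"
  unfolding ifourier_eq_fourier by (simp add: fourier_cmult)

lemma exp_lam_fourier_integrable:
  assumes f: "f \<in> schwartz" and t: "t \<ge> 0"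
  shows "integrable lborel (\<lambda>\<xi>. of_real (exp (- (lam \<xi> * t))) * fourier f \<xi>)"
proof -
  note [measurable] = schwartz_measurable[OF fourier_schwartz[OF f]]
  show ?thesis
    using t lam_pos
    by (intro Bochner_Integration.integrable_bound[OF schwartz_integrable[OF fourier_schwartz[OF f]]])
      (auto simp: norm_mult intro!: mult_left_le_one_le mult_nonneg_nonneg)
qed

lemma ifourier_one_minus_exp:
  assumes f: "f \<in> schwartz" and t: "t > 0"
  shows "ifourier (\<lambda>\<xi>. of_real (1 - exp (- (lam \<xi> * t))) * fourier f \<xi>) x = f x - of_real (exp (- t)) * heat_op t f x"
proof -
  have "ifourier (\<lambda>\<xi>. of_real (1 - exp (- (lam \<xi> * t))) * fourier f \<xi>) x =
     ifourier (\<lambda>\<xi>. fourier f \<xi> - of_real (exp (- (lam \<xi> * t))) * fourier f \<xi>) x"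
    by (simp add: left_diff_distrib)
  also have "\<dots> = ifourier (fourier f) x - ifourier (\<lambda>\<xi>. of_real (exp (- (lam \<xi> * t))) * fourier f \<xi>) x"
    using t by (intro ifourier_diff schwartz_integrable fourier_schwartz f exp_lam_fourier_integrable) auto
  finally show ?thesis by (simp only: ifourier_fourier[OF f] ifourier_exp_lam[OF f t])
qed

lemma norm_minus_heat_le_sup:
  assumes f: "f \<in> schwartz" and A: "\<And>x. norm (f x) \<le> A" and t: "t > 0"
  shows "norm (f x - of_real (exp (- t)) * heat_op t f x) \<le> 2 * A"
proof -
  have "norm (f x - of_real (exp (- t)) * heat_op t f x) \<le> norm (f x) + exp (- t) * norm (heat_op t f x)"
    using norm_triangle_ineq4[of "f x" "of_real (exp (- t)) * heat_op t f x"] by (simp add: norm_mult)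
  also have "\<dots> \<le> A + 1 * A"
    using t norm_heat_op_le[OF schwartz_measurable[OF f] A t, of x] by (intro add_mono A mult_mono) auto
  finally show ?thesis by simp
qed

text \<open>The symbol 1 - exp (- lam * t) is the integral over [0, t] of lam * exp (- lam *
  \<tau>), and the factor lam turns f into \<open>Lop f\<close>. This is the bound for small t; the
  supremum bound covers large t.\<close>

lemma norm_minus_heat_le_Lop:
  fixes f :: "'n::finite test"
  assumes f: "f \<in> schwartz" and B: "\<And>x. norm (Lop f x) \<le> B" and t: "t > 0"
  shows "norm (f x - of_real (exp (- t)) * heat_op t f x) \<le> t * B"
proof -
  let ?k = "\<lambda>\<tau> \<xi>. indicator {0..t} \<tau> * (lam \<xi> * exp (- (lam \<xi> * \<tau>))) :: real"
  note [measurable] = fourier_schwartz[OF f, THEN schwartz_measurable]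
  have B0: "B \<ge> 0" using order_trans[OF norm_ge_zero B] .
  have "f x - of_real (exp (- t)) * heat_op t f x = ifourier (\<lambda>\<xi>. of_real (1 - exp (- (lam \<xi> * t))) * fourier f \<xi>) x"
    by (rule ifourier_one_minus_exp[OF f t, symmetric])
  also have "\<dots> = (\<integral>\<tau>. ifourier (\<lambda>\<xi>. of_real (?k \<tau> \<xi>) * fourier f \<xi>) x \<partial>lborel)"
  proof (rule ifourier_superposition(1))
    fix \<xi> :: "real^'n"
    have "(\<integral>\<^sup>+\<tau>. ennreal (lam \<xi> * exp (- (lam \<xi> * \<tau>))) * indicator {0..t} \<tau> \<partial>lborel) =
      (- exp (- (lam \<xi> * t))) - (- exp (- (lam \<xi> * 0)))"
      using t lam_pos[of \<xi>] by (intro nn_integral_FTC_Icc) (auto intro!: derivative_eq_intros simp: algebra_simps)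
    then show "(\<integral>\<^sup>+\<tau>. ennreal (?k \<tau> \<xi>) \<partial>lborel) = ennreal (1 - exp (- (lam \<xi> * t)))"
      using lam_pos[of \<xi>] by (simp add: ennreal_mult' ennreal_indicator mult.commute)
    show "0 \<le> 1 - exp (- (lam \<xi> * t))" using t lam_pos[of \<xi>] by simp
    show "?k \<tau> \<xi> \<ge> 0" for \<tau> using lam_pos[of \<xi>] by simp
    have "integrable lborel (\<lambda>\<xi>. fourier f \<xi> - of_real (exp (- (lam \<xi> * t))) * fourier f \<xi>)"
      using t by (intro Bochner_Integration.integrable_diff schwartz_integrable fourier_schwartz f exp_lam_fourier_integrable) auto
    then show "integrable lborel (\<lambda>\<xi>. of_real (1 - exp (- (lam \<xi> * t))) * fourier f \<xi>)"
      by (simp add: left_diff_distrib)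
  qed measurable
  also have "norm \<dots> \<le> (\<integral>\<tau>. norm (ifourier (\<lambda>\<xi>. of_real (?k \<tau> \<xi>) * fourier f \<xi>) x) \<partial>lborel)"
    by (rule integral_norm_bound)
  also have "\<dots> \<le> (\<integral>\<tau>. indicator {0..t} \<tau> * B \<partial>lborel)"
  proof (rule integral_mono_AE')
    show "integrable lborel (\<lambda>\<tau>. indicator {0..t} \<tau> * B)"
      using t by (intro integrable_mult_left integrable_real_indicator) auto
    \<comment> \<open>The heat representation requires a positive time, so the endpoint 0 is
      discarded as a null set.\<close>
    have "AE \<tau> in lborel. \<tau> \<noteq> (0::real)" by (rule AE_lborel_singleton)
    then show "AE \<tau> in lborel. norm (ifourier (\<lambda>\<xi>. of_real (?k \<tau> \<xi>) * fourier f \<xi>) x) \<le> indicator {0..t} \<tau> * B"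
    proof eventually_elim
      case (elim \<tau>)
      show ?case
      proof (cases "\<tau> \<in> {0..t}")
        case True
        with elim have \<tau>: "\<tau> > 0" by auto
        have "ifourier (\<lambda>\<xi>. of_real (?k \<tau> \<xi>) * fourier f \<xi>) x = ifourier (\<lambda>\<xi>. of_real (exp (- (lam \<xi> * \<tau>))) * fourier (Lop f) \<xi>) x"
          unfolding fourier_Lop[OF f] using True by (simp add: mult_ac)
        also have "\<dots> = of_real (exp (- \<tau>)) * heat_op \<tau> (Lop f) x" by (rule ifourier_exp_lam[OF schwartz_Lop[OF f] \<tau>])
        also have "norm \<dots> \<le> 1 * B"
          unfolding norm_mult using \<tau> norm_heat_op_le[OF schwartz_measurable[OF schwartz_Lop[OF f]] B \<tau>, of x]
          by (intro mult_mono) auto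
        finally show ?thesis using True by simp
      qed (simp add: ifourier_def)
    qed
    show "AE \<tau> in lborel. 0 \<le> indicator {0..t} \<tau> * B" using B0 by simp
  qed
  also have "\<dots> = t * B" using t by simp
  finally show ?thesis .
qed

text \<open>Balakrishnan's formula. By scaling, integrating 1 - exp (- lam * t) against t powr (-
  \<sigma> - 1) gives lam powr \<sigma> up to \<open>weight_exp\<close>; subtracting the heat flow
  from f is what makes the integral converge at t = 0.\<close>

lemma bessel_fractional:
  fixes f :: "'n::finite test"
  assumes f: "f \<in> schwartz" and \<sigma>: "0 < \<sigma>" "\<sigma> < 1"
  shows "of_real (weight_exp \<sigma>) * bessel (2 * \<sigma>) f x =
    (\<integral>t. of_real (indicator {0<..} t * t powr (- \<sigma> - 1)) * (f x - of_real (exp (- t)) * heat_op t f x) \<partial>lborel)"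
proof -
  let ?k = "\<lambda>t \<xi>. indicator {0<..} t * t powr (- \<sigma> - 1) * (1 - exp (- (lam \<xi> * t))) :: real"
  note [measurable] = fourier_schwartz[OF f, THEN schwartz_measurable]
  have bs: "bessel_symbol (2 * \<sigma>) \<xi> = of_real (lam \<xi> powr \<sigma>)" for \<xi> :: "real^'n"
    by (simp add: bessel_symbol_def)
  have "of_real (weight_exp \<sigma>) * bessel (2 * \<sigma>) f x = ifourier (\<lambda>\<xi>. of_real (lam \<xi> powr \<sigma> * weight_exp \<sigma>) * fourier f \<xi>) x"
    unfolding bessel_def bs ifourier_cmult[symmetric] of_real_mult by (simp only: mult_ac)
  also have "\<dots> = (\<integral>t. ifourier (\<lambda>\<xi>. of_real (?k t \<xi>) * fourier f \<xi>) x \<partial>lborel)"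
  proof (rule ifourier_superposition(1))
    show "(\<integral>\<^sup>+t. ennreal (?k t \<xi>) \<partial>lborel) = ennreal (lam \<xi> powr \<sigma> * weight_exp \<sigma>)" for \<xi> :: "real^'n"
      by (rule nn_integral_weight_exp[OF \<sigma> lam_pos])
    show "?k t \<xi> \<ge> 0" for t \<xi> using lam_pos[of \<xi>] by (cases "t > 0") auto
    show "0 \<le> lam \<xi> powr \<sigma> * weight_exp \<sigma>" for \<xi> using weight_exp_pos[OF \<sigma>] by simp
    have "integrable lborel (\<lambda>\<xi>. of_real (weight_exp \<sigma>) * (bessel_symbol (2 * \<sigma>) \<xi> * fourier f \<xi>))"
      by (intro integrable_mult_right schwartz_integrable schwartz_bessel_mult f)
    then show "integrable lborel (\<lambda>\<xi>. complex_of_real (lam \<xi> powr \<sigma> * weight_exp \<sigma>) * fourier f \<xi>)"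
      unfolding bs of_real_mult by (simp only: mult_ac)
  qed measurable
  also have "\<dots> = (\<integral>t. of_real (indicator {0<..} t * t powr (- \<sigma> - 1)) * (f x - of_real (exp (- t)) * heat_op t f x) \<partial>lborel)"
  proof (intro Bochner_Integration.integral_cong refl)
    fix t :: real
    show "ifourier (\<lambda>\<xi>. of_real (?k t \<xi>) * fourier f \<xi>) x =
      of_real (indicator {0<..} t * t powr (- \<sigma> - 1)) * (f x - of_real (exp (- t)) * heat_op t f x)"
    proof (cases "t > 0")
      case True
      show ?thesis
        unfolding of_real_mult[of "indicator {0<..} t * t powr (- \<sigma> - 1)"] mult.assoc[of "of_real (indicator {0<..} t * t powr (- \<sigma> - 1))"]
          ifourier_cmult ifourier_one_minus_exp[OF f True] ..
    qed (simp add: ifourier_def)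
  qed
  finally show ?thesis .
qed

text \<open>Here k is the inverse square of the relevant length: the width of the bump near its
  centre, half the distance to the centre far away. The factor k powr \<sigma> is the price of 2
  \<sigma> derivatives at that length.\<close>

lemma bessel_fractional_bound:
  fixes f :: "'n::finite test"
  assumes f: "f \<in> schwartz" and \<sigma>: "0 < \<sigma>" "\<sigma> < 1" and k: "k > 0" and G: "G \<ge> 0"
    and le: "\<And>t. t > 0 \<Longrightarrow> norm (f x - of_real (exp (- t)) * heat_op t f x) \<le> G * min 1 (k * t)"
  shows "norm (bessel (2 * \<sigma>) f x) \<le> G * k powr \<sigma> * (weight_min \<sigma> / weight_exp \<sigma>)"
proof -
  let ?w = "\<lambda>t. indicator {0<..} t * t powr (- \<sigma> - 1) * min 1 (k * t) :: real"
  have w0: "?w t \<ge> 0" for t using k by (cases "t > 0") auto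
  have iw: "integrable lborel ?w"
    using nn_integral_weight_min[OF \<sigma> k] w0 by (intro integrableI_nonneg) auto
  have vw: "integral\<^sup>L lborel ?w = k powr \<sigma> * weight_min \<sigma>"
    using nn_integral_weight_min[OF \<sigma> k] w0 weight_min_nonneg by (subst integral_eq_nn_integral) auto
  have "weight_exp \<sigma> * norm (bessel (2 * \<sigma>) f x) = norm (of_real (weight_exp \<sigma>) * bessel (2 * \<sigma>) f x)"
    using weight_exp_pos[OF \<sigma>] by (simp add: norm_mult)
  also have "\<dots> \<le> (\<integral>t. norm (of_real (indicator {0<..} t * t powr (- \<sigma> - 1)) * (f x - of_real (exp (- t)) * heat_op t f x)) \<partial>lborel)"
    unfolding bessel_fractional[OF f \<sigma>] by (rule integral_norm_bound)
  also have "\<dots> \<le> (\<integral>t. G * ?w t \<partial>lborel)"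
  proof (rule integral_mono_AE')
    show "integrable lborel (\<lambda>t. G * ?w t)" by (intro integrable_mult_right iw)
    show "AE t in lborel. norm (of_real (indicator {0<..} t * t powr (- \<sigma> - 1)) * (f x - of_real (exp (- t)) * heat_op t f x)) \<le> G * ?w t"
    proof (intro AE_I2)
      fix t
      show "norm (of_real (indicator {0<..} t * t powr (- \<sigma> - 1)) * (f x - of_real (exp (- t)) * heat_op t f x)) \<le> G * ?w t"
      proof (cases "t > 0")
        case True
        from mult_left_mono[OF le[OF True], of "t powr (- \<sigma> - 1)"] True show ?thesis
          by (simp add: norm_mult mult_ac)
      qed simp
    qed
    show "AE t in lborel. 0 \<le> G * ?w t" by (intro AE_I2 mult_nonneg_nonneg[OF G w0])
  qed
  also have "\<dots> = G * (k powr \<sigma> * weight_min \<sigma>)" by (simp only: integral_mult_right_zero vw)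
  finally show ?thesis using weight_exp_pos[OF \<sigma>] by (simp add: field_simps)
qed

section \<open>Decay of the heat kernel in space\<close>

lemma powr_exp_bounded:
  assumes "b \<ge> 0" shows "\<exists>D\<ge>0. \<forall>u>0. u powr b * exp (- u) \<le> (D::real)"
proof -
  define N where "N = Suc (nat \<lceil>b\<rceil>)"
  have N: "b \<le> real N" "N > 0" by (auto simp: N_def) linarith
  have "u powr b * exp (- u) \<le> 1 + real N ^ N" if u: "u > 0" for u
  proof -
    have "(u / real N) ^ N \<le> (1 + u / real N) ^ N" using u by (intro power_mono) auto
    also have "\<dots> \<le> exp u" using exp_ge_one_plus_x_over_n_power_n[of N u] u N by simp
    finally have "u ^ N \<le> real N ^ N * exp u" using N by (simp add: power_divide field_simps)
    then have 1: "u ^ N * exp (- u) \<le> real N ^ N" by (simp add: exp_minus field_simps)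
    have "u powr b \<le> 1 + u ^ N"
    proof (cases "u \<ge> 1")
      case True
      then have "u powr b \<le> u powr (real N)" using N by (intro powr_mono) auto
      then show ?thesis using u by (simp add: powr_realpow)
    next
      case False
      then have "u powr b \<le> 1" using u assms by (intro powr_le1) auto
      then show ?thesis using u by (simp add: add_increasing2)
    qed
    then have "u powr b * exp (- u) \<le> (1 + u ^ N) * exp (- u)" by (intro mult_right_mono) auto
    also have "\<dots> \<le> 1 + real N ^ N" using 1 u by (simp add: ring_distribs add_mono)
    finally show ?thesis .
  qed
  then show ?thesis by (intro exI[of _ "1 + real N ^ N"]) auto
qed

lemma heat_decay:
  "\<exists>D\<ge>0. \<forall>t>0. \<forall>z::real^'n::finite. z \<noteq> 0 \<longrightarrow> heat t z \<le> D * norm z powr (- real CARD('n)) * min 1 (t / (norm z)\<^sup>2)"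
proof -
  let ?n = "real CARD('n)"
  obtain D1 where D1: "D1 \<ge> 0" "\<And>u. u > 0 \<Longrightarrow> u powr (?n / 2) * exp (- u) \<le> D1" using powr_exp_bounded[of "?n / 2"] by auto
  obtain D2 where D2: "D2 \<ge> 0" "\<And>u. u > 0 \<Longrightarrow> u powr (?n / 2 + 1) * exp (- u) \<le> D2" using powr_exp_bounded[of "?n / 2 + 1"] by auto
  \<comment> \<open>The constant D1 serves for t \<ge> |z|^2. Otherwise an additional power of u,
    controlled by D2, yields the factor t / |z|^2 = 1 / (4 u), whence the 4.\<close>
  define D where "D = pi powr (- ?n / 2) * (4 * (D1 + D2))"
  have "heat t z \<le> D * norm z powr (- ?n) * min 1 (t / (norm z)\<^sup>2)" if t: "t > 0" and z: "z \<noteq> 0" for t and z :: "real^'n"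
  proof -
    \<comment> \<open>In this variable heat t z is |z| powr (- n) times a function of u alone, in
      which exp (- u) beats every power.\<close>
    define u where "u = (norm z)\<^sup>2 / (4 * t)"
    have u: "u > 0" using t z by (simp add: u_def)
    have 4: "4 * pi * t = pi * ((norm z)\<^sup>2 / u)" using t z by (simp add: u_def)
    have "(4 * pi * t) powr (- ?n / 2) = pi powr (- ?n / 2) * ((norm z)\<^sup>2 powr (- ?n / 2) / u powr (- ?n / 2))"
      unfolding 4 using u by (simp add: powr_mult powr_divide)
    also have "(norm z)\<^sup>2 powr (- ?n / 2) = norm z powr (- ?n)"
      using z by (subst powr_numeral[symmetric]) (simp_all only: powr_powr, simp_all)
    also have "norm z powr (- ?n) / u powr (- ?n / 2) = norm z powr (- ?n) * u powr (?n / 2)"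
      by (simp add: powr_minus field_simps)
    finally have h: "heat t z = pi powr (- ?n / 2) * norm z powr (- ?n) * (u powr (?n / 2) * exp (- u))"
      unfolding heat_def u_def by simp
    have "u powr (?n / 2) * exp (- u) \<le> 4 * (D1 + D2) * min 1 (t / (norm z)\<^sup>2)"
    proof (cases "t / (norm z)\<^sup>2 \<ge> 1")
      case True
      then show ?thesis using D1(2)[OF u] D1(1) D2(1) by simp
    next
      case False
      have "t / (norm z)\<^sup>2 = 1 / (4 * u)" using t z by (simp add: u_def)
      with False have "min 1 (t / (norm z)\<^sup>2) = 1 / (4 * u)" by linarith
      then have m: "4 * (D1 + D2) * min 1 (t / (norm z)\<^sup>2) = (D1 + D2) / u"
        using u by (simp only:) (simp add: field_simps)
      have "u powr (?n / 2) * exp (- u) = u powr (?n / 2 + 1) * exp (- u) / u" using u by (simp add: powr_add)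
      moreover have "\<dots> \<le> D2 / u" using D2(2)[OF u] u by (intro divide_right_mono) auto
      moreover have "\<dots> \<le> (D1 + D2) / u" using D1(1) u by (intro divide_right_mono) auto
      ultimately show ?thesis unfolding m by linarith
    qed
    from mult_left_mono[OF this, of "pi powr (- ?n / 2) * norm z powr (- ?n)"]
    show ?thesis unfolding h D_def by (simp add: mult_ac)
  qed
  moreover have "D \<ge> 0" using D1 D2 by (simp add: D_def)
  ultimately show ?thesis by blast
qed

section \<open>Derivatives of a smooth function times a small bump\<close>

text \<open>A uniform O-bound on S. It is used with pairs (e, x) as points, so that one constant
  serves all widths e and all positions x.\<close>

definition bdd_by :: "'b set \<Rightarrow> ('b \<Rightarrow> complex) \<Rightarrow> ('b \<Rightarrow> real) \<Rightarrow> bool" where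
  "bdd_by S F w \<longleftrightarrow> (\<exists>C\<ge>0. \<forall>y\<in>S. norm (F y) \<le> C * w y)"

lemma bdd_byI: "C \<ge> 0 \<Longrightarrow> (\<And>y. y \<in> S \<Longrightarrow> norm (F y) \<le> C * w y) \<Longrightarrow> bdd_by S F w"
  unfolding bdd_by_def by blast

lemma bdd_byE:
  assumes "bdd_by S F w"
  obtains C where "C \<ge> 0" "\<And>y. y \<in> S \<Longrightarrow> norm (F y) \<le> C * w y"
  using assms unfolding bdd_by_def by blast

lemma bdd_by_add:
  assumes "bdd_by S F w" "bdd_by S G w" shows "bdd_by S (\<lambda>y. F y + G y) w"
proof -
  obtain C D where C: "C \<ge> 0" "\<And>y. y \<in> S \<Longrightarrow> norm (F y) \<le> C * w y" and D: "D \<ge> 0" "\<And>y. y \<in> S \<Longrightarrow> norm (G y) \<le> D * w y"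
    using assms unfolding bdd_by_def by metis
  show ?thesis
  proof (rule bdd_byI[of "C + D"])
    show "norm (F y + G y) \<le> (C + D) * w y" if "y \<in> S" for y
      using norm_triangle_ineq[of "F y" "G y"] C(2)[OF that] D(2)[OF that] by (simp add: ring_distribs)
  qed (use C D in simp)
qed

lemma bdd_by_0: "bdd_by S (\<lambda>y. 0) w"
  by (rule bdd_byI[of 0]) auto

lemma bdd_by_sum_list:
  "(\<And>a. a \<in> set xs \<Longrightarrow> bdd_by S (F a) w) \<Longrightarrow> bdd_by S (\<lambda>y. \<Sum>a\<leftarrow>xs. F a y) w"
  by (induction xs) (auto intro: bdd_by_add bdd_by_0)

lemma bdd_by_sum:
  "(\<And>a. a \<in> I \<Longrightarrow> bdd_by S (F a) w) \<Longrightarrow> bdd_by S (\<lambda>y. \<Sum>a\<in>I. F a y) w"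
  by (induction I rule: infinite_finite_induct) (auto intro: bdd_by_add bdd_by_0)

lemma bdd_by_cmult: assumes "bdd_by S F w" shows "bdd_by S (\<lambda>y. c * F y) w"
proof -
  obtain C where C: "C \<ge> 0" "\<And>y. y \<in> S \<Longrightarrow> norm (F y) \<le> C * w y" using assms unfolding bdd_by_def by metis
  show ?thesis
    by (rule bdd_byI[of "norm c * C"]) (use C in \<open>auto simp: norm_mult mult.assoc intro!: mult_left_mono\<close>)
qed

lemma smooth_fun_Lop: "smooth_fun f \<Longrightarrow> smooth_fun (Lop f)"
  unfolding Lop_def using smooth_fun_add[of f "\<lambda>x. (-1) * (\<Sum>j\<in>UNIV. pdiff [j, j] f x)"]
  by (simp add: smooth_fun_cmult[of _ "-1", simplified] smooth_fun_sum smooth_fun_pdiff)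

lemma smooth_fun_Lop_pow: "smooth_fun f \<Longrightarrow> smooth_fun ((Lop ^^ k) f)"
  by (induction k) (auto intro: smooth_fun_Lop)

lemma pdiff_Lop:
  assumes f: "smooth_fun f"
  shows "pdiff is (Lop f) = (\<lambda>x. pdiff is f x + (-1) * (\<Sum>j\<in>UNIV. pdiff (is @ [j, j]) f x))"
proof -
  have s: "smooth_fun (\<lambda>x. \<Sum>j\<in>UNIV. pdiff [j, j] f x)" by (intro smooth_fun_sum smooth_fun_pdiff f)
  have "Lop f = (\<lambda>x. f x + (-1) * (\<Sum>j\<in>UNIV. pdiff [j, j] f x))" by (simp add: Lop_def)
  then have "pdiff is (Lop f) = (\<lambda>x. pdiff is f x + (-1) * pdiff is (\<lambda>x. \<Sum>j\<in>UNIV. pdiff [j, j] f x) x)"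
    by (simp only: pdiff_add[OF f smooth_fun_cmult[OF s]] pdiff_cmult[OF s])
  then show ?thesis by (simp add: pdiff_sum smooth_fun_pdiff f pdiff_append)
qed

lemma Lop_pow_eq_0_open:
  assumes U: "open U" and f: "\<And>x. x \<in> U \<Longrightarrow> f x = 0" and x: "x \<in> U"
  shows "(Lop ^^ k) f x = 0"
  using x
proof (induction k arbitrary: x)
  case (Suc k)
  have "pdiff js ((Lop ^^ k) f) x = 0" for js by (rule pdiff_eq_0_open[OF U Suc.IH Suc.prems])
  from this[of "[]"] this have "Lop ((Lop ^^ k) f) x = 0"
    unfolding Lop_def[of "(Lop ^^ k) f"] by simp
  then show ?case by simp
qed (use f in simp)

lemma smooth_fun_mult_bump: "smooth_fun h \<Longrightarrow> smooth_fun (\<lambda>x. h x * bump q e x)"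
  by (intro smooth_fun_mult smooth_fun_bump)

lemma mult_bump_eq_0: "e > 0 \<Longrightarrow> norm (x - q) > e \<Longrightarrow> h x * bump q e x = 0"
  using bump_eq_0[of e x q] by simp

lemma open_norm_greater: "open {x::real^'n::finite. norm (x - q) > e}"
  by (intro open_Collect_less continuous_intros)

lemma schwartz_mult_bump:
  fixes h :: "'n::finite test"
  assumes h: "smooth_fun h" and e: "e > 0"
  shows "(\<lambda>x. h x * bump q e x) \<in> schwartz"
proof (rule schwartz_compact_support[OF smooth_fun_mult_bump[OF h]])
  fix x :: "real^'n" assume "norm x > norm q + e"
  then have "norm (x - q) > e" using norm_triangle_ineq2[of x q] by linarith
  then show "h x * bump q e x = 0" using e by (rule mult_bump_eq_0[rotated])
qed

lemma bump_rescale: "bump q e x = bump 0 1 ((1 / e) *\<^sub>R (x - q))"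
  by (simp add: bump_def)

text \<open>In the Leibniz expansion each derivative falling on the bump costs 1 / e, while those
  falling on h cost a constant. Since e \<le> 1, the missing powers of 1 / e may be added.\<close>

lemma mult_bump_family:
  fixes h :: "'n::finite test"
  assumes h: "smooth_fun h"
  shows "bdd_by ({0<..1} \<times> UNIV) (\<lambda>(e, x). pdiff is (\<lambda>x. h x * bump q e x) x) (\<lambda>(e, x). (1 / e) ^ length is)"
proof -
  \<comment> \<open>The function h is merely smooth, so bounds for its derivatives come from
    compactness of the unit ball at q. Outside this ball the product vanishes, because e \<le>
    1.\<close>
  let ?S = "{y \<in> {0<..1::real} \<times> (UNIV :: (real^'n) set). norm (snd y - q) \<le> 1}"
  have "bdd_by ?S (\<lambda>y. \<Sum>a\<leftarrow>splits is. pdiff (fst a) h (snd y) * pdiff (snd a) (bump q (fst y)) (snd y)) (\<lambda>y. (1 / fst y) ^ length is)"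
  proof (rule bdd_by_sum_list)
    fix a assume "a \<in> set (splits is)"
    then have len: "length (fst a) + length (snd a) = length is" using length_splits[of "fst a" "snd a"] by simp
    have "\<exists>E. \<forall>y\<in>pdiff (fst a) h ` cball q 1. norm y \<le> E"
      using compact_imp_bounded[OF compact_continuous_image[OF smooth_fun_continuous_on[OF h, of "cball q 1" "fst a"] compact_cball]]
      by (simp only: bounded_iff)
    then obtain E where E: "\<forall>y\<in>pdiff (fst a) h ` cball q 1. norm y \<le> E" ..
    have E0: "E \<ge> 0" using E by (meson centre_in_cball image_eqI norm_ge_zero order_trans zero_le_one)
    obtain D where D: "D \<ge> 0" "\<And>x. norm (pdiff (snd a) (bump 0 1) x) \<le> D"
      using schwartz_bounded[OF schwartz_pdiff[OF bump_schwartz[OF zero_less_one]]] by metis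
    show "bdd_by ?S (\<lambda>y. pdiff (fst a) h (snd y) * pdiff (snd a) (bump q (fst y)) (snd y)) (\<lambda>y. (1 / fst y) ^ length is)"
    proof (rule bdd_byI[of "E * D"])
      fix y :: "real \<times> (real^'n)" assume y: "y \<in> ?S"
      obtain e x where ex: "y = (e, x)" by (cases y)
      have e: "0 < e" "e \<le> 1" and x: "norm (x - q) \<le> 1" using y by (auto simp: ex)
      have "norm (pdiff (snd a) (bump q e) x) = (1 / e) ^ length (snd a) * norm (pdiff (snd a) (bump 0 1) ((1 / e) *\<^sub>R (x - q)))"
      proof -
        have "bump q e = (\<lambda>x. bump 0 1 ((1 / e) *\<^sub>R (x - q)))" using bump_rescale by blast
        then show ?thesis using e by (simp add: pdiff_affine[OF smooth_fun_bump] norm_mult norm_power norm_divide)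
      qed
      also have "\<dots> \<le> (1 / e) ^ length (snd a) * D" using e by (intro mult_left_mono D) auto
      also have "\<dots> \<le> (1 / e) ^ length is * D"
        using e len D by (intro mult_right_mono power_increasing) auto
      finally have 1: "norm (pdiff (snd a) (bump q e) x) \<le> (1 / e) ^ length is * D" .
      have 2: "norm (pdiff (fst a) h x) \<le> E"
        by (rule bspec[OF E imageI]) (use x in \<open>simp add: dist_norm norm_minus_commute\<close>)
      show "norm (pdiff (fst a) h (snd y) * pdiff (snd a) (bump q (fst y)) (snd y)) \<le> E * D * (1 / fst y) ^ length is"
        using mult_mono[OF 2 1 E0 norm_ge_zero] by (simp add: ex norm_mult mult_ac)
    qed (use E0 D in simp)
  qed
  then have "bdd_by ?S (\<lambda>y. pdiff is (\<lambda>x. h x * bump q (fst y) x) (snd y)) (\<lambda>y. (1 / fst y) ^ length is)"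
    by (simp only: pdiff_mult[OF h smooth_fun_bump])
  then obtain C where C: "C \<ge> 0" "\<And>y. y \<in> ?S \<Longrightarrow> norm (pdiff is (\<lambda>x. h x * bump q (fst y) x) (snd y)) \<le> C * (1 / fst y) ^ length is"
    by (erule bdd_byE)
  show ?thesis
  proof (rule bdd_byI[OF C(1)], clarify)
    fix e :: real and x :: "real^'n" assume e: "e \<in> {0<..1}"
    show "norm (pdiff is (\<lambda>x. h x * bump q e x) x) \<le> C * (1 / e) ^ length is"
    proof (cases "norm (x - q) \<le> 1")
      case True
      then show ?thesis using C(2)[of "(e, x)"] e by simp
    next
      case False
      have "pdiff is (\<lambda>x. h x * bump q e x) x = 0"
        by (rule pdiff_eq_0_open[OF open_norm_greater[of e q]]) (use e False mult_bump_eq_0 in auto)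
      then show ?thesis using C e by simp
    qed
  qed
qed

text \<open>The word of derivatives is generalised in the induction, since one more
  \<open>Lop\<close> involves words longer by two.\<close>

lemma Lop_pow_mult_bump_family:
  fixes h :: "'n::finite test"
  assumes h: "smooth_fun h"
  shows "bdd_by ({0<..1} \<times> UNIV) (\<lambda>(e, x). pdiff is ((Lop ^^ k) (\<lambda>x. h x * bump q e x)) x) (\<lambda>(e, x). (1 / e) ^ (2 * k + length is))"
proof (induction k arbitrary: "is")
  case 0
  show ?case using mult_bump_family[OF h, of "is" q] by simp
next
  case (Suc k)
  let ?S = "{0<..1::real} \<times> (UNIV :: (real^'n) set)" and ?g = "\<lambda>e. (Lop ^^ k) (\<lambda>x. h x * bump q e x)"
  have s: "smooth_fun (?g e)" for e by (intro smooth_fun_Lop_pow smooth_fun_mult_bump h)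
  \<comment> \<open>For e \<le> 1 the zeroth-order term of \<open>Lop\<close> is of lower order in 1
    / e and is absorbed.\<close>
  have mono: "bdd_by ?S F (\<lambda>(e, x). (1 / e) ^ (2 * Suc k + length is))"
    if F: "bdd_by ?S F (\<lambda>(e, x). (1 / e) ^ m)" and m: "m \<le> 2 * Suc k + length is" for F m
  proof -
    from F obtain C where C: "C \<ge> 0" "\<And>y. y \<in> ?S \<Longrightarrow> norm (F y) \<le> C * (case y of (e, x) \<Rightarrow> (1 / e) ^ m)"
      by (erule bdd_byE)
    show ?thesis
    proof (rule bdd_byI[OF C(1)], clarify)
      fix e :: real and x :: "real^'n" assume e: "e \<in> {0<..1}"
      have "norm (F (e, x)) \<le> C * (1 / e) ^ m" using C(2)[of "(e, x)"] e by simp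
      also have "\<dots> \<le> C * (1 / e) ^ (2 * Suc k + length is)" using e m C(1) by (intro mult_left_mono power_increasing) auto
      finally show "norm (F (e, x)) \<le> C * (1 / e) ^ (2 * Suc k + length is)" .
    qed
  qed
  have "bdd_by ?S (\<lambda>y. (case y of (e, x) \<Rightarrow> pdiff is (?g e) x) + (-1) * (\<Sum>j\<in>UNIV. case y of (e, x) \<Rightarrow> pdiff (is @ [j, j]) (?g e) x))
     (\<lambda>(e, x). (1 / e) ^ (2 * Suc k + length is))"
    by (intro bdd_by_add bdd_by_cmult bdd_by_sum mono[OF Suc.IH]) auto
  then show ?case by (simp add: pdiff_Lop[OF s] case_prod_unfold)
qed

text \<open>Size at distance r from q of the Bessel potential of order s of a bump of width e at q.\<close>

definition profile :: "nat \<Rightarrow> real \<Rightarrow> real \<Rightarrow> real \<Rightarrow> real" where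
  "profile n s e r = e powr (- s) * (e / max e r) ^ n"

text \<open>Every point of the support of f has distance at least |x - q| / 2 from x. The bound is
  therefore supremum of f times volume of the ball times the kernel at that distance; the volume, of
  order e^n, against the power -n of the distance is the tail of \<open>profile\<close>.\<close>

lemma heat_op_far:
  fixes f :: "'n::finite test"
  assumes f: "f \<in> schwartz" and A: "A \<ge> 0" "\<And>x. norm (f x) \<le> A" and e: "e > 0" and supp: "\<And>x. norm (x - q) > e \<Longrightarrow> f x = 0"
    and D: "D \<ge> 0" "\<And>t z::real^'n. t > 0 \<Longrightarrow> z \<noteq> 0 \<Longrightarrow> heat t z \<le> D * norm z powr (- real CARD('n)) * min 1 (t / (norm z)\<^sup>2)"
    and far: "norm (x - q) \<ge> 2 * e" and t: "t > 0"
  shows "norm (heat_op t f x) \<le> A * (unit_ball_vol (real CARD('n)) * e ^ CARD('n)) * D * (norm (x - q) / 2) powr (- real CARD('n)) * min 1 ((1 / (norm (x - q) / 2)\<^sup>2) * t)"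
proof -
  let ?r = "norm (x - q) / 2"
  let ?H = "D * ?r powr (- real CARD('n)) * min 1 (t / ?r\<^sup>2)"
  have "norm (x - q) > 0" using far e by linarith
  then have r: "?r > 0" by (rule half_gt_zero)
  have H0: "?H \<ge> 0" using D t by simp
  have h: "heat t (x - y) \<le> ?H" if "norm (y - q) \<le> e" for y
  proof -
    have le: "?r \<le> norm (x - y)"
      using norm_triangle_ineq[of "x - y" "y - q"] that far by simp
    then have z: "x - y \<noteq> 0" using r by auto
    have "heat t (x - y) \<le> D * norm (x - y) powr (- real CARD('n)) * min 1 (t / (norm (x - y))\<^sup>2)" by (rule D(2)[OF t z])
    also have "\<dots> \<le> ?H"
    proof (intro mult_mono mult_left_mono D(1))
      show "norm (x - y) powr (- real CARD('n)) \<le> ?r powr (- real CARD('n))"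
        using le r by (intro powr_mono2') auto
      have "t / (norm (x - y))\<^sup>2 \<le> t / ?r\<^sup>2" using le r t by (intro divide_left_mono power_mono mult_pos_pos zero_less_power) auto
      then show "min 1 (t / (norm (x - y))\<^sup>2) \<le> min 1 (t / ?r\<^sup>2)" by (intro min.mono) auto
    qed (use D t in auto)
    finally show ?thesis .
  qed
  have "norm (heat_op t f x) \<le> (\<integral>y. norm (of_real (heat t (x - y)) * f y) \<partial>lborel)"
    unfolding heat_op_def by (rule integral_norm_bound)
  also have "\<dots> \<le> (\<integral>y. (?H * A) * indicator (cball q e) y \<partial>lborel)"
  proof (rule integral_mono_AE')
    show "integrable lborel (\<lambda>y. (?H * A) * indicator (cball q e) y)"
      by (intro integrable_mult_right integrable_real_indicator emeasure_bounded_finite bounded_cball) auto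
    show "AE y in lborel. norm (of_real (heat t (x - y)) * f y) \<le> (?H * A) * indicator (cball q e) y"
    proof (intro AE_I2)
      fix y
      show "norm (of_real (heat t (x - y)) * f y) \<le> (?H * A) * indicator (cball q e) y"
      proof (cases "norm (y - q) \<le> e")
        case True
        have "norm (of_real (heat t (x - y)) * f y) = heat t (x - y) * norm (f y)" by (simp add: norm_mult heat_nonneg)
        also have "\<dots> \<le> ?H * A" using H0 by (intro mult_mono h True A) auto
        finally show ?thesis using True by (simp add: dist_norm norm_minus_commute)
      next
        case False
        then show ?thesis using supp[of y] H0 A by simp
      qed
    qed
    show "AE y in lborel. 0 \<le> (?H * A) * indicator (cball q e) y" by (intro AE_I2 mult_nonneg_nonneg[OF mult_nonneg_nonneg[OF H0 A(1)]]) simp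
  qed
  also have "\<dots> = (?H * A) * measure lborel (cball q e)" by simp
  also have "measure lborel (cball q e) = unit_ball_vol (real CARD('n)) * e ^ CARD('n)"
    using e by (simp add: content_cball)
  finally show ?thesis by (simp add: mult_ac)
qed

text \<open>Write s = 2 k + 2 \<sigma> with k a natural number and 0 \<le> \<sigma> < 1. The even
  part is \<open>Lop ^^ k\<close>, which keeps the support and has size (1 / e) ^ (2 k). For the
  fractional part, points within 2 e use the two increment bounds with length e; farther away the
  function itself vanishes and only its heat tail contributes.\<close>

lemma bessel_mult_bump_bound:
  fixes h :: "'n::finite test"
  assumes h: "smooth_fun h" and s: "s > 0"
  shows "\<exists>C\<ge>0. \<forall>e\<in>{0<..1}. \<forall>x. norm (bessel s (\<lambda>x. h x * bump q e x) x) \<le> C * profile CARD('n) s e (norm (x - q))"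
proof -
  define k where "k = nat \<lfloor>s / 2\<rfloor>"
  define \<sigma> where "\<sigma> = s / 2 - real k"
  have k: "real k = of_int \<lfloor>s / 2\<rfloor>" using s by (simp add: k_def)
  have \<sigma>: "0 \<le> \<sigma>" "\<sigma> < 1" unfolding \<sigma>_def k by linarith+
  have s_eq: "s = 2 * \<sigma> + 2 * real k" by (simp add: \<sigma>_def)
  let ?n = "CARD('n)" and ?V = "unit_ball_vol (real CARD('n))"
  let ?\<psi> = "\<lambda>e x. h x * bump q e x"
  let ?f = "\<lambda>e. (Lop ^^ k) (?\<psi> e)"
  have \<psi>S: "?\<psi> e \<in> schwartz" if "e \<in> {0<..1}" for e using that by (intro schwartz_mult_bump h) auto
  have fam: "\<exists>C\<ge>0. \<forall>e\<in>{0<..1}. \<forall>x. norm ((Lop ^^ j) (?\<psi> e) x) \<le> C * (1 / e) ^ (2 * j)" for j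
    using Lop_pow_mult_bump_family[OF h, of "[]" j q]
    unfolding bdd_by_def split_paired_Ball_Sigma split by simp
  obtain C1 where C1: "C1 \<ge> 0" "\<And>e x. e \<in> {0<..1} \<Longrightarrow> norm (?f e x) \<le> C1 * (1 / e) ^ (2 * k)"
    using fam[of k] by blast
  obtain C2 where C2: "C2 \<ge> 0" "\<And>e x. e \<in> {0<..1} \<Longrightarrow> norm (Lop (?f e) x) \<le> C2 * (1 / e) ^ (2 * Suc k)"
    using fam[of "Suc k"] by (simp only: funpow.simps(2) comp_apply) blast
  define C where "C = C1 + C2"
  have C0: "C \<ge> 0" using C1 C2 by (simp add: C_def)
  have fb: "norm (?f e x) \<le> C * (1 / e) ^ (2 * k)" if "e \<in> {0<..1}" for e x
  proof -
    have "C1 * (1 / e) ^ (2 * k) \<le> C * (1 / e) ^ (2 * k)"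
      using C2(1) that by (intro mult_right_mono) (auto simp: C_def)
    with C1(2)[OF that, of x] show ?thesis by (rule order_trans)
  qed
  have Lfb: "norm (Lop (?f e) x) \<le> C * (1 / e) ^ (2 * k) * (1 / e\<^sup>2)" if "e \<in> {0<..1}" for e x
  proof -
    have "C2 * (1 / e) ^ (2 * Suc k) \<le> C * (1 / e) ^ (2 * Suc k)"
      using C1(1) that by (intro mult_right_mono) (auto simp: C_def)
    with C2(2)[OF that, of x] have "norm (Lop (?f e) x) \<le> C * (1 / e) ^ (2 * Suc k)" by (rule order_trans)
    also have "(1 / e) ^ (2 * Suc k) = (1 / e) ^ (2 * k) * (1 / e\<^sup>2)"
      by (simp add: power_divide power2_eq_square)
    finally show ?thesis by (simp only: mult.assoc)
  qed
  have fsupp: "?f e x = 0" if "e \<in> {0<..1}" "norm (x - q) > e" for e x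
    by (rule Lop_pow_eq_0_open[OF open_norm_greater[of e q]]) (use that mult_bump_eq_0 in auto)
  have bess: "bessel s (?\<psi> e) = bessel (2 * \<sigma>) (?f e)" if "e \<in> {0<..1}" for e
    unfolding s_eq bessel_bessel[OF \<psi>S[OF that], symmetric] bessel_even_nat[OF \<psi>S[OF that]] ..
  \<comment> \<open>The dimension count: 2 k derivatives and 2 \<sigma> fractional ones at scale e
    add up to order s.\<close>
  have pw: "(1 / e) ^ (2 * k) * (1 / e\<^sup>2) powr \<sigma> = e powr (- s)" if "e > 0" for e :: real
  proof -
    have "(1 / e) ^ (2 * k) = e powr (- (2 * real k))" using that by (simp add: powr_minus powr_realpow[symmetric] power_one_over inverse_eq_divide)
    moreover have "(1 / e\<^sup>2) powr \<sigma> = e powr (- (2 * \<sigma>))"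
    proof -
      have "(1 / e\<^sup>2) = e powr (- 2)" using that by (simp add: powr_minus inverse_eq_divide)
      then show ?thesis by (simp only: powr_powr) simp
    qed
    ultimately show ?thesis using that by (simp add: powr_add[symmetric] s_eq add.commute)
  qed
  show ?thesis
  \<comment> \<open>An even integer order is local and leaves no tail; the integral formula for
    fractional powers requires \<sigma> > 0.\<close>
  proof (cases "\<sigma> = 0")
    case True
    have "norm (bessel s (?\<psi> e) x) \<le> C * profile ?n s e (norm (x - q))" if e: "e \<in> {0<..1}" for e x
    proof -
      have b: "bessel s (?\<psi> e) x = ?f e x" unfolding bess[OF e] True by (simp add: bessel_0 schwartz_Lop_pow \<psi>S[OF e])
      show ?thesis
      proof (cases "norm (x - q) \<le> e")
        case le: True
        then show ?thesis using fb[OF e, of x] pw[of e] True e unfolding b by (simp add: profile_def max_def)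
      next
        case False
        then show ?thesis using fsupp[OF e, of x] C0 e unfolding b by (simp add: profile_def)
      qed
    qed
    then show ?thesis using C0 by blast
  next
    case False
    with \<sigma> have \<sigma>': "0 < \<sigma>" "\<sigma> < 1" by auto
    obtain D where D: "D \<ge> 0" "\<And>t z::real^'n. t > 0 \<Longrightarrow> z \<noteq> 0 \<Longrightarrow> heat t z \<le> D * norm z powr (- real ?n) * min 1 (t / (norm z)\<^sup>2)"
      using heat_decay[where 'n = 'n] by metis
    define W where "W = weight_min \<sigma> / weight_exp \<sigma>"
    have W: "W \<ge> 0" unfolding W_def using weight_exp_pos[OF \<sigma>'] weight_min_nonneg by (intro divide_nonneg_nonneg) auto
    \<comment> \<open>The two summands are the near and the far constant. The factor 2^n compensates
      max e |x - q| \<le> 2 e in the near region and the halved distance in the far one.\<close>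
    define K where "K = 2 ^ ?n * (2 * C * W + C * ?V * D * W)"
    have K0: "K \<ge> 0" unfolding K_def using C0 W D by (intro mult_nonneg_nonneg add_nonneg_nonneg) auto
    have "norm (bessel s (?\<psi> e) x) \<le> K * profile ?n s e (norm (x - q))" if e: "e \<in> {0<..1}" for e x
    proof -
      let ?A = "C * (1 / e) ^ (2 * k)" and ?r = "norm (x - q)"
      have e0: "e > 0" using e by simp
      have A0: "?A \<ge> 0" using C0 e by simp
      have fS: "?f e \<in> schwartz" by (intro schwartz_Lop_pow \<psi>S e)
      show ?thesis
      proof (cases "?r < 2 * e")
        case True
        have "norm (bessel (2 * \<sigma>) (?f e) x) \<le> (2 * ?A) * (1 / e\<^sup>2) powr \<sigma> * W"
          unfolding W_def
        proof (rule bessel_fractional_bound[OF fS \<sigma>'])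
          fix t :: real assume t: "t > 0"
          have 1: "norm (?f e x - of_real (exp (- t)) * heat_op t (?f e) x) \<le> 2 * ?A"
            by (rule norm_minus_heat_le_sup[OF fS fb[OF e] t])
          have 2: "norm (?f e x - of_real (exp (- t)) * heat_op t (?f e) x) \<le> ?A * (1 / e\<^sup>2 * t)"
            using norm_minus_heat_le_Lop[OF fS Lfb[OF e] t, of x] by (simp add: mult_ac)
          also have "\<dots> \<le> 2 * ?A * (1 / e\<^sup>2 * t)" using A0 t by (intro mult_right_mono) auto
          finally have 3: "norm (?f e x - of_real (exp (- t)) * heat_op t (?f e) x) \<le> 2 * ?A * (1 / e\<^sup>2 * t)" .
          show "norm (?f e x - of_real (exp (- t)) * heat_op t (?f e) x) \<le> (2 * ?A) * min 1 (1 / e\<^sup>2 * t)"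
            using 1 3 by (cases "1 \<le> 1 / e\<^sup>2 * t") (simp_all only: min_def if_True if_False mult_1_right)
        qed (use e A0 in auto)
        also have "\<dots> = 2 * C * W * ((1 / e) ^ (2 * k) * (1 / e\<^sup>2) powr \<sigma>)" by (simp only: mult_ac)
        also have "\<dots> = 2 * C * W * e powr (- s)" by (simp only: pw[OF e0])
        also have "\<dots> \<le> (2 * C * W * e powr (- s)) * (2 ^ ?n * (e / max e ?r) ^ ?n)"
        proof -
          have mx: "0 < max e ?r" "max e ?r \<le> 2 * e" using e0 True by auto
          have "1 \<le> 2 * e / max e ?r" using mx by (simp only: pos_le_divide_eq mult_1)
          then have "1 \<le> (2 * e / max e ?r) ^ ?n" by (rule one_le_power)
          then have "1 \<le> 2 ^ ?n * (e / max e ?r) ^ ?n" by (simp only: power_mult_distrib times_divide_eq_right[symmetric])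
          from mult_left_mono[OF this, of "2 * C * W * e powr (- s)"] show ?thesis using C0 W by simp
        qed
        also have "\<dots> = (2 ^ ?n * (2 * C * W)) * profile ?n s e ?r" by (simp add: profile_def mult_ac)
        also have "\<dots> \<le> K * profile ?n s e ?r"
          unfolding K_def profile_def using C0 W D e0 by (intro mult_right_mono mult_left_mono) (auto intro!: mult_nonneg_nonneg)
        finally show ?thesis unfolding bess[OF e] .
      next
        case False
        then have far: "?r \<ge> 2 * e" by simp
        have r0: "?r > 0" using far e0 by linarith
        have fx: "?f e x = 0" using far e0 by (intro fsupp e) linarith
        let ?G = "?A * (?V * e ^ ?n) * D * (?r / 2) powr (- real ?n)"
        have "norm (bessel (2 * \<sigma>) (?f e) x) \<le> ?G * (1 / (?r / 2)\<^sup>2) powr \<sigma> * W"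
          unfolding W_def
        proof (rule bessel_fractional_bound[OF fS \<sigma>'])
          fix t :: real assume t: "t > 0"
          have "norm (?f e x - of_real (exp (- t)) * heat_op t (?f e) x) = exp (- t) * norm (heat_op t (?f e) x)"
            unfolding fx by (simp add: norm_mult)
          also have "\<dots> \<le> 1 * norm (heat_op t (?f e) x)" using t by (intro mult_right_mono) auto
          also have "\<dots> \<le> ?G * min 1 (1 / (?r / 2)\<^sup>2 * t)"
            unfolding mult_1 by (rule heat_op_far[OF fS A0 fb[OF e] e0 fsupp[OF e] D far t])
          finally show "norm (?f e x - of_real (exp (- t)) * heat_op t (?f e) x) \<le> ?G * min 1 (1 / (?r / 2)\<^sup>2 * t)" .
        qed (use r0 A0 D e0 in auto)
        \<comment> \<open>The additional decay with exponent -2 \<sigma> in the distance is given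
          up: the power -n alone is p-integrable at infinity, and the bound takes the form of
          \<open>profile\<close>.\<close>
        also have "\<dots> \<le> ?G * (1 / e\<^sup>2) powr \<sigma> * W"
        proof (intro mult_right_mono mult_left_mono powr_mono2)
          show "1 / (?r / 2)\<^sup>2 \<le> 1 / e\<^sup>2" using far e0 r0 by (intro divide_left_mono power_mono mult_pos_pos zero_less_power) auto
        qed (use W A0 D \<sigma>' e0 in auto)
        also have "\<dots> = C * ?V * D * W * (e ^ ?n * (?r / 2) powr (- real ?n)) * ((1 / e) ^ (2 * k) * (1 / e\<^sup>2) powr \<sigma>)"
          by (simp only: mult_ac)
        also have "(?r / 2) powr (- real ?n) = 2 ^ ?n * (1 / ?r ^ ?n)"
          using r0 by (simp add: powr_minus powr_realpow power_divide inverse_eq_divide)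
        also have "C * ?V * D * W * (e ^ ?n * (2 ^ ?n * (1 / ?r ^ ?n))) * ((1 / e) ^ (2 * k) * (1 / e\<^sup>2) powr \<sigma>)
            = (2 ^ ?n * (C * ?V * D * W)) * profile ?n s e ?r"
          unfolding pw[OF e0] profile_def using far e0 by (simp add: max_def power_divide)
        also have "\<dots> \<le> K * profile ?n s e ?r"
          unfolding K_def profile_def using C0 W D e0 by (intro mult_right_mono mult_left_mono) (auto intro!: mult_nonneg_nonneg)
        finally show ?thesis unfolding bess[OF e] .
      qed
    qed
    then show ?thesis using K0 by blast
  qed
qed

section \<open>Averages over dyadic scales\<close>

lemma sum_powers_le_last:
  fixes x :: real assumes "x > 1" shows "(\<Sum>j\<le>m. x ^ j) \<le> x ^ m * (x / (x - 1))"
proof (induction m)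
  case 0
  show ?case using assms by (simp add: field_simps)
next
  case (Suc m)
  have "x ^ m * (x / (x - 1)) + x ^ Suc m = x ^ Suc m * (x / (x - 1))"
    using assms by (simp add: field_simps)
  then show ?case using Suc by simp
qed

lemma sum_powers_le_first:
  fixes y :: real assumes y: "0 < y" "y < 1" and J: "finite J" "\<And>j. j \<in> J \<Longrightarrow> m \<le> j"
  shows "(\<Sum>j\<in>J. y ^ j) \<le> y ^ m * (1 / (1 - y))"
proof -
  have "(\<Sum>j\<in>J. y ^ j) = y ^ m * (\<Sum>j\<in>J. y ^ (j - m))"
    unfolding sum_distrib_left using J(2) by (intro sum.cong refl) (simp flip: power_add)
  also have "(\<Sum>j\<in>J. y ^ (j - m)) = (\<Sum>i\<in>(\<lambda>j. j - m) ` J. y ^ i)"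
    using J(2) by (subst sum.reindex) (auto intro!: inj_on_diff_nat)
  also have "\<dots> \<le> (\<Sum>i. y ^ i)"
    using y J(1) by (intro sum_le_suminf summable_geometric) auto
  also have "\<dots> = 1 / (1 - y)" using y by (intro suminf_geometric) auto
  finally show ?thesis using y by (simp add: mult_left_mono)
qed

lemma profile_nonneg: "e > 0 \<Longrightarrow> profile n s e r \<ge> 0"
  by (simp add: profile_def max_def)

text \<open>The profile increases geometrically in the scale up to r and decreases geometrically
  beyond it, so that a dyadic sum is comparable to its largest term.\<close>

lemma sum_profile_le_max:
  assumes s: "0 < s" "s < real n" and e0: "e0 > 0"
    and B: "\<And>j. j < M \<Longrightarrow> profile n s (e0 * (1/2) ^ j) r \<le> B" and B0: "B \<ge> 0"
  shows "(\<Sum>j<M. profile n s (e0 * (1/2) ^ j) r) \<le>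
    (2 powr s / (2 powr s - 1) + 1 / (1 - (1/2) powr (real n - s))) * B"
proof -
  let ?e = "\<lambda>j::nat. e0 * (1/2) ^ j :: real"
  let ?a = "\<lambda>j. profile n s (?e j) r"
  define J1 where "J1 = {j. j < M \<and> r < ?e j}"
  define J2 where "J2 = {j. j < M \<and> ?e j \<le> r}"
  \<comment> \<open>Halving e multiplies the profile by x = 2 powr s as long as e > r, and by y = 2
    powr (s - n) once e \<le> r. Thus 0 < s < n makes both ranges geometric.\<close>
  define x :: real where "x = 2 powr s"
  define y :: real where "y = (1/2) powr (real n - s)"
  have x: "x > 1" using s by (simp add: x_def)
  have y: "0 < y" "y < 1" using s by (auto simp: y_def powr_less_mono2[of "real n - s" "1/2" 1, simplified])
  have e: "?e j > 0" for j using e0 by simp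
  have es: "?e j powr (- s) = e0 powr (- s) * x ^ j" for j
  proof -
    have "((1/2::real) ^ j) powr (- s) = (2 powr (- real j)) powr (- s)"
      by (simp add: powr_minus powr_realpow power_one_over inverse_eq_divide)
    also have "\<dots> = x ^ j" by (simp add: powr_powr x_def powr_realpow[symmetric] mult.commute)
    finally show ?thesis using e0 by (simp add: powr_mult)
  qed
  have a1: "?a j = e0 powr (- s) * x ^ j" if "j \<in> J1" for j
    using that e[of j] unfolding J1_def profile_def es[symmetric] by (simp add: max_def)
  have a2: "?a j = e0 powr (- s) * (e0 / r) ^ n * y ^ j" if "j \<in> J2" for j
  proof -
    have r: "r > 0" "max (?e j) r = r" using that e[of j] by (auto simp: J2_def max_def)
    have "x ^ j * ((1/2) ^ j) ^ n = y ^ j"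
    proof -
      have "y = x * (1/2) ^ n"
        by (simp add: x_def y_def powr_diff powr_realpow powr_divide power_one_over field_simps)
      then show ?thesis by (simp add: power_mult_distrib power_mult[symmetric] mult.commute)
    qed
    note xy = this
    have A: "(?e j / r) ^ n = (e0 / r) ^ n * ((1/2) ^ j) ^ n"
      by (simp only: times_divide_eq_left[symmetric] power_mult_distrib)
    have "?a j = e0 powr (- s) * (e0 / r) ^ n * (x ^ j * ((1/2) ^ j) ^ n)"
      unfolding profile_def r(2) es A by (simp only: mult_ac)
    then show ?thesis by (simp only: xy)
  qed
  have S1: "(\<Sum>j\<in>J1. ?a j) \<le> x / (x - 1) * B"
  proof (cases "J1 = {}")
    case False
    define m where "m = Max J1"
    have fin: "finite J1" by (simp add: J1_def)
    have m: "m \<in> J1" "\<And>j. j \<in> J1 \<Longrightarrow> j \<le> m" using False fin by (auto simp: m_def)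
    have "(\<Sum>j\<in>J1. ?a j) = e0 powr (- s) * (\<Sum>j\<in>J1. x ^ j)" using a1 by (simp add: sum_distrib_left)
    also have "\<dots> \<le> e0 powr (- s) * (\<Sum>j\<le>m. x ^ j)"
      using m x by (intro mult_left_mono sum_mono2) auto
    also have "\<dots> \<le> e0 powr (- s) * (x ^ m * (x / (x - 1)))"
      by (intro mult_left_mono sum_powers_le_last x) auto
    also have "\<dots> = x / (x - 1) * ?a m" by (simp add: a1[OF m(1)])
    also have "\<dots> \<le> x / (x - 1) * B" using m(1) x by (intro mult_left_mono B) (auto simp: J1_def)
    finally show ?thesis .
  qed (use B0 x in simp)
  have S2: "(\<Sum>j\<in>J2. ?a j) \<le> 1 / (1 - y) * B"
  proof (cases "J2 = {}")
    case False
    define m where "m = Min J2"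
    have fin: "finite J2" by (simp add: J2_def)
    have m: "m \<in> J2" "\<And>j. j \<in> J2 \<Longrightarrow> m \<le> j" using False fin by (auto simp: m_def)
    have r: "r > 0" using m(1) e[of m] by (auto simp: J2_def)
    have "(\<Sum>j\<in>J2. ?a j) = e0 powr (- s) * (e0 / r) ^ n * (\<Sum>j\<in>J2. y ^ j)" using a2 by (simp add: sum_distrib_left)
    also have "\<dots> \<le> e0 powr (- s) * (e0 / r) ^ n * (y ^ m * (1 / (1 - y)))"
      using e0 r by (intro mult_left_mono sum_powers_le_first y fin m) auto
    also have "\<dots> = 1 / (1 - y) * ?a m" by (simp add: a2[OF m(1)])
    also have "\<dots> \<le> 1 / (1 - y) * B" using m(1) y by (intro mult_left_mono B) (auto simp: J2_def)
    finally show ?thesis .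
  qed (use B0 y in simp)
  have "{..<M} = J1 \<union> J2" "J1 \<inter> J2 = {}" "finite J1" "finite J2" by (auto simp: J1_def J2_def)
  then have "(\<Sum>j<M. ?a j) = (\<Sum>j\<in>J1. ?a j) + (\<Sum>j\<in>J2. ?a j)" by (simp add: sum.union_disjoint)
  also have "\<dots> \<le> (x / (x - 1) + 1 / (1 - y)) * B" using S1 S2 by (simp add: ring_distribs)
  finally show ?thesis by (simp only: x_def y_def)
qed

text \<open>The sum is at most a constant times its largest term, whose p-th power is one term on
  the right. The constant does not involve M; plain convexity would lose M powr (p - 1), which is
  exactly the gain sought from averaging.\<close>

lemma sum_profile_powr_le:
  assumes s: "0 < s" "s < real n" and e0: "e0 > 0" and p: "p \<ge> 1"
  shows "(\<Sum>j<M. profile n s (e0 * (1/2) ^ j) r) powr p \<le>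
    (2 powr s / (2 powr s - 1) + 1 / (1 - (1/2) powr (real n - s))) powr p * (\<Sum>j<M. profile n s (e0 * (1/2) ^ j) r powr p)"
proof (cases "M = 0")
  case False
  let ?a = "\<lambda>j. profile n s (e0 * (1/2) ^ j) r"
  let ?c = "2 powr s / (2 powr s - 1) + 1 / (1 - (1/2) powr (real n - s))"
  have a0: "?a j \<ge> 0" for j using e0 by (intro profile_nonneg) auto
  have c0: "?c \<ge> 0" using s by (intro add_nonneg_nonneg divide_nonneg_nonneg) (auto simp: powr_le1 intro!: powr_le1 less_imp_le)
  define B where "B = Max (?a ` {..<M})"
  have "B \<in> ?a ` {..<M}" unfolding B_def using False by (intro Max_in) auto
  then obtain i where i: "i < M" "B = ?a i" by auto
  have B: "?a j \<le> B" if "j < M" for j unfolding B_def using that by (intro Max_ge) auto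
  have "(\<Sum>j<M. ?a j) powr p \<le> (?c * B) powr p"
    using sum_profile_le_max[OF s e0 B] a0 i p by (intro powr_mono2 sum_nonneg) auto
  also have "\<dots> = ?c powr p * ?a i powr p" using c0 a0 i by (simp add: powr_mult)
  also have "\<dots> \<le> ?c powr p * (\<Sum>j<M. ?a j powr p)"
    using i by (intro mult_left_mono member_le_sum) auto
  finally show ?thesis .
qed (use p in simp)

text \<open>Scale invariance at the critical order: with x = q + e y the Jacobian e^n cancels (e
  powr (- s)) powr p = e powr (- n). What remains is max 1 |y| to the power - n p, integrable
  because p > 1.\<close>

lemma nn_integral_profile:
  assumes p: "p > 1" and s: "s = real CARD('n::finite) / p"
  shows "\<exists>K\<ge>0. \<forall>e>0. \<forall>q::real^'n. (\<integral>\<^sup>+x. ennreal (profile CARD('n) s e (norm (x - q)) powr p) \<partial>lborel) \<le> ennreal K"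
proof -
  let ?n = "CARD('n)"
  let ?w = "\<lambda>y::real^'n. ((1 / max 1 (norm y)) ^ ?n) powr p"
  define b where "b = real ?n * p / 2"
  have b: "b > real ?n / 2" using p by (simp add: b_def)
  have w: "?w y \<le> 2 powr b * lam y powr (- b)" for y
  proof -
    have m: "max 1 (norm y) \<ge> 1" by simp
    have "lam y / 2 \<le> (max 1 (norm y))\<^sup>2"
      by (auto simp: max_def power2_eq_square intro: order_trans[OF _ mult_mono[of 1 "norm y" 1 "norm y"]] mult_le_one)
    then have "((max 1 (norm y))\<^sup>2) powr (- b) \<le> (lam y / 2) powr (- b)"
      using lam_pos[of y] b by (intro powr_mono2') auto
    moreover have "?w y = ((max 1 (norm y))\<^sup>2) powr (- b)"
    proof -
      have "(1 / max 1 (norm y)) ^ ?n = max 1 (norm y) powr (- real ?n)"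
        using m by (simp add: powr_minus powr_realpow power_one_over inverse_eq_divide)
      then have "?w y = max 1 (norm y) powr (2 * (- b))" by (simp add: powr_powr b_def)
      also have "\<dots> = (max 1 (norm y) powr 2) powr (- b)" by (simp only: powr_powr)
      also have "max 1 (norm y) powr 2 = (max 1 (norm y))\<^sup>2" using m by (intro powr_numeral) linarith
      finally show ?thesis .
    qed
    moreover have "(lam y / 2) powr (- b) = 2 powr b * lam y powr (- b)"
      using lam_pos[of y] by (simp add: powr_divide powr_minus field_simps)
    ultimately show ?thesis by simp
  qed
  have "(\<integral>\<^sup>+y. ennreal (?w y) \<partial>lborel) \<le> (\<integral>\<^sup>+y. ennreal (2 powr b) * ennreal (lam (y::real^'n) powr (- b)) \<partial>lborel)"
    using w by (intro nn_integral_mono) (simp add: ennreal_mult'[symmetric] ennreal_leI)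
  also have "\<dots> = ennreal (2 powr b) * (\<integral>\<^sup>+y. ennreal (lam (y::real^'n) powr (- b)) \<partial>lborel)"
    by (rule nn_integral_cmult) measurable
  also have "\<dots> < \<infinity>" using nn_integral_lam_powr[OF b] by (simp add: ennreal_mult_less_top)
  finally have fin: "(\<integral>\<^sup>+y. ennreal (?w y) \<partial>lborel) < \<infinity>" .
  define K where "K = enn2real (\<integral>\<^sup>+y. ennreal (?w y) \<partial>lborel)"
  have K: "ennreal K = (\<integral>\<^sup>+y. ennreal (?w y) \<partial>lborel)" unfolding K_def using fin by (simp add: less_top)
  have "(\<integral>\<^sup>+x. ennreal (profile ?n s e (norm (x - q)) powr p) \<partial>lborel) \<le> ennreal K" if e: "e > 0" for e and q :: "real^'n"
  proof -
    have "(\<integral>\<^sup>+x. ennreal (profile ?n s e (norm (x - q)) powr p) \<partial>lborel) =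
       ennreal (\<bar>e\<bar> ^ ?n) * (\<integral>\<^sup>+y. ennreal (profile ?n s e (norm ((q + e *\<^sub>R y) - q)) powr p) \<partial>lborel)"
      using e unfolding profile_def by (intro nn_integral_lborel_affine) auto
    also have "\<dots> = ennreal (\<bar>e\<bar> ^ ?n) * (\<integral>\<^sup>+y. ennreal (e powr (- real ?n)) * ennreal (?w y) \<partial>lborel)"
    proof (intro arg_cong2[where f = "(*)"] refl nn_integral_cong)
      fix y :: "real^'n"
      have "max e (norm ((q + e *\<^sub>R y) - q)) = e * max 1 (norm y)" using e by (simp add: max_def)
      then have "profile ?n s e (norm ((q + e *\<^sub>R y) - q)) = e powr (- s) * (1 / max 1 (norm y)) ^ ?n"
        using e by (simp only: profile_def) simp
      then have "profile ?n s e (norm ((q + e *\<^sub>R y) - q)) powr p = (e powr (- s)) powr p * ?w y"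
        by (simp only: powr_mult powr_ge_zero)
      also have "(e powr (- s)) powr p = e powr (- real ?n)" using p by (simp add: powr_powr s)
      finally show "ennreal (profile ?n s e (norm ((q + e *\<^sub>R y) - q)) powr p) = ennreal (e powr (- real ?n)) * ennreal (?w y)"
        by (simp only: ennreal_mult' powr_ge_zero)
    qed
    also have "\<dots> = ennreal (\<bar>e\<bar> ^ ?n) * (ennreal (e powr (- real ?n)) * ennreal K)"
      unfolding K by (intro arg_cong2[where f = "(*)"] refl nn_integral_cmult) measurable
    also have "\<dots> = ennreal (e ^ ?n * e powr (- real ?n)) * ennreal K" using e by (simp add: ennreal_mult' mult.assoc)
    also have "e ^ ?n * e powr (- real ?n) = 1" using e by (simp add: powr_minus powr_realpow)
    finally show ?thesis by simp
  qed
  moreover have "K \<ge> 0" by (simp add: K_def)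
  ultimately show ?thesis by blast
qed

lemma bessel_sum:
  assumes "\<And>a. a \<in> I \<Longrightarrow> F a \<in> schwartz"
  shows "bessel s (\<lambda>x. \<Sum>a\<in>I. F a x) = (\<lambda>x. \<Sum>a\<in>I. bessel s (F a) x)"
  using assms
proof (induction I rule: infinite_finite_induct)
  case (insert a I)
  then show ?case by (simp add: bessel_add schwartz_sum)
next
  case empty
  show ?case using bessel_cmult[of s 0 "\<lambda>x. 0"] by simp
next
  case (infinite I)
  then show ?case using bessel_cmult[of s 0 "\<lambda>x. 0"] by simp
qed

text \<open>A bump at scale e has bounded norm at the critical order and its potential lives at
  distance about e from q; averaging M of them over separated scales gains a factor
  M powr (1 - p) in the p-th power of the norm.\<close>

lemma cheap_cutoff:
  fixes h :: "'n::finite test"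
  assumes p: "p > 1" and h: "smooth_fun h" and h1: "\<And>x. norm (h x) \<le> 1" and \<eta>: "\<eta> > 0"
  obtains \<theta> :: "real^'n \<Rightarrow> real" and \<delta> where "smooth_fun (\<lambda>x. of_real (\<theta> x))" "\<And>x. 0 \<le> \<theta> x" "\<And>x. \<theta> x \<le> 1"
    "\<delta> > 0" "\<And>x. norm (x - q) < \<delta> \<Longrightarrow> \<theta> x = 1" "(\<lambda>x. h x * of_real (\<theta> x)) \<in> schwartz"
    "(\<integral>x. norm (h x * of_real (\<theta> x)) \<partial>lborel) \<le> \<eta>"
    "(\<integral>x. norm (bessel (real CARD('n) / p) (\<lambda>x. h x * of_real (\<theta> x)) x) powr p \<partial>lborel) \<le> \<eta>"
proof -
  let ?n = "CARD('n)" and ?V = "unit_ball_vol (real CARD('n))"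
  define s where "s = real ?n / p"
  have s: "0 < s" "s < real ?n" using p by (auto simp: s_def divide_simps)
  obtain C where C: "C \<ge> 0" "\<And>e x. e \<in> {0<..1} \<Longrightarrow> norm (bessel s (\<lambda>x. h x * bump q e x) x) \<le> C * profile ?n s e (norm (x - q))"
    using bessel_mult_bump_bound[OF h s(1), of q] by blast
  obtain K where K: "K \<ge> 0" "\<And>e q. e > 0 \<Longrightarrow> (\<integral>\<^sup>+x. ennreal (profile ?n s e (norm (x - (q::real^'n))) powr p) \<partial>lborel) \<le> ennreal K"
    using nn_integral_profile[OF p s_def] by blast
  \<comment> \<open>The cutoff will live in the ball of radius e0. As e0 \<le> 1, the volume V *
    e0^n is at most V * e0, hence at most \<open>\<eta>\<close>: this is the L1 bound.\<close>
  define e0 where "e0 = min 1 (\<eta> / (?V + 1))"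
  have V: "?V \<ge> 0" by simp
  have e0: "0 < e0" "e0 \<le> 1" using \<eta> V by (auto simp: e0_def intro!: divide_pos_pos add_nonneg_pos)
  have Ve0: "?V * e0 ^ ?n \<le> \<eta>"
  proof -
    have "e0 ^ ?n \<le> e0 ^ 1" using e0 by (intro power_decreasing) auto
    then have "?V * e0 ^ ?n \<le> ?V * e0" using V by (intro mult_left_mono) auto
    also have "\<dots> \<le> (?V + 1) * (\<eta> / (?V + 1))"
      using V e0 by (intro mult_mono) (auto simp: e0_def)
    also have "\<dots> = \<eta>" using V by (simp add: add_nonneg_eq_0_iff)
    finally show ?thesis .
  qed
  let ?c = "2 powr s / (2 powr s - 1) + 1 / (1 - (1/2) powr (real ?n - s))"
  define D where "D = C powr p * ?c powr p * K"
  have D0: "D \<ge> 0" using K by (simp add: D_def)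
  \<comment> \<open>All constants that depend on h have entered D by now, so M may be chosen as
    large as they require.\<close>
  obtain M :: nat where M: "M > 0" "D * real M powr (1 - p) \<le> \<eta>"
  proof -
    have "((\<lambda>M. D * real M powr (1 - p)) \<longlongrightarrow> D * 0) sequentially"
      using p by (intro tendsto_mult tendsto_const tendsto_neg_powr[OF _ filterlim_real_sequentially]) auto
    then have "eventually (\<lambda>M. D * real M powr (1 - p) < \<eta>) sequentially"
      using \<eta> by (intro order_tendstoD(2)) auto
    from eventually_conj[OF this eventually_gt_at_top[of 0]] show ?thesis
      using that by (auto simp: eventually_sequentially intro: less_imp_le)
  qed
  let ?e = "\<lambda>j::nat. e0 * (1/2) ^ j :: real"
  have e: "?e j \<in> {0<..1}" "?e j \<le> e0" for j
    using e0 mult_mono[of e0 1 "(1/2) ^ j" 1] mult_left_mono[of "(1/2)^j" 1 e0] by (auto simp: power_le_one)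
  have epos: "?e j > 0" for j using e0 by simp
  define b where "b j x = bump_real ((1 / ?e j) *\<^sub>R (x - q))" for j and x :: "real^'n"
  have b: "bump q (?e j) x = of_real (b j x)" for j x by (simp add: bump_def b_def)
  have b01: "0 \<le> b j x" "b j x \<le> 1" for j x unfolding b_def by (rule bump_real_range)+
  define \<theta> where "\<theta> x = (\<Sum>j<M. b j x) / real M" for x
  have \<theta>: "0 \<le> \<theta> x" "\<theta> x \<le> 1" for x
  proof -
    show "0 \<le> \<theta> x" unfolding \<theta>_def using b01 by (intro divide_nonneg_nonneg sum_nonneg) auto
    have "(\<Sum>j<M. b j x) \<le> (\<Sum>j<M. 1)" using b01 by (intro sum_mono) auto
    then show "\<theta> x \<le> 1" unfolding \<theta>_def using M by (simp add: divide_le_eq)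
  qed
  have \<theta>_eq: "complex_of_real (\<theta> x) = of_real (1 / real M) * (\<Sum>j<M. bump q (?e j) x)" for x
    unfolding \<theta>_def b by (simp add: divide_inverse mult.commute)
  have h\<theta>: "h x * of_real (\<theta> x) = of_real (1 / real M) * (\<Sum>j<M. h x * bump q (?e j) x)" for x
    unfolding \<theta>_eq by (simp add: sum_distrib_left mult_ac)
  have S: "(\<lambda>x. h x * bump q (?e j) x) \<in> schwartz" for j using e0 by (intro schwartz_mult_bump h) auto
  have h\<theta>S: "(\<lambda>x. h x * of_real (\<theta> x)) \<in> schwartz"
    unfolding h\<theta> by (intro schwartz_cmult schwartz_sum S)
  have 1: "smooth_fun (\<lambda>x. of_real (\<theta> x))"
    unfolding \<theta>_eq by (intro smooth_fun_cmult smooth_fun_sum smooth_fun_bump)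
  \<comment> \<open>Each bump equals 1 up to half its radius, and the scale of index M is smaller
    than all the M scales in use.\<close>
  define \<delta> where "\<delta> = ?e M / 2"
  have \<delta>: "\<delta> > 0" using e0 by (simp add: \<delta>_def)
  have 2: "\<theta> x = 1" if x: "norm (x - q) < \<delta>" for x
  proof -
    have "b j x = 1" if "j < M" for j
    proof -
      have "?e M \<le> ?e j" using that e0 by (intro mult_left_mono power_decreasing) auto
      then have "bump q (?e j) x = 1" using x epos[of j] by (intro bump_eq_1) (auto simp: \<delta>_def)
      then show ?thesis unfolding b by simp
    qed
    then show ?thesis unfolding \<theta>_def using M by simp
  qed
  have z: "\<theta> x = 0" if "norm (x - q) > e0" for x
  proof -
    have "bump q (?e j) x = 0" for j using that e(2)[of j] epos[of j] by (intro bump_eq_0) auto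
    then show ?thesis unfolding \<theta>_def b by simp
  qed
  have 3: "(\<integral>x. norm (h x * of_real (\<theta> x)) \<partial>lborel) \<le> \<eta>"
  proof -
    have "(\<integral>x. norm (h x * of_real (\<theta> x)) \<partial>lborel) \<le> (\<integral>x. indicator (cball q e0) x \<partial>lborel)"
    proof (rule integral_mono)
      show "integrable lborel (\<lambda>x. norm (h x * of_real (\<theta> x)))" by (intro integrable_norm schwartz_integrable h\<theta>S)
      show "integrable lborel (indicator (cball q e0) :: real^'n \<Rightarrow> real)"
        by (intro integrable_real_indicator emeasure_bounded_finite bounded_cball) auto
      fix x
      show "norm (h x * of_real (\<theta> x)) \<le> indicator (cball q e0) x"
      proof (cases "norm (x - q) > e0")
        case False
        have "norm (h x) * \<theta> x \<le> 1 * 1" using h1 \<theta> by (intro mult_mono) auto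
        then show ?thesis using False \<theta> by (simp add: norm_mult dist_norm norm_minus_commute)
      qed (simp add: z)
    qed
    also have "\<dots> = ?V * e0 ^ ?n" using e0 by (simp add: content_cball)
    finally show ?thesis using Ve0 by simp
  qed
  let ?J = "bessel s (\<lambda>x. h x * of_real (\<theta> x))"
  let ?a = "\<lambda>j x. profile ?n s (?e j) (norm (x - q))"
  have a0: "?a j x \<ge> 0" for j x by (intro profile_nonneg epos)
  have J: "norm (?J x) powr p \<le> (C / real M) powr p * (?c powr p * (\<Sum>j<M. ?a j x powr p))" for x
  proof -
    have "norm (?J x) \<le> (1 / real M) * (\<Sum>j<M. norm (bessel s (\<lambda>x. h x * bump q (?e j) x) x))"
      unfolding h\<theta> bessel_cmult bessel_sum[OF S] norm_mult norm_of_real by (intro mult_mono norm_sum) auto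
    also have "\<dots> \<le> (1 / real M) * (\<Sum>j<M. C * ?a j x)"
      by (intro mult_left_mono sum_mono C e) auto
    also have "\<dots> = (C / real M) * (\<Sum>j<M. ?a j x)" by (simp add: sum_distrib_left)
    finally have "norm (?J x) powr p \<le> ((C / real M) * (\<Sum>j<M. ?a j x)) powr p"
      using p by (intro powr_mono2) auto
    also have "\<dots> = (C / real M) powr p * (\<Sum>j<M. ?a j x) powr p"
      by (rule powr_mult)
    also have "\<dots> \<le> (C / real M) powr p * (?c powr p * (\<Sum>j<M. ?a j x powr p))"
      using p by (intro mult_left_mono sum_profile_powr_le s e0) auto
    finally show ?thesis .
  qed
  have 4: "(\<integral>x. norm (?J x) powr p \<partial>lborel) \<le> \<eta>"
  proof -
    have "ennreal (\<integral>x. norm (?J x) powr p \<partial>lborel) = (\<integral>\<^sup>+x. ennreal (norm (?J x) powr p) \<partial>lborel)"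
      using p by (intro nn_integral_eq_integral[symmetric] schwartz_powr_integrable schwartz_bessel h\<theta>S) auto
    also have "\<dots> \<le> (\<integral>\<^sup>+x. ennreal ((C / real M) powr p * ?c powr p) * (\<Sum>j<M. ennreal (?a j x powr p)) \<partial>lborel)"
      using J by (intro nn_integral_mono) (simp add: sum_ennreal ennreal_mult'[symmetric] ennreal_leI mult.assoc)
    also have "\<dots> = ennreal ((C / real M) powr p * ?c powr p) * (\<Sum>j<M. (\<integral>\<^sup>+x. ennreal (?a j x powr p) \<partial>lborel))"
      by (subst nn_integral_cmult, unfold profile_def, measurable, subst nn_integral_sum, auto)
    also have "\<dots> \<le> ennreal ((C / real M) powr p * ?c powr p) * (\<Sum>j<M. ennreal K)"
      by (intro mult_left_mono sum_mono K epos) auto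
    also have "\<dots> = ennreal ((C / real M) powr p * ?c powr p * (real M * K))"
      using K by (simp add: ennreal_mult' ennreal_of_nat_eq_real_of_nat)
    \<comment> \<open>The average contributes M powr (- p), and the M scales contribute K
      each.\<close>
    also have "(C / real M) powr p * ?c powr p * (real M * K) = D * real M powr (1 - p)"
      unfolding D_def using C M by (simp add: powr_divide powr_diff)
    finally have "(\<integral>x. norm (?J x) powr p \<partial>lborel) \<le> D * real M powr (1 - p)"
      using D0 by (subst (asm) ennreal_le_iff) auto
    then show ?thesis using M by simp
  qed
  show ?thesis
    by (rule that[OF 1 \<theta> \<delta> 2 h\<theta>S 3 4[unfolded s_def]])
qed

section \<open>The critical order\<close>

text \<open>Discrete Jensen with weights of total at most 1: the constant term of the tangent
  inequality is nonnegative, so a deficit in the weights only helps. Finite partial sums of a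
  geometric weight are of this kind.\<close>

lemma sum_weighted_powr_le:
  fixes w y :: "'a \<Rightarrow> real"
  assumes fin: "finite I" and w: "\<And>i. i \<in> I \<Longrightarrow> w i \<ge> 0" "sum w I \<le> 1" and y: "\<And>i. i \<in> I \<Longrightarrow> y i \<ge> 0" and p: "p > 1"
  shows "(\<Sum>i\<in>I. w i * y i) powr p \<le> (\<Sum>i\<in>I. w i * y i powr p)"
proof -
  define m where "m = (\<Sum>i\<in>I. w i * y i)"
  have m0: "m \<ge> 0" unfolding m_def using w y by (intro sum_nonneg) auto
  show ?thesis
  proof (cases "m = 0")
    case True
    then show ?thesis unfolding m_def[symmetric] using w by (auto intro!: sum_nonneg)
  next
    case False
    with m0 have m: "m > 0" by simp
    have "p * m powr p = p * m powr (p - 1) * m" using m by (simp add: powr_diff)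
    also have "\<dots> = (\<Sum>i\<in>I. w i * (p * (y i * m powr (p - 1))))"
      unfolding m_def[symmetric] by (subst (2) m_def) (simp add: sum_distrib_left mult_ac)
    also have "\<dots> \<le> (\<Sum>i\<in>I. w i * (y i powr p + (p - 1) * m powr p))"
      using w y m p by (intro sum_mono mult_left_mono powr_tangent) auto
    also have "\<dots> = (\<Sum>i\<in>I. w i * y i powr p) + sum w I * ((p - 1) * m powr p)"
      by (simp only: distrib_left sum.distrib sum_distrib_right)
    also have "\<dots> \<le> (\<Sum>i\<in>I. w i * y i powr p) + 1 * ((p - 1) * m powr p)"
      using w p by (intro add_left_mono mult_right_mono) auto
    finally show ?thesis unfolding m_def[symmetric] by (simp add: algebra_simps)
  qed
qed

lemma add_powr_le:
  fixes a b p :: real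
  assumes "a \<ge> 0" "b \<ge> 0" "p \<ge> 0"
  shows "(a + b) powr p \<le> 2 powr p * (a powr p + b powr p)"
proof -
  have "(a + b) powr p \<le> (2 * max a b) powr p" using assms by (intro powr_mono2) auto
  also have "\<dots> = 2 powr p * max a b powr p" using assms by (intro powr_mult)
  also have "\<dots> \<le> 2 powr p * (a powr p + b powr p)" using assms by (intro mult_left_mono) (auto simp: max_def)
  finally show ?thesis .
qed

text \<open>Jensen's inequality with the weights w j = (1/2) ^ Suc j replaces the Minkowski inequality:
  the p-th power of the sum of the norms of the b j is dominated by the integrable
  function with summands w j powr (1 - p) * norm (b j x) powr p.\<close>

lemma Lp_series:
  fixes b :: "nat \<Rightarrow> 'n::finite test"
  assumes p: "p > 1" and [measurable]: "\<And>j. b j \<in> borel_measurable borel" "g0 \<in> borel_measurable borel"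
    and int: "\<And>j. integrable lborel (\<lambda>x. norm (b j x) powr p)"
    and b: "\<And>j. (\<integral>x. norm (b j x) powr p \<partial>lborel) \<le> ((1/2) ^ Suc j) powr p"
    and g0: "integrable lborel (\<lambda>x. norm (g0 x) powr p)"
    and \<phi>: "\<phi> \<in> schwartz"
  defines "g \<equiv> \<lambda>x. g0 x - (\<Sum>j. b j x)"
  shows "g \<in> borel_measurable borel" and "integrable lborel (\<lambda>x. norm (g x) powr p)"
    and "integrable lborel (\<lambda>x. g0 x * \<phi> x) \<Longrightarrow>
      (\<lambda>N. \<integral>x. (g0 x - (\<Sum>j<N. b j x)) * \<phi> x \<partial>lborel) \<longlonglongrightarrow> (\<integral>x. g x * \<phi> x \<partial>lborel)"
proof -
  define w :: "nat \<Rightarrow> real" where "w j = (1/2) ^ Suc j" for j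
  have w0: "w j > 0" for j by (simp add: w_def)
  have ws: "w sums 1" unfolding w_def[abs_def] by (rule power_half_series)
  have wN: "sum w {..<N} \<le> 1" for N
    using sum_le_suminf[OF sums_summable[OF ws], of "{..<N}"] w0 sums_unique[OF ws] by (auto intro: less_imp_le)
  define c where "c j x = w j powr (1 - p) * norm (b j x) powr p" for j x
  have c0: "c j x \<ge> 0" for j x by (simp add: c_def)
  have [measurable]: "c j \<in> borel_measurable borel" for j unfolding c_def[abs_def] by measurable
  \<comment> \<open>The majorant is first formed in the extended reals, where its integral can be
    bounded before anything is known about pointwise convergence.\<close>
  let ?E = "\<lambda>x. \<Sum>j. ennreal (c j x)"
  have "(\<integral>\<^sup>+x. ennreal (c j x) \<partial>lborel) \<le> ennreal (w j)" for j
  proof -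
    have "(\<integral>\<^sup>+x. ennreal (c j x) \<partial>lborel) = ennreal (\<integral>x. c j x \<partial>lborel)"
      using int[of j] c0 by (intro nn_integral_eq_integral) (auto simp: c_def)
    also have "(\<integral>x. c j x \<partial>lborel) \<le> w j powr (1 - p) * w j powr p"
      using b[of j] unfolding c_def w_def[symmetric] by (simp add: mult_left_mono)
    also have "\<dots> = w j" using w0[of j] by (simp add: powr_add[symmetric])
    finally show ?thesis by (simp add: ennreal_leI)
  qed
  then have "(\<Sum>j. \<integral>\<^sup>+x. ennreal (c j x) \<partial>lborel) \<le> (\<Sum>j. ennreal (w j))" by (intro suminf_le) auto
  also have "\<dots> = ennreal 1" using ws w0 by (intro suminf_ennreal_eq) (auto intro: less_imp_le)
  finally have E1: "(\<integral>\<^sup>+x. ?E x \<partial>lborel) \<le> 1" by (subst nn_integral_suminf) auto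
  then have Efin: "(\<integral>\<^sup>+x. ?E x \<partial>lborel) < \<infinity>" by (rule order.strict_trans1) simp
  \<comment> \<open>Off this null set the series converges absolutely. On it the value of the
    infinite sum in g is not controlled, which does not affect any integral.\<close>
  have AEfin: "AE x in lborel. ?E x \<noteq> \<infinity>"
    using Efin by (intro nn_integral_PInf_AE) auto
  have sumb: "(\<Sum>j<N. norm (b j x)) powr p \<le> (\<Sum>j<N. c j x)" for N x
  proof -
    have "(\<Sum>j<N. w j * (norm (b j x) / w j)) powr p \<le> (\<Sum>j<N. w j * (norm (b j x) / w j) powr p)"
      using w0 wN by (intro sum_weighted_powr_le p) (auto simp: less_imp_le)
    moreover have "w j * (norm (b j x) / w j) = norm (b j x)" for j using w0[of j] by simp
    moreover have "w j * (norm (b j x) / w j) powr p = c j x" for j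
      using w0[of j] by (simp add: c_def powr_divide powr_diff)
    ultimately show ?thesis by simp
  qed
  \<comment> \<open>The bound on the p-th power makes g an Lp function. The bound by 1 + E, uniform
    in the number of terms, is the majorant for the pairings with \<phi>.\<close>
  have key: "summable (\<lambda>j. norm (b j x)) \<and> (\<Sum>j. norm (b j x)) powr p \<le> enn2real (?E x) \<and> (\<forall>N. (\<Sum>j<N. norm (b j x)) \<le> 1 + enn2real (?E x))"
    if fin: "?E x \<noteq> \<infinity>" for x
  proof -
    have sc: "summable (\<lambda>j. c j x)" using fin c0 by (intro summable_suminf_not_top) auto
    have E: "enn2real (?E x) = (\<Sum>j. c j x)"
      using suminf_ennreal2[OF c0 sc] c0 by (simp add: suminf_nonneg sc)
    have le: "(\<Sum>j<N. norm (b j x)) powr p \<le> enn2real (?E x)" for N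
      unfolding E by (rule order_trans[OF sumb sum_le_suminf[OF sc]]) (auto simp: c0)
    have le1: "(\<Sum>j<N. norm (b j x)) \<le> 1 + enn2real (?E x)" for N
    proof -
      have "(\<Sum>j<N. norm (b j x)) \<ge> 0" by (intro sum_nonneg) auto
      from le_one_plus_powr[OF this, of p] le[of N] p show ?thesis by linarith
    qed
    have sb: "summable (\<lambda>j. norm (b j x))"
      by (rule summableI_nonneg_bounded[OF _ le1]) auto
    have "(\<lambda>N. (\<Sum>j<N. norm (b j x)) powr p) \<longlonglongrightarrow> (\<Sum>j. norm (b j x)) powr p"
      using p by (intro tendsto_powr' summable_LIMSEQ sb tendsto_const) (auto intro!: sum_nonneg always_eventually)
    then have "(\<Sum>j. norm (b j x)) powr p \<le> enn2real (?E x)"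
      by (rule LIMSEQ_le_const2) (use le in blast)
    with sb le1 show ?thesis by blast
  qed
  show gm [measurable]: "g \<in> borel_measurable borel" unfolding g_def by measurable
  show "integrable lborel (\<lambda>x. norm (g x) powr p)"
  proof (rule integrableI_bounded)
    have "(\<integral>\<^sup>+x. ennreal (norm (norm (g x) powr p)) \<partial>lborel) \<le> (\<integral>\<^sup>+x. ennreal (2 powr p) * (ennreal (norm (g0 x) powr p) + ?E x) \<partial>lborel)"
    proof (rule nn_integral_mono_AE)
      show "AE x in lborel. ennreal (norm (norm (g x) powr p)) \<le> ennreal (2 powr p) * (ennreal (norm (g0 x) powr p) + ?E x)"
        using AEfin
      proof eventually_elim
        case (elim x)
        let ?S = "\<Sum>j. norm (b j x)"
        have S: "summable (\<lambda>j. norm (b j x))" "?S powr p \<le> enn2real (?E x)" using key[OF elim] by auto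
        have "norm (g x) \<le> norm (g0 x) + ?S"
          unfolding g_def using norm_triangle_ineq4[of "g0 x" "\<Sum>j. b j x"] summable_norm[OF S(1)] by linarith
        then have "norm (g x) powr p \<le> (norm (g0 x) + ?S) powr p" using p by (intro powr_mono2) auto
        also have "\<dots> \<le> 2 powr p * (norm (g0 x) powr p + ?S powr p)"
          using p S(1) by (intro add_powr_le suminf_nonneg) auto
        also have "\<dots> \<le> 2 powr p * (norm (g0 x) powr p + enn2real (?E x))" using S(2) by (intro mult_left_mono) auto
        finally have "ennreal (norm (g x) powr p) \<le> ennreal (2 powr p * (norm (g0 x) powr p + enn2real (?E x)))"
          by (rule ennreal_leI)
        also have "\<dots> = ennreal (2 powr p) * (ennreal (norm (g0 x) powr p) + ?E x)"
          using elim by (simp add: ennreal_mult' less_top)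
        finally show ?case by simp
      qed
    qed
    also have "\<dots> = ennreal (2 powr p) * ((\<integral>\<^sup>+x. ennreal (norm (g0 x) powr p) \<partial>lborel) + (\<integral>\<^sup>+x. ?E x \<partial>lborel))"
      by (subst nn_integral_cmult, measurable) (subst nn_integral_add, auto)
    also have "\<dots> < \<infinity>"
      using Efin g0 by (simp add: ennreal_mult_less_top integrable_iff_bounded)
    finally show "(\<integral>\<^sup>+x. ennreal (norm (norm (g x) powr p)) \<partial>lborel) < \<infinity>" .
  qed measurable
  assume ig0: "integrable lborel (\<lambda>x. g0 x * \<phi> x)"
  obtain B where B: "B \<ge> 0" "\<And>x. norm (\<phi> x) \<le> B" using schwartz_bounded[OF \<phi>] by metis
  note [measurable] = schwartz_measurable[OF \<phi>]
  have Eint: "integrable lborel (\<lambda>x. enn2real (?E x))"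
  proof (rule integrableI_nonneg)
    have "(\<integral>\<^sup>+x. ennreal (enn2real (?E x)) \<partial>lborel) = (\<integral>\<^sup>+x. ?E x \<partial>lborel)"
      using AEfin by (intro nn_integral_cong_AE) (auto simp: less_top)
    then show "(\<integral>\<^sup>+x. ennreal (enn2real (?E x)) \<partial>lborel) < \<infinity>" using Efin by simp
  qed auto
  show "(\<lambda>N. \<integral>x. (g0 x - (\<Sum>j<N. b j x)) * \<phi> x \<partial>lborel) \<longlonglongrightarrow> (\<integral>x. g x * \<phi> x \<partial>lborel)"
  proof (rule integral_dominated_convergence[where w = "\<lambda>x. norm (g0 x * \<phi> x) + (norm (\<phi> x) + B * enn2real (?E x))"])
    show "integrable lborel (\<lambda>x. norm (g0 x * \<phi> x) + (norm (\<phi> x) + B * enn2real (?E x)))"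
      by (intro Bochner_Integration.integrable_add integrable_norm ig0 schwartz_integrable \<phi> integrable_mult_right Eint)
    show "AE x in lborel. (\<lambda>N. (g0 x - (\<Sum>j<N. b j x)) * \<phi> x) \<longlonglongrightarrow> g x * \<phi> x"
      using AEfin
    proof eventually_elim
      case (elim x)
      show ?case unfolding g_def
        using summable_norm_cancel[OF conjunct1[OF key[OF elim]]] by (intro tendsto_intros summable_LIMSEQ)
    qed
    fix N
    show "AE x in lborel. norm ((g0 x - (\<Sum>j<N. b j x)) * \<phi> x) \<le> norm (g0 x * \<phi> x) + (norm (\<phi> x) + B * enn2real (?E x))"
      using AEfin
    proof eventually_elim
      case (elim x)
      have "norm (\<Sum>j<N. b j x) \<le> 1 + enn2real (?E x)"
        using key[OF elim] norm_sum[of "\<lambda>j. b j x" "{..<N}"] by (meson order_trans)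
      then have "norm (\<Sum>j<N. b j x) * norm (\<phi> x) \<le> (1 + enn2real (?E x)) * norm (\<phi> x)" by (intro mult_right_mono) auto
      also have "\<dots> \<le> norm (\<phi> x) + B * enn2real (?E x)"
        using mult_right_mono[OF B(2)[of x], of "enn2real (?E x)"] by (simp add: ring_distribs mult.commute)
      finally have "norm (\<Sum>j<N. b j x) * norm (\<phi> x) \<le> norm (\<phi> x) + B * enn2real (?E x)" .
      then show ?case
        using norm_triangle_ineq4[of "g0 x * \<phi> x" "(\<Sum>j<N. b j x) * \<phi> x"] by (simp add: left_diff_distrib norm_mult)
    qed
  qed measurable
qed

section \<open>Distributions given by integrable functions\<close>

lemma norm_le_schwartz_seminorm:
  assumes "f \<in> schwartz" shows "norm (f x) \<le> schwartz_seminorm 0 f"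
proof -
  obtain C where C: "\<And>x. norm (f x) \<le> C" using schwartz_bounded[OF assms] by metis
  show ?thesis unfolding schwartz_seminorm_def
    by (rule cSup_upper) (auto intro!: exI[of _ x] bdd_aboveI[of _ C] C)
qed

lemma tempered_integrable:
  fixes h :: "'n::finite test"
  assumes h: "integrable lborel h"
  shows "tempered (\<lambda>\<phi>. \<integral>x. h x * \<phi> x \<partial>lborel)"
proof -
  note [measurable] = borel_measurable_integrable[OF h]
  have int: "integrable lborel (\<lambda>x. h x * f x)" if f: "f \<in> schwartz" for f
  proof -
    obtain C where C: "C \<ge> 0" "\<And>x. norm (f x) \<le> C" using schwartz_bounded[OF f] by metis
    note [measurable] = schwartz_measurable[OF f]
    show ?thesis
      by (rule Bochner_Integration.integrable_bound[OF integrable_mult_left[OF integrable_norm[OF h], of C]])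
         (use C in \<open>auto simp: norm_mult abs_mult mult_left_mono\<close>)
  qed
  have "norm (\<integral>x. h x * f x \<partial>lborel) \<le> (\<integral>x. norm (h x) \<partial>lborel) * schwartz_seminorm 0 f" if f: "f \<in> schwartz" for f
  proof -
    have "norm (\<integral>x. h x * f x \<partial>lborel) \<le> (\<integral>x. norm (h x * f x) \<partial>lborel)" by (rule integral_norm_bound)
    also have "\<dots> \<le> (\<integral>x. norm (h x) * schwartz_seminorm 0 f \<partial>lborel)"
      by (intro integral_mono integrable_norm int f integrable_mult_left h)
         (simp add: norm_mult mult_left_mono norm_le_schwartz_seminorm[OF f])
    finally show ?thesis by simp
  qed
  then show ?thesis unfolding tempered_def
    by (intro conjI ballI allI exI[of _ "\<integral>x. norm (h x) \<partial>lborel"] exI[of _ 0])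
       (auto simp: ring_distribs int Bochner_Integration.integral_add mult.left_commute)
qed

lemma not_in_dist_support_integral:
  assumes "open U" "x \<in> U" "\<And>y. y \<in> U \<Longrightarrow> h y = 0"
  shows "x \<notin> dist_support (\<lambda>\<phi>. \<integral>y. h y * \<phi> y \<partial>lborel)"
proof -
  have "(\<integral>y. h y * \<phi> y \<partial>lborel) = 0" if "closure {y. \<phi> y \<noteq> 0} \<subseteq> U" for \<phi> :: "'a test"
  proof -
    have "h y * \<phi> y = 0" for y using that assms(3)[of y] closure_subset[of "{y. \<phi> y \<noteq> 0}"] by auto
    then have "(\<lambda>y. h y * \<phi> y) = (\<lambda>y. 0)" by (intro ext)
    then show ?thesis by simp
  qed
  then show ?thesis unfolding dist_support_def using assms(1,2) by blast
qed

lemma smooth_fun_real_mult_diff: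
  assumes "smooth_fun (\<lambda>x. complex_of_real (h x))" "smooth_fun (\<lambda>x. complex_of_real (f x))"
  shows "smooth_fun (\<lambda>x. complex_of_real (h x * (1 - f x)))"
proof -
  have "smooth_fun (\<lambda>x. complex_of_real (h x) * (1 + (-1) * complex_of_real (f x)))"
    by (intro smooth_fun_mult smooth_fun_add smooth_fun_const smooth_fun_cmult assms)
  then show ?thesis by simp
qed

section \<open>The distribution at order n/p\<close>

text \<open>The sequence H N decreases, so a neighbourhood cleared at one step stays clear. Its
  limit h is bounded with compact support and defines u. Nonvanishing follows by pairing with the
  initial bump, and membership in the space from convergence of the series of potentials of the
  removed pieces.\<close>

theorem exists_critical_distribution:
  fixes A Q :: "(real^'n::finite) set" and p :: real
  assumes A: "interior A \<noteq> {}" and cQ: "countable Q" and Q: "interior A \<subseteq> closure Q" and p: "1 < p"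
  shows "\<exists>u \<in> bessel_space (real CARD('n) / p) p. dist_support u \<subseteq> A - Q \<and> \<not> zero_distr u"
proof -
  let ?s = "real CARD('n) / p"
  have Qne: "Q \<noteq> {}" using A Q by auto
  define q where "q = from_nat_into Q"
  have q: "range q = Q" unfolding q_def by (rule range_from_nat_into[OF Qne cQ])
  obtain x0 where "x0 \<in> interior A" using A by blast
  then obtain r0 where r0: "r0 > 0" "cball x0 r0 \<subseteq> interior A" using open_contains_cball open_interior by blast
  define h0 :: "real^'n \<Rightarrow> real" where "h0 x = bump_real ((1 / r0) *\<^sub>R (x - x0))" for x
  have h0b: "(\<lambda>x. complex_of_real (h0 x)) = bump x0 r0" by (simp add: bump_def h0_def fun_eq_iff)
  have h0r: "0 \<le> h0 x" "h0 x \<le> 1" for x unfolding h0_def by (rule bump_real_range)+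
  have h0S: "(\<lambda>x. complex_of_real (h0 x)) \<in> schwartz" unfolding h0b by (rule bump_schwartz[OF r0(1)])
  have h0z: "h0 x = 0" if "x \<notin> cball x0 r0" for x
    using bump_eq_0[OF r0(1), of x x0] that unfolding h0b[symmetric, THEN fun_cong] by (auto simp: dist_norm norm_minus_commute)
  have h0int: "integrable lborel h0" using integrable_Re[OF schwartz_integrable[OF h0S]] by simp
  have [measurable]: "h0 \<in> borel_measurable borel" using borel_measurable_integrable[OF h0int] by simp
  define I where "I = (\<integral>x. h0 x * h0 x \<partial>lborel)"
  have h0sq: "integrable lborel (\<lambda>x. h0 x * h0 x)"
    by (rule Bochner_Integration.integrable_bound[OF h0int]) (use h0r in \<open>auto simp: abs_mult mult_left_le\<close>)
  have I: "I > 0"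
  proof -
    have "(\<integral>x. indicator (ball x0 (r0 / 2)) x \<partial>lborel) \<le> I" unfolding I_def
    proof (rule integral_mono[OF _ h0sq])
      show "integrable lborel (indicator (ball x0 (r0 / 2)) :: real^'n \<Rightarrow> real)"
        by (intro integrable_real_indicator emeasure_bounded_finite bounded_ball) auto
      fix x show "indicator (ball x0 (r0 / 2)) x \<le> h0 x * h0 x"
      proof (cases "x \<in> ball x0 (r0 / 2)")
        case True
        then have "bump x0 r0 x = 1" using r0 by (intro bump_eq_1) (auto simp: dist_norm norm_minus_commute)
        then have "h0 x = 1" unfolding h0b[symmetric, THEN fun_cong] by simp
        then show ?thesis using True by simp
      qed (use h0r in simp)
    qed
    moreover have "measure lborel (ball x0 (r0 / 2)) > 0" using r0 by (simp add: content_ball_pos)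
    moreover have "(\<integral>x. indicator (ball x0 (r0 / 2)) x \<partial>lborel) = measure lborel (ball x0 (r0 / 2))" by simp
    ultimately show ?thesis by linarith
  qed
  \<comment> \<open>The first entry keeps the total L1 loss at most I / 2; the second is the rate
    that \<open>Lp_series\<close> demands of the p-th powers of the norms.\<close>
  define \<eta> where "\<eta> N = min (I / 2 * (1/2) ^ Suc N) (((1/2) ^ Suc N) powr p)" for N :: nat
  have \<eta>: "\<eta> N > 0" for N using I by (simp add: \<eta>_def)
  define step where "step N h h' \<longleftrightarrow> (\<forall>x. h' x \<le> h x) \<and> (\<exists>\<delta>>0. \<forall>x. norm (x - q N) < \<delta> \<longrightarrow> h' x = 0) \<and>
     (\<lambda>x. complex_of_real (h x - h' x)) \<in> schwartz \<and> (\<integral>x. \<bar>h x - h' x\<bar> \<partial>lborel) \<le> \<eta> N \<and>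
     (\<integral>x. norm (bessel ?s (\<lambda>x. of_real (h x - h' x)) x) powr p \<partial>lborel) \<le> \<eta> N" for N and h h' :: "real^'n \<Rightarrow> real"
  \<comment> \<open>The clause for N = 0 pins the start of the sequence to h0, since dependent
    choice only provides some starting value.\<close>
  define good where "good N h \<longleftrightarrow> smooth_fun (\<lambda>x. complex_of_real (h x)) \<and> (\<forall>x. 0 \<le> h x \<and> h x \<le> 1) \<and> (N = 0 \<longrightarrow> h = h0)"
    for N :: nat and h :: "real^'n \<Rightarrow> real"
  have "\<exists>H. \<forall>N. good N (H N) \<and> step N (H N) (H (Suc N))"
  proof (rule dependent_nat_choice)
    show "\<exists>h. good 0 h" unfolding good_def using h0r h0S by (auto intro: schwartz_smooth)
    fix h N assume "good N h"
    then have h: "smooth_fun (\<lambda>x. complex_of_real (h x))" "\<And>x. 0 \<le> h x" "\<And>x. h x \<le> 1" by (auto simp: good_def)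
    have h1: "norm (complex_of_real (h x)) \<le> 1" for x using h by simp
    obtain \<theta> :: "real^'n \<Rightarrow> real" and \<delta> where \<theta>: "smooth_fun (\<lambda>x. complex_of_real (\<theta> x))" "\<And>x. 0 \<le> \<theta> x" "\<And>x. \<theta> x \<le> 1"
      "\<delta> > 0" "\<And>x. norm (x - q N) < \<delta> \<Longrightarrow> \<theta> x = 1" "(\<lambda>x. complex_of_real (h x) * of_real (\<theta> x)) \<in> schwartz"
      "(\<integral>x. norm (complex_of_real (h x) * of_real (\<theta> x)) \<partial>lborel) \<le> \<eta> N"
      "(\<integral>x. norm (bessel ?s (\<lambda>x. complex_of_real (h x) * of_real (\<theta> x)) x) powr p \<partial>lborel) \<le> \<eta> N"
      by (rule cheap_cutoff[OF p h(1) h1 \<eta>[of N], of "q N"], rule that; assumption?)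
    let ?h' = "\<lambda>x. h x * (1 - \<theta> x)"
    have d: "complex_of_real (h x - ?h' x) = of_real (h x) * of_real (\<theta> x)" for x by (simp add: algebra_simps)
    have d': "\<bar>h x - ?h' x\<bar> = norm (complex_of_real (h x) * of_real (\<theta> x))" for x
      unfolding d[symmetric] norm_of_real ..
    have "good (Suc N) ?h'" unfolding good_def
    proof (intro conjI allI)
      show "smooth_fun (\<lambda>x. complex_of_real (?h' x))" by (rule smooth_fun_real_mult_diff[OF h(1) \<theta>(1)])
      show "0 \<le> ?h' x" for x using h(2)[of x] \<theta>(3)[of x] by simp
      show "?h' x \<le> 1" for x using h(2,3)[of x] \<theta>(2,3)[of x] by (intro mult_le_one) auto
    qed simp
    moreover have "step N h ?h'" unfolding step_def d d'
    proof (intro conjI allI)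
      show "?h' x \<le> h x" for x using h(2)[of x] \<theta>(2)[of x] by (simp add: mult_left_le)
      show "\<exists>\<delta>>0. \<forall>x. norm (x - q N) < \<delta> \<longrightarrow> ?h' x = 0" using \<theta>(4,5) by (intro exI[of _ \<delta>]) auto
    qed (use \<theta> in auto)
    ultimately show "\<exists>h'. good (Suc N) h' \<and> step N h h'" by blast
  qed
  then obtain H where good: "\<And>N. good N (H N)" and step: "\<And>N. step N (H N) (H (Suc N))" by blast
  have H0: "H 0 = h0" using good[of 0] by (simp add: good_def)
  have Hr: "0 \<le> H N x" "H N x \<le> 1" for N x using good[of N] by (auto simp: good_def)
  have Hdec: "decseq (\<lambda>N. H N x)" for x using step by (intro decseq_SucI) (auto simp: step_def)
  define d where "d N x = complex_of_real (H N x - H (Suc N) x)" for N x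
  have dS: "d N \<in> schwartz" for N using step[of N] by (simp add: step_def d_def[abs_def])
  have Hsum: "complex_of_real (H N x) = of_real (h0 x) - (\<Sum>j<N. d j x)" for N x
    by (induction N) (auto simp: H0 d_def)
  have HS: "(\<lambda>x. complex_of_real (H N x)) \<in> schwartz" for N
    unfolding Hsum by (intro schwartz_diff schwartz_sum h0S dS)
  have Hle: "H N x \<le> h0 x" for N x using decseqD[OF Hdec, of 0 N x] by (simp add: H0)
  have "\<exists>l. (\<lambda>N. H N x) \<longlonglongrightarrow> l" for x
  proof (rule decseq_convergent[OF Hdec[of x], of 0])
    show "\<forall>i. 0 \<le> H i x" using Hr(1) by simp
    show "\<exists>l. (\<lambda>N. H N x) \<longlonglongrightarrow> l" if "(\<lambda>N. H N x) \<longlonglongrightarrow> L" for L using that by (rule exI)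
  qed
  then obtain h where h: "\<And>x. (\<lambda>N. H N x) \<longlonglongrightarrow> h x" by metis
  have [measurable]: "H N \<in> borel_measurable borel" for N
    using borel_measurable_integrable[OF integrable_Re[OF schwartz_integrable[OF HS[of N]]]] by simp
  \<comment> \<open>The limit vanishes on the dense set Q although it is not the zero function, so
    it cannot be continuous; measurability and the bounds are inherited from the sequence.\<close>
  have [measurable]: "h \<in> borel_measurable borel" by (rule borel_measurable_LIMSEQ_real[OF h]) auto
  have h0': "0 \<le> h x" for x by (rule LIMSEQ_le_const[OF h]) (use Hr in blast)
  have hH: "h x \<le> H N x" for N x by (rule decseq_ge[OF Hdec h])
  have hle: "h x \<le> h0 x" for x using hH[of x 0] by (simp add: H0)
  have hz: "h x = 0" if "x \<notin> cball x0 r0" for x using h0'[of x] hle[of x] h0z[OF that] by linarith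
  let ?h = "\<lambda>x. complex_of_real (h x)"
  have hint: "integrable lborel ?h"
    by (rule Bochner_Integration.integrable_bound[OF h0int]) (use h0' hle h0r in auto)
  define u :: "'n distr" where "u \<phi> = (\<integral>x. ?h x * \<phi> x \<partial>lborel)" for \<phi>
  have u_eq: "u = (\<lambda>\<phi>. \<integral>x. ?h x * \<phi> x \<partial>lborel)" by (simp add: u_def fun_eq_iff)
  have lim: "(\<lambda>N. \<integral>x. complex_of_real (H N x) * \<phi> x \<partial>lborel) \<longlonglongrightarrow> u \<phi>" if \<phi>: "\<phi> \<in> schwartz" for \<phi>
    unfolding u_def
  proof (rule integral_dominated_convergence[where w = "\<lambda>x. norm (\<phi> x)"])
    note [measurable] = schwartz_measurable[OF \<phi>]
    show "(\<lambda>x. ?h x * \<phi> x) \<in> borel_measurable lborel" "(\<lambda>x. complex_of_real (H N x) * \<phi> x) \<in> borel_measurable lborel" for N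
      by measurable
    show "integrable lborel (\<lambda>x. norm (\<phi> x))" by (intro integrable_norm schwartz_integrable \<phi>)
    show "AE x in lborel. (\<lambda>N. complex_of_real (H N x) * \<phi> x) \<longlonglongrightarrow> ?h x * \<phi> x"
      by (intro AE_I2 tendsto_intros h)
    show "AE x in lborel. norm (complex_of_real (H N x) * \<phi> x) \<le> norm (\<phi> x)" for N
      using Hr by (intro AE_I2) (simp add: norm_mult mult_left_le_one_le)
  qed

  have supp: "dist_support u \<subseteq> A - Q"
  proof
    fix x assume x: "x \<in> dist_support u"
    have "x \<in> cball x0 r0"
    proof (rule ccontr)
      assume "x \<notin> cball x0 r0"
      then have "x \<notin> dist_support u" unfolding u_eq
        by (intro not_in_dist_support_integral[of "- cball x0 r0"]) (use hz in \<open>auto simp: open_Compl\<close>)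
      with x show False by simp
    qed
    \<comment> \<open>Step N clears a ball around the N-th point of Q, and 0 \<le> h \<le> H (Suc N)
      keeps h zero there.\<close>
    moreover have "x \<notin> Q"
    proof
      assume "x \<in> Q"
      then obtain N where N: "x = q N" using q by blast
      obtain \<delta> where \<delta>: "\<delta> > 0" "\<And>y. norm (y - q N) < \<delta> \<Longrightarrow> H (Suc N) y = 0" using step[of N] by (auto simp: step_def)
      have "?h y = 0" if "y \<in> ball x \<delta>" for y
        using \<delta>(2)[of y] that hH[of y "Suc N"] h0'[of y] by (simp add: N dist_norm norm_minus_commute)
      then have "x \<notin> dist_support u" unfolding u_eq
        using \<delta>(1) by (intro not_in_dist_support_integral[of "ball x \<delta>"]) auto
      with x show False by simp
    qed
    ultimately show "x \<in> A - Q" using r0(2) interior_subset by blast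
  qed

  have nz: "\<not> zero_distr u"
  proof
    assume z: "zero_distr u"
    let ?\<phi> = "\<lambda>x. complex_of_real (h0 x)"
    have dint: "integrable lborel (\<lambda>x. H j x - H (Suc j) x)" for j
      using integrable_Re[OF schwartz_integrable[OF dS[of j]]] by (simp add: d_def)
    have dh0: "integrable lborel (\<lambda>x. (H j x - H (Suc j) x) * h0 x)" for j
      by (rule Bochner_Integration.integrable_bound[OF dint[of j]]) (use h0r in \<open>auto simp: abs_mult mult_left_le\<close>)
    have dle: "(\<integral>x. (H j x - H (Suc j) x) * h0 x \<partial>lborel) \<le> I / 2 * (1/2) ^ Suc j" for j
    proof -
      have "(\<integral>x. (H j x - H (Suc j) x) * h0 x \<partial>lborel) \<le> (\<integral>x. \<bar>H j x - H (Suc j) x\<bar> \<partial>lborel)"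
      proof (intro integral_mono dh0 integrable_abs dint)
        fix x
        have "0 \<le> H j x - H (Suc j) x" using decseqD[OF Hdec, of j "Suc j" x] by simp
        then show "(H j x - H (Suc j) x) * h0 x \<le> \<bar>H j x - H (Suc j) x\<bar>" using h0r[of x] by (simp add: mult_left_le)
      qed
      also have "\<dots> \<le> \<eta> j" using step[of j] unfolding step_def by (elim conjE)
      also have "\<dots> \<le> I / 2 * (1/2) ^ Suc j" unfolding \<eta>_def by (rule min.cobounded1)
      finally show ?thesis .
    qed
    \<comment> \<open>Telescoping: pairing H N with h0 gives I minus the losses of the first N
      steps, and these are bounded by a geometric series with sum I / 2.\<close>
    have "I / 2 \<le> Re (\<integral>x. complex_of_real (H N x) * ?\<phi> x \<partial>lborel)" for N
    proof -
      have "H N x * h0 x = h0 x * h0 x - (\<Sum>j<N. (H j x - H (Suc j) x) * h0 x)" for x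
      proof -
        have "H N x = h0 x - (\<Sum>j<N. H j x - H (Suc j) x)" by (induction N) (auto simp: H0)
        then show ?thesis by (simp add: left_diff_distrib sum_distrib_right)
      qed
      then have "(\<integral>x. H N x * h0 x \<partial>lborel) = I - (\<Sum>j<N. \<integral>x. (H j x - H (Suc j) x) * h0 x \<partial>lborel)"
        unfolding I_def using dh0 h0sq by (simp add: Bochner_Integration.integral_diff Bochner_Integration.integral_sum)
      moreover have "(\<Sum>j<N. \<integral>x. (H j x - H (Suc j) x) * h0 x \<partial>lborel) \<le> (\<Sum>j<N. I / 2 * (1/2) ^ Suc j)"
        by (intro sum_mono dle)
      moreover have "(\<Sum>j<N. I / 2 * (1/2) ^ Suc j) = I / 2 * (\<Sum>j<N. (1/2) ^ Suc j)" by (simp add: sum_distrib_left)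
      moreover have "(\<Sum>j<N. (1/2) ^ Suc j) \<le> (1::real)"
        using sum_le_suminf[OF sums_summable[OF power_half_series], of "{..<N}"] sums_unique[OF power_half_series] by simp
      then have "I / 2 * (\<Sum>j<N. (1/2) ^ Suc j) \<le> I / 2 * 1" using I by (intro mult_left_mono) auto
      ultimately have "I / 2 \<le> (\<integral>x. H N x * h0 x \<partial>lborel)" by linarith
      also have "\<dots> = Re (\<integral>x. complex_of_real (H N x * h0 x) \<partial>lborel)" unfolding integral_complex_of_real by simp
      finally show ?thesis by simp
    qed
    moreover have "(\<lambda>N. Re (\<integral>x. complex_of_real (H N x) * ?\<phi> x \<partial>lborel)) \<longlonglongrightarrow> Re (u ?\<phi>)"
      by (intro tendsto_Re lim h0S)
    ultimately have "I / 2 \<le> Re (u ?\<phi>)" by (intro LIMSEQ_le_const) auto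
    with z h0S I show False by (auto simp: zero_distr_def)
  qed

  \<comment> \<open>The candidate density: H N is h0 minus the sum of the pieces d j with j < N, and
    g is the corresponding limit of potentials.\<close>
  define g where "g x = bessel ?s (\<lambda>x. of_real (h0 x)) x - (\<Sum>j. bessel ?s (d j) x)" for x
  have g_eq: "g = (\<lambda>x. bessel ?s (\<lambda>x. of_real (h0 x)) x - (\<Sum>j. bessel ?s (d j) x))" by (simp add: g_def fun_eq_iff)
  have bm: "bessel ?s (d j) \<in> borel_measurable borel" "bessel ?s (\<lambda>x. of_real (h0 x)) \<in> borel_measurable borel" for j
    by (intro schwartz_measurable schwartz_bessel dS h0S)+
  have bi: "integrable lborel (\<lambda>x. norm (bessel ?s (d j) x) powr p)" "integrable lborel (\<lambda>x. norm (bessel ?s (\<lambda>x. of_real (h0 x)) x) powr p)" for j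
    using p by (intro schwartz_powr_integrable schwartz_bessel dS h0S; simp)+
  have bb: "(\<integral>x. norm (bessel ?s (d j) x) powr p \<partial>lborel) \<le> ((1/2) ^ Suc j) powr p" for j
  proof -
    have "(\<integral>x. norm (bessel ?s (d j) x) powr p \<partial>lborel) \<le> \<eta> j"
      using step[of j] unfolding step_def d_def[abs_def] by (elim conjE)
    also have "\<dots> \<le> ((1/2) ^ Suc j) powr p" unfolding \<eta>_def by (rule min.cobounded2)
    finally show ?thesis .
  qed
  note L = Lp_series[OF p bm bi(1) bb bi(2), folded g_eq]
  \<comment> \<open>Both sides are limits of one sequence. Since H N is Schwartz, symmetry moves the
    potential from \<phi> onto H N, where it is the potential of h0 minus a finite sum.\<close>
  have "u (bessel ?s \<phi>) = (\<integral>x. g x * \<phi> x \<partial>lborel)" if \<phi>: "\<phi> \<in> schwartz" for \<phi>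
  proof (rule LIMSEQ_unique)
    show "(\<lambda>N. \<integral>x. complex_of_real (H N x) * bessel ?s \<phi> x \<partial>lborel) \<longlonglongrightarrow> u (bessel ?s \<phi>)"
      by (intro lim schwartz_bessel \<phi>)
    have "(\<integral>x. complex_of_real (H N x) * bessel ?s \<phi> x \<partial>lborel) =
       (\<integral>x. (bessel ?s (\<lambda>x. of_real (h0 x)) x - (\<Sum>j<N. bessel ?s (d j) x)) * \<phi> x \<partial>lborel)" for N
    proof -
      have "(\<lambda>x. complex_of_real (H N x)) = (\<lambda>x. of_real (h0 x) + (-1) * (\<Sum>j<N. d j x))" by (simp add: Hsum)
      then have "bessel ?s (\<lambda>x. complex_of_real (H N x)) = (\<lambda>x. bessel ?s (\<lambda>x. of_real (h0 x)) x - (\<Sum>j<N. bessel ?s (d j) x))"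
        by (simp only: bessel_add[OF h0S schwartz_cmult[OF schwartz_sum[OF dS]]] bessel_cmult bessel_sum[OF dS]) simp
      then show ?thesis using bessel_symmetric[OF HS \<phi>, of ?s N] by simp
    qed
    moreover have "integrable lborel (\<lambda>x. bessel ?s (\<lambda>x. of_real (h0 x)) x * \<phi> x)"
    proof -
      obtain B where B: "B \<ge> 0" "\<And>x. norm (\<phi> x) \<le> B" using schwartz_bounded[OF \<phi>] by metis
      note [measurable] = schwartz_measurable[OF \<phi>] bm(2)
      show ?thesis
        by (rule Bochner_Integration.integrable_bound[OF integrable_mult_left[OF integrable_norm[OF schwartz_integrable[OF schwartz_bessel[OF h0S, of ?s]]], of B]])
           (use B in \<open>auto simp: norm_mult abs_mult mult_left_mono\<close>)
    qed
    ultimately show "(\<lambda>N. \<integral>x. complex_of_real (H N x) * bessel ?s \<phi> x \<partial>lborel) \<longlonglongrightarrow> (\<integral>x. g x * \<phi> x \<partial>lborel)"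
      using L(3)[OF \<phi>] by (simp add: g_def)
  qed
  moreover have "g \<in> borel_measurable lborel" "integrable lborel (\<lambda>x. norm (g x) powr p)" using L(1,2)[OF h0S] by (simp_all add: g_def)
  moreover have "tempered u" unfolding u_eq by (rule tempered_integrable[OF hint])
  ultimately have "u \<in> bessel_space ?s p" unfolding bessel_space_iff by blast
  with supp nz show ?thesis by blast
qed

theorem theorem2p22:
  fixes A Q :: "(real^'n::finite) set" and p :: real
  assumes "interior A \<noteq> {}"
    and "Q \<subseteq> A" and "countable Q" and "interior A \<subseteq> closure Q"
    and "1 < p"
  shows "\<not> null_set (real CARD('n) / p) p (A - Q) \<and>
         nullity_threshold p (A - Q) = real CARD('n) / p"
proof -
  let ?s = "real CARD('n) / p"
  obtain u where u: "u \<in> bessel_space ?s p" "dist_support u \<subseteq> A - Q" "\<not> zero_distr u"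
    using exists_critical_distribution[OF assms(1,3,4,5)] by blast
  \<comment> \<open>One distribution serves all orders s \<le> n/p, because the spaces decrease in
    s.\<close>
  have not_null: "\<not> null_set s p (A - Q)" if "s \<le> ?s" for s
  proof -
    have "u \<in> bessel_space s p"
      using u(1) bessel_space_mono[OF u(1) _ assms(5), of s] that by (cases "s = ?s") auto
    with u show ?thesis unfolding null_set_def by blast
  qed
  \<comment> \<open>The null orders form a nonempty half-line bounded below, so its
    \<open>Inf\<close> is a genuine infimum; the critical order itself is not attained.\<close>
  have "{s. null_set s p (A - Q)} = {?s<..}"
    using not_null null_set_supercritical[OF assms(4,5)] by (auto simp: not_le[symmetric])
  then have "nullity_threshold p (A - Q) = ?s"
    unfolding nullity_threshold_def by simp
  with not_null show ?thesis by blast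
qed

end
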